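(* Let $G\le F\ne1$ be groups with $G\in\mathcal{C}$ and $F$ finitely generated and left orderable. Then there exists a left-relatively convex subgroup $B$ of $F$ with $B\ne F$ and $B\cap G\lhd G$, such that $G/(B\cap G)$ has a torsion free abelian normal subgroup $A/(B\cap G)$ which is its own centralizer in $G/(B\cap G)$, and $G/A$ is torsion free abelian.
   Context: A subgroup of a group $F$ is left-relatively convex if it is convex with respect to some left order on $F$ (a total order with $x\le y\Rightarrow fx\le fy$). Let $\mathcal{P}$ be the group of piecewise linear orientation preserving self-homeomorphisms of $[0,1]$ and $\mathrm{NS}$ the class of groups with no nonabelian free subsemigroup. $\mathcal{C}$ is the smallest class of groups containing all $\mathrm{NS}$-groups and $\mathcal{P}$, and closed under subgroups, homomorphic images, group extensions and directed unions. *)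

theory Defs
  imports "HOL-Analysis.Analysis" "HOL-Algebra.Algebra"
begin

definition left_order :: "('a, 'b) monoid_scheme \<Rightarrow> 'a rel \<Rightarrow> bool" where
  "left_order F R \<longleftrightarrow> R \<subseteq> carrier F \<times> carrier F \<and> linear_order_on (carrier F) R \<and>
     (\<forall>f\<in>carrier F. \<forall>x\<in>carrier F. \<forall>y\<in>carrier F.
        (x, y) \<in> R \<longrightarrow> (f \<otimes>\<^bsub>F\<^esub> x, f \<otimes>\<^bsub>F\<^esub> y) \<in> R)"

definition left_orderable :: "('a, 'b) monoid_scheme \<Rightarrow> bool" where
  "left_orderable F \<longleftrightarrow> (\<exists>R. left_order F R)"

definition convex_wrt :: "('a, 'b) monoid_scheme \<Rightarrow> 'a rel \<Rightarrow> 'a set \<Rightarrow> bool" where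
  "convex_wrt F R B \<longleftrightarrow> subgroup B F \<and>
     (\<forall>x\<in>B. \<forall>z\<in>B. \<forall>y\<in>carrier F. (x, y) \<in> R \<and> (y, z) \<in> R \<longrightarrow> y \<in> B)"

definition left_rel_convex :: "('a, 'b) monoid_scheme \<Rightarrow> 'a set \<Rightarrow> bool" where
  "left_rel_convex F B \<longleftrightarrow> (\<exists>R. left_order F R \<and> convex_wrt F R B)"

definition fin_gen :: "('a, 'b) monoid_scheme \<Rightarrow> bool" where
  "fin_gen F \<longleftrightarrow> (\<exists>S. finite S \<and> S \<subseteq> carrier F \<and> generate F S = carrier F)"

definition torsion_free :: "('a, 'b) monoid_scheme \<Rightarrow> bool" where
  "torsion_free G \<longleftrightarrow> (\<forall>x\<in>carrier G. \<forall>n::nat. n > 0 \<and> x [^]\<^bsub>G\<^esub> n = \<one>\<^bsub>G\<^esub> \<longrightarrow> x = \<one>\<^bsub>G\<^esub>)"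

definition centralizer_of :: "('a, 'b) monoid_scheme \<Rightarrow> 'a set \<Rightarrow> 'a set" where
  "centralizer_of G A = {g \<in> carrier G. \<forall>a\<in>A. g \<otimes>\<^bsub>G\<^esub> a = a \<otimes>\<^bsub>G\<^esub> g}"

definition word_eval :: "('a, 'b) monoid_scheme \<Rightarrow> 'a \<Rightarrow> 'a \<Rightarrow> bool list \<Rightarrow> 'a" where
  "word_eval G x y w = foldr (\<lambda>b acc. (if b then x else y) \<otimes>\<^bsub>G\<^esub> acc) w \<one>\<^bsub>G\<^esub>"

text \<open>x, y freely generate a free subsemigroup of rank 2 iff distinct nonempty positive
  words in x, y evaluate to distinct elements.\<close>
definition NS_group :: "('a, 'b) monoid_scheme \<Rightarrow> bool" where
  "NS_group G \<longleftrightarrow> group G \<and> (\<forall>x\<in>carrier G. \<forall>y\<in>carrier G.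
     \<exists>w1 w2. w1 \<noteq> [] \<and> w2 \<noteq> [] \<and> w1 \<noteq> w2 \<and> word_eval G x y w1 = word_eval G x y w2)"

definition pl_homeo :: "(real \<Rightarrow> real) \<Rightarrow> bool" where
  "pl_homeo f \<longleftrightarrow> (\<forall>x. x \<notin> {0..1} \<longrightarrow> f x = x) \<and>
     continuous_on {0..1} f \<and> strict_mono_on {0..1} f \<and> f 0 = 0 \<and> f 1 = 1 \<and>
     (\<exists>T. finite T \<and> T \<subseteq> {0..1} \<and> 0 \<in> T \<and> 1 \<in> T \<and>
        (\<forall>a\<in>T. \<forall>b\<in>T. a < b \<and> {a<..<b} \<inter> T = {} \<longrightarrow>
           (\<exists>m c. \<forall>x\<in>{a..b}. f x = m * x + c)))"

definition PL_group :: "(real \<Rightarrow> real) monoid" where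
  "PL_group = \<lparr>carrier = {f. pl_homeo f}, mult = (\<circ>), one = id\<rparr>"

text \<open>Membership in C for groups living on a universe type 'u (closure under isomorphism
  is built in via homomorphic images).  A group of any type is in C if it is isomorphic to
  some inC-group on some universe type.\<close>
inductive inC :: "'u monoid \<Rightarrow> bool" where
  NS: "NS_group H \<Longrightarrow> inC H"
| P: "group H \<Longrightarrow> H \<cong> PL_group \<Longrightarrow> inC H"
| sub: "inC H \<Longrightarrow> subgroup S H \<Longrightarrow> inC (H\<lparr>carrier := S\<rparr>)"
| image: "inC H \<Longrightarrow> group K \<Longrightarrow> h \<in> hom H K \<Longrightarrow> h ` carrier H = carrier K \<Longrightarrow> inC K"
| ext: "group H \<Longrightarrow> N \<lhd> H \<Longrightarrow> inC (H\<lparr>carrier := N\<rparr>) \<Longrightarrow> inC K \<Longrightarrow> K \<cong> H Mod N \<Longrightarrow> inC H"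
| union: "group H \<Longrightarrow> \<S> \<noteq> {} \<Longrightarrow> (\<forall>S\<in>\<S>. subgroup S H \<and> inC (H\<lparr>carrier := S\<rparr>)) \<Longrightarrow>
          (\<forall>S\<in>\<S>. \<forall>T\<in>\<S>. \<exists>U\<in>\<S>. S \<union> T \<subseteq> U) \<Longrightarrow> \<Union>\<S> = carrier H \<Longrightarrow> inC H"

end

theory Submission
  imports Defs
begin

text \<open>
  Even \<open>G / (B \<inter> G)\<close> can be made torsion free abelian, so that \<open>A = G\<close> works. The left preorders on
  \<open>F\<close> that are not trivial form a compact set, because \<open>F\<close> is finitely generated, and the stabilizer
  of each of them is left-relatively convex in \<open>F\<close>. It suffices to find one whose restriction
  to \<open>G\<close> is Archimedean, since by Hoelder's theorem it is then induced by a homomorphism to the reals.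
  The restrictions to \<open>G\<close> form a closed set that contains, with each preorder, the preorders
  defined by its cuts. Call \<open>G\<close> tame if every such set contains an Archimedean preorder.

  Tameness passes to directed unions by compactness. For an extension of a tame group \<open>N\<close> choose
  a preorder that is Archimedean on \<open>N\<close>. If the extension acts nontrivially on the value group
  of \<open>N\<close>, then moving the base point to infinity yields an Archimedean preorder. Otherwise \<open>N\<close> becomes
  central: a quotient without free subsemigroups then forces Conrad's condition, and for a
  quotient that is a group of piecewise linear homeomorphisms one uses that elements with support in a
  compact part of an orbital commute with a conjugate of themselves.
\<close>

text \<open>Only preorders on \<open>G\<close> that extend to \<open>F\<close> are available, so an
  Archimedean one cannot simply be constructed on \<open>G\<close>. It has to be reached from a
  given preorder by limits and cuts, and both can be carried out on \<open>F\<close>. A limit may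
  become trivial on \<open>G\<close>. This does no harm: the trivial preorder counts as Archimedean,
  and \<open>B\<close> then contains \<open>G\<close>. Finite generation keeps the preorder
  nontrivial on \<open>F\<close>, and this is what makes \<open>B\<close> a proper subgroup.

  The induction over the class is not run on tameness itself: a preorder on a subgroup need not
  extend to the group, so it is unclear how tameness could be inherited by subgroups. The invariant
  is that extensions of arbitrary tame groups by subquotients of the given group are tame. It passes
  to subgroups and images almost by definition, and to extensions by composing two extensions. The
  price is that in both base cases relations hold only modulo a tame kernel \<open>N\<close>. They
  are first improved to relations modulo the kernel of a homomorphism from \<open>N\<close> to the
  reals.\<close>

declare add_uminus_conv_diff [simp del]

section \<open>Groups, left preorders and cuts\<close>

lemmas grp = add.assoc minus_add

text \<open>Groups are subgroups of a type of class \<open>group_add\<close>, which is not commutative in spite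
  of the additive notation.\<close>
definition sgp :: "'g::group_add set \<Rightarrow> bool" where
  "sgp N \<longleftrightarrow> 0 \<in> N \<and> (\<forall>x\<in>N. \<forall>y\<in>N. x + y \<in> N) \<and> (\<forall>x\<in>N. - x \<in> N)"

definition normal_in :: "'g::group_add set \<Rightarrow> 'g set \<Rightarrow> bool" where
  "normal_in K M \<longleftrightarrow> sgp K \<and> K \<subseteq> M \<and> (\<forall>m\<in>M. \<forall>k\<in>K. m + k + - m \<in> K)"

primrec mul :: "nat \<Rightarrow> 'g::group_add \<Rightarrow> 'g" where
  "mul 0 g = 0"
| "mul (Suc n) g = g + mul n g"

text \<open>A total left-invariant preorder is represented by the set of its elements that are \<open>\<ge> 0\<close>.\<close>
definition preord :: "'g::group_add set \<Rightarrow> 'g set \<Rightarrow> bool" where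
  "preord N P \<longleftrightarrow> P \<subseteq> N \<and> (\<forall>x\<in>P. \<forall>y\<in>P. x + y \<in> P) \<and> (\<forall>x\<in>N. x \<in> P \<or> - x \<in> P)"

definition cle :: "'g::group_add set \<Rightarrow> 'g \<Rightarrow> 'g \<Rightarrow> bool" where
  "cle P x y \<longleftrightarrow> - x + y \<in> P"

definition downset :: "'g::group_add set \<Rightarrow> 'g set \<Rightarrow> 'g set \<Rightarrow> bool" where
  "downset N P D \<longleftrightarrow> D \<subseteq> N \<and> D \<noteq> {} \<and> D \<noteq> N \<and> (\<forall>d\<in>D. \<forall>m\<in>N. cle P m d \<longrightarrow> m \<in> D)"

text \<open>The preorder that compares \<open>g\<close> and \<open>h\<close> by the inclusion of \<open>g + D\<close> and \<open>h + D\<close>.\<close>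
definition cut_cone :: "'g::group_add set \<Rightarrow> 'g set \<Rightarrow> 'g set" where
  "cut_cone N D = {h \<in> N. \<forall>d\<in>D. - h + d \<in> D}"

text \<open>Closedness in the product topology on the powerset.\<close>
definition lim_closed :: "'a set set \<Rightarrow> bool" where
  "lim_closed Z \<longleftrightarrow> (\<forall>Q. (\<forall>W. finite W \<longrightarrow> (\<exists>P\<in>Z. P \<inter> W = Q \<inter> W)) \<longrightarrow> Q \<in> Z)"

text \<open>Every construction takes place inside such a set: limits and cuts are the two ways to
  modify a preorder without leaving it.\<close>

definition good :: "'g::group_add set \<Rightarrow> 'g set set \<Rightarrow> bool" where
  "good N Z \<longleftrightarrow> Z \<noteq> {} \<and> (\<forall>P\<in>Z. preord N P) \<and> lim_closed Z \<and>
     (\<forall>P\<in>Z. \<forall>D. downset N P D \<longrightarrow> cut_cone N D \<in> Z)"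

text \<open>This includes the trivial preorder \<open>P = N\<close>.\<close>
definition arch :: "'g::group_add set \<Rightarrow> 'g set \<Rightarrow> bool" where
  "arch N P \<longleftrightarrow> (\<forall>a\<in>N. - a \<notin> P \<longrightarrow> (\<forall>y\<in>N. \<exists>n. cle P y (mul n a)))"

text \<open>\<open>Z\<close> may live on a larger group than \<open>N\<close>; the preorder found on
  \<open>N\<close> is then the trace of one on the larger group.\<close>

definition has_arch :: "'g::group_add set \<Rightarrow> 'g set set \<Rightarrow> bool" where
  "has_arch N Z \<longleftrightarrow> (\<exists>P\<in>Z. arch N (P \<inter> N))"

subsection \<open>Compactness\<close>

text \<open>Conditions that inspect finitely many elements are the ones that compactness is applied
  to throughout.\<close>

lemma lim_closed_finitary:
  assumes "finite W" "\<And>P Q. P \<inter> W = Q \<inter> W \<Longrightarrow> C P \<Longrightarrow> C Q"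
  shows "lim_closed {P. C P}"
  unfolding lim_closed_def using assms by (metis mem_Collect_eq)

lemma lim_closed_Inter: "(\<And>Y. Y \<in> \<F> \<Longrightarrow> lim_closed Y) \<Longrightarrow> lim_closed (\<Inter>\<F>)"
  unfolding lim_closed_def by (metis InterE InterI)

lemma lim_closed_Int: "lim_closed Y \<Longrightarrow> lim_closed Z \<Longrightarrow> lim_closed (Y \<inter> Z)"
  unfolding lim_closed_def by (metis IntD1 IntD2 IntI)

lemma lim_closed_imp_closed:
  assumes "lim_closed Z"
  shows "closed {f :: 'a \<Rightarrow> bool. Collect f \<in> Z}"
proof -
  have "open (- {f :: 'a \<Rightarrow> bool. Collect f \<in> Z})"
  proof (subst open_subopen, intro ballI)
    fix f :: "'a \<Rightarrow> bool" assume "f \<in> - {f. Collect f \<in> Z}"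
    then obtain W where W: "finite W" "\<And>P. P \<in> Z \<Longrightarrow> P \<inter> W \<noteq> Collect f \<inter> W"
      using assms unfolding lim_closed_def by (metis ComplD mem_Collect_eq)
    let ?V = "\<Inter>x\<in>W. (\<lambda>g :: 'a \<Rightarrow> bool. g x) -` {f x}"
    have "open ((\<lambda>g :: 'a \<Rightarrow> bool. g x) -` {f x})" for x
      by (rule open_vimage) (auto intro: open_discrete continuous_on_product_coordinates)
    then have "open ?V" using W(1) by (intro open_INT) auto
    moreover have "f \<in> ?V" by auto
    moreover have "?V \<subseteq> - {f. Collect f \<in> Z}"
    proof
      fix g assume "g \<in> ?V"
      then have "Collect g \<inter> W = Collect f \<inter> W" by auto
      then show "g \<in> - {f. Collect f \<in> Z}" using W(2) by auto
    qed
    ultimately show "\<exists>T. open T \<and> f \<in> T \<and> T \<subseteq> - {f. Collect f \<in> Z}" by blast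
  qed
  then show ?thesis by (simp add: closed_def)
qed

lemma compact_powerset: "compact (UNIV :: ('a \<Rightarrow> bool) set)"
proof -
  have "compact_space (product_topology (\<lambda>_. euclidean :: bool topology) (UNIV :: 'a set))"
    unfolding compact_space_product_topology
    by (auto simp: compact_space_def compactin_euclidean_iff intro!: finite_imp_compact)
  then show ?thesis
    by (simp add: euclidean_product_topology compact_space_def)
qed

lemma compactness:
  fixes \<C> :: "'a set set set"
  assumes "\<And>C. C \<in> \<C> \<Longrightarrow> lim_closed C"
    and "\<And>\<C>0. finite \<C>0 \<Longrightarrow> \<C>0 \<subseteq> \<C> \<Longrightarrow> \<exists>P. \<forall>C\<in>\<C>0. P \<in> C"
  shows "\<exists>P. \<forall>C\<in>\<C>. P \<in> C"
proof -
  let ?h = "\<lambda>C. {f :: 'a \<Rightarrow> bool. Collect f \<in> C}"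
  have "UNIV \<inter> \<Inter>(?h ` \<C>) \<noteq> {}"
  proof (rule compact_imp_fip[OF compact_powerset])
    fix T assume "T \<in> ?h ` \<C>" then show "closed T"
      using assms(1) lim_closed_imp_closed by auto
  next
    fix \<F> assume "finite \<F>" "\<F> \<subseteq> ?h ` \<C>"
    then obtain \<C>0 where C0: "\<C>0 \<subseteq> \<C>" "finite \<C>0" "\<F> = ?h ` \<C>0"
      by (meson finite_subset_image)
    then obtain P where "\<forall>C\<in>\<C>0. P \<in> C" using assms(2) by blast
    then have "(\<lambda>x. x \<in> P) \<in> \<Inter>\<F>" using C0(3) by auto
    then show "UNIV \<inter> \<Inter>\<F> \<noteq> {}" by blast
  qed
  then show ?thesis by auto
qed

lemma compactness_indexed:
  assumes "lim_closed Z" and "\<And>i. i \<in> I \<Longrightarrow> lim_closed {P. C i P}"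
    and "\<And>J. finite J \<Longrightarrow> J \<subseteq> I \<Longrightarrow> \<exists>P\<in>Z. \<forall>i\<in>J. C i P"
  shows "\<exists>P\<in>Z. \<forall>i\<in>I. C i P"
proof -
  have "\<exists>P. \<forall>S\<in>insert Z ((\<lambda>i. {P. C i P}) ` I). P \<in> S"
  proof (rule compactness)
    fix S assume "S \<in> insert Z ((\<lambda>i. {P. C i P}) ` I)"
    then show "lim_closed S" using assms by auto
  next
    fix \<F> assume F: "finite \<F>" "\<F> \<subseteq> insert Z ((\<lambda>i. {P. C i P}) ` I)"
    then have "finite (\<F> - {Z})" "\<F> - {Z} \<subseteq> (\<lambda>i. {P. C i P}) ` I" by auto
    then obtain J where "J \<subseteq> I" "finite J" "\<F> - {Z} = (\<lambda>i. {P. C i P}) ` J"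
      by (meson finite_subset_image)
    moreover from this obtain P where "P \<in> Z" "\<forall>i\<in>J. C i P" using assms(3) by blast
    ultimately have "P \<in> S" if "S \<in> \<F>" for S
      using that by (cases "S = Z") blast+
    then show "\<exists>P. \<forall>S\<in>\<F>. P \<in> S" by blast
  qed
  then show ?thesis by auto
qed

subsection \<open>Left preorders\<close>

lemma sgp_zero: "sgp N \<Longrightarrow> 0 \<in> N"
  and sgp_add: "sgp N \<Longrightarrow> x \<in> N \<Longrightarrow> y \<in> N \<Longrightarrow> x + y \<in> N"
  and sgp_minus: "sgp N \<Longrightarrow> x \<in> N \<Longrightarrow> - x \<in> N"
  by (auto simp: sgp_def)

lemma sgp_mul: "sgp N \<Longrightarrow> x \<in> N \<Longrightarrow> mul n x \<in> N"
  by (induction n) (auto simp: sgp_zero sgp_add)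

lemmas sgpI = sgp_zero sgp_add sgp_minus sgp_mul

lemma mul_comm: "mul n g + g = g + mul n g"
  by (induction n) (auto simp: add.assoc)

lemma mul_add: "mul (m + n) g = mul m g + mul n g"
  by (induction m) (auto simp: add.assoc)

lemma mul_mult: "mul (m * n) g = mul m (mul n g)"
  by (induction m) (auto simp: mul_add)

lemma mul_conj: "mul n (x + g + - x) = x + mul n g + - x"
  by (induction n) (simp_all add: grp)

lemma mul_minus: "mul n (- g) = - mul n g"
proof (induction n)
  case (Suc n)
  have "- (mul n g + g) = - (g + mul n g)" by (simp only: mul_comm)
  then show ?case using Suc by (simp add: minus_add)
qed simp

lemma cle_left [simp]: "cle P (g + x) (g + y) \<longleftrightarrow> cle P x y"
  by (simp add: cle_def grp)

lemma cle_zero_right: "cle P x 0 \<longleftrightarrow> - x \<in> P"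
  by (simp add: cle_def)

lemma cle_shift: "cle P (- g + x) y \<longleftrightarrow> cle P x (g + y)"
  using cle_left[of P g "- g + x" y] by (simp add: grp)

context
  fixes N P :: "'g::group_add set"
  assumes N: "sgp N" and P: "preord N P"
begin

lemma cone_sub: "x \<in> P \<Longrightarrow> x \<in> N" and cone_add: "x \<in> P \<Longrightarrow> y \<in> P \<Longrightarrow> x + y \<in> P"
  and cone_total: "x \<in> N \<Longrightarrow> x \<notin> P \<Longrightarrow> - x \<in> P"
  using P by (auto simp: preord_def)

lemma cone_zero: "0 \<in> P"
  using cone_total[of 0] sgp_zero[OF N] by auto

lemma cle_refl: "cle P x x"
  by (simp add: cle_def cone_zero)

lemma cle_trans: "cle P x y \<Longrightarrow> cle P y z \<Longrightarrow> cle P x z"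
  using cone_add[of "- x + y" "- y + z"] by (simp add: cle_def grp)

lemma cle_total: "x \<in> N \<Longrightarrow> y \<in> N \<Longrightarrow> \<not> cle P x y \<Longrightarrow> cle P y x"
  using cone_total[of "- x + y"] N by (simp add: cle_def sgpI grp)

lemma cone_mul: "x \<in> P \<Longrightarrow> mul n x \<in> P"
  by (induction n) (auto simp: cone_zero cone_add)

lemma cle_mul_mono: "x \<in> P \<Longrightarrow> m \<le> n \<Longrightarrow> cle P (mul m x) (mul n x)"
  using cone_mul[of x "n - m"] mul_add[of m "n - m" x] by (simp add: cle_def grp)

end

lemma cone_restrict: "preord N P \<Longrightarrow> sgp K \<Longrightarrow> K \<subseteq> N \<Longrightarrow> preord K (P \<inter> K)"
  by (auto simp: preord_def sgp_def)

lemma arch_restrict: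
  assumes "sgp K" "K \<subseteq> N" "arch N (P \<inter> N)"
  shows "arch K (P \<inter> K)"
  unfolding arch_def
proof (intro ballI impI)
  fix a y assume h: "a \<in> K" "- a \<notin> P \<inter> K" "y \<in> K"
  then have "- a \<notin> P" using assms(1) by (auto simp: sgpI)
  then obtain n where "cle (P \<inter> N) y (mul n a)"
    using assms h unfolding arch_def by (metis IntD1 subsetD)
  then show "\<exists>n. cle (P \<inter> K) y (mul n a)"
    using h assms(1) by (auto simp: cle_def sgpI intro!: exI[of _ n])
qed

lemma goodD:
  assumes "good N Z"
  shows "Z \<noteq> {}" "\<And>P. P \<in> Z \<Longrightarrow> preord N P" "lim_closed Z"
    "\<And>P D. P \<in> Z \<Longrightarrow> downset N P D \<Longrightarrow> cut_cone N D \<in> Z"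
  using assms by (auto simp: good_def)

text \<open>A change of base point is a cut: for the initial segment of the elements below
  \<open>g\<close>, an element \<open>h\<close> is nonnegative in the cut preorder iff
  \<open>g \<le> h + g\<close>. Hence good sets are closed under conjugation.\<close>

lemma good_conj:
  assumes N: "sgp N" and Z: "good N Z" and P: "P \<in> Z" and g: "g \<in> N"
  shows "{h \<in> N. - g + h + g \<in> P} \<in> Z"
proof -
  have cP: "preord N P" using Z P by (rule goodD)
  note c = cone_add[OF N cP] cone_total[OF N cP] cone_zero[OF N cP] cone_sub[OF N cP]
    cle_trans[OF N cP] cle_refl[OF N cP]
  let ?D = "{m \<in> N. cle P m g}"
  show ?thesis
  proof (cases "?D = N")
    case True
    \<comment> \<open>If \<open>g\<close> is a largest element, then \<open>g - x \<le> g\<close>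
      for every \<open>x\<close>, so every \<open>x\<close> is nonnegative.\<close>
    have "P = N"
    proof
      show "P \<subseteq> N" using c by blast
      show "N \<subseteq> P"
      proof
        fix x assume x: "x \<in> N"
        have "g + - x \<in> ?D" using True N g x by (simp add: sgpI)
        then have "cle P (g + - x) (g + 0)" by simp
        then show "x \<in> P" by (subst (asm) cle_left) (simp add: cle_def)
      qed
    qed
    then have "{h \<in> N. - g + h + g \<in> P} = P" using N g by (auto simp: sgpI)
    then show ?thesis using P by simp
  next
    case False
    have "g \<in> ?D" using g c by simp
    then have "downset N P ?D" using False c by (auto simp: downset_def)
    moreover have "cut_cone N ?D = {h \<in> N. - g + h + g \<in> P}"
    proof (intro Set.set_eqI iffI)
      fix h assume "h \<in> cut_cone N ?D"
      then have "h \<in> N" "- h + g \<in> ?D" using \<open>g \<in> ?D\<close> by (auto simp: cut_cone_def)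
      then show "h \<in> {h \<in> N. - g + h + g \<in> P}" by (simp add: cle_def grp)
    next
      fix h assume "h \<in> {h \<in> N. - g + h + g \<in> P}"
      then have h: "h \<in> N" "cle P g (h + g)" by (auto simp: cle_def grp)
      have "- h + d \<in> ?D" if "d \<in> ?D" for d
      proof -
        have "cle P d (h + g)" using that h c by blast
        then show ?thesis using that h N by (simp add: cle_shift sgpI)
      qed
      then show "h \<in> cut_cone N ?D" using h by (simp add: cut_cone_def)
    qed
    ultimately show ?thesis using goodD(4)[OF Z P] by force
  qed
qed

text \<open>Restriction is continuous, so the image of the compact set \<open>Z\<close> is closed;
  and every cut of a restricted preorder is the trace of a cut of the whole preorder.\<close>

lemma good_restrict:
  assumes N: "sgp N" and Z: "good N Z" and K: "sgp K" "K \<subseteq> N"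
  shows "good K ((\<lambda>P. P \<inter> K) ` Z)"
  unfolding good_def
proof (intro conjI ballI allI impI)
  show "(\<lambda>P. P \<inter> K) ` Z \<noteq> {}" using goodD(1)[OF Z] by auto
  show "preord K P" if "P \<in> (\<lambda>P. P \<inter> K) ` Z" for P
    using that goodD(2)[OF Z] cone_restrict[OF _ K] by auto
  show "lim_closed ((\<lambda>P. P \<inter> K) ` Z)"
    unfolding lim_closed_def
  proof (intro allI impI)
    fix Q assume Q: "\<forall>W. finite W \<longrightarrow> (\<exists>P\<in>(\<lambda>P. P \<inter> K) ` Z. P \<inter> W = Q \<inter> W)"
    have "Q \<subseteq> K"
    proof
      fix x assume "x \<in> Q"
      moreover obtain P where "P \<in> Z" "P \<inter> K \<inter> {x} = Q \<inter> {x}" using Q[rule_format, of "{x}"] by auto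
      ultimately show "x \<in> K" by auto
    qed
    have "\<exists>P\<in>Z. \<forall>x\<in>K. x \<in> P \<longleftrightarrow> x \<in> Q"
    proof (rule compactness_indexed[OF goodD(3)[OF Z]])
      show "lim_closed {P. (x \<in> P) = (x \<in> Q)}" for x
        by (rule lim_closed_finitary[of "{x}"]) auto
      fix J assume J: "finite J" "J \<subseteq> K"
      then obtain P where "P \<in> Z" "P \<inter> K \<inter> J = Q \<inter> J" using Q by auto
      then show "\<exists>P\<in>Z. \<forall>x\<in>J. (x \<in> P) = (x \<in> Q)" using J by (intro bexI[of _ P]) auto
    qed
    then obtain P where "P \<in> Z" "\<forall>x\<in>K. x \<in> P \<longleftrightarrow> x \<in> Q" by blast
    then have "Q = P \<inter> K" using \<open>Q \<subseteq> K\<close> by auto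
    then show "Q \<in> (\<lambda>P. P \<inter> K) ` Z" using \<open>P \<in> Z\<close> by blast
  qed
next
  fix R D assume "R \<in> (\<lambda>P. P \<inter> K) ` Z" and D: "downset K R D"
  then obtain P where P: "P \<in> Z" "R = P \<inter> K" by auto
  have cP: "preord N P" using Z P(1) by (rule goodD)
  note c = cle_trans[OF N cP] cle_refl[OF N cP] cle_total[OF N cP]
  have R: "cle R x y \<longleftrightarrow> cle P x y" if "x \<in> K" "y \<in> K" for x y
    using that K P by (simp add: cle_def sgpI)
  have DK: "D \<subseteq> K" "D \<noteq> {}" "D \<noteq> K" using D by (auto simp: downset_def)
  have Ddown: "m \<in> D" if "m \<in> K" "d \<in> D" "cle P m d" for m d
    using D that R DK by (auto simp: downset_def)
  \<comment> \<open>The initial segment of \<open>N\<close> spanned by \<open>D\<close> meets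
    \<open>K\<close> exactly in \<open>D\<close>, which makes the two cut preorders agree on
    \<open>K\<close>.\<close>
  let ?D = "{m \<in> N. \<exists>d\<in>D. cle P m d}"
  have DD: "?D \<inter> K = D" using Ddown DK K c(2) by blast
  have "downset N P ?D"
    unfolding downset_def
  proof (intro conjI ballI impI)
    show "?D \<noteq> {}" "?D \<noteq> N" using DD DK K by blast+
    show "m \<in> ?D" if "d \<in> ?D" "m \<in> N" "cle P m d" for m d
      using that c by blast
  qed auto
  then have "cut_cone N ?D \<in> Z" using goodD(4)[OF Z P(1)] by simp
  moreover have "cut_cone N ?D \<inter> K = cut_cone K D"
  proof (intro Set.set_eqI iffI)
    fix h assume h: "h \<in> cut_cone N ?D \<inter> K"
    have "- h + d \<in> D" if "d \<in> D" for d
    proof -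
      have "d \<in> ?D" "d \<in> K" using that DD DK by auto
      then have "- h + d \<in> ?D" "- h + d \<in> K" using h K by (auto simp: cut_cone_def sgpI)
      then show ?thesis using DD by blast
    qed
    then show "h \<in> cut_cone K D" using h by (simp add: cut_cone_def)
  next
    fix h assume h: "h \<in> cut_cone K D"
    then have hK: "h \<in> K" by (simp add: cut_cone_def)
    have "- h + m \<in> ?D" if "m \<in> ?D" for m
    proof -
      obtain d where "d \<in> D" "cle P m d" "m \<in> N" using \<open>m \<in> ?D\<close> by auto
      then have "- h + d \<in> D" "cle P (- h + m) (- h + d)" using h by (auto simp: cut_cone_def)
      moreover have "- h + m \<in> N" using hK K N \<open>m \<in> N\<close> by (auto simp: sgpI)
      ultimately show ?thesis by blast
    qed
    then show "h \<in> cut_cone N ?D \<inter> K" using hK K by (auto simp: cut_cone_def)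
  qed
  ultimately show "cut_cone K D \<in> (\<lambda>P. P \<inter> K) ` Z" by blast
qed

lemma has_arch_restrict_iff:
  "K \<subseteq> M \<Longrightarrow> has_arch K ((\<lambda>P. P \<inter> M) ` Z) \<longleftrightarrow> has_arch K Z"
  by (auto simp: has_arch_def Int_assoc Int_absorb1)

text \<open>Cuts of a preorder that is trivial on a normal subgroup are invariant under it.\<close>
lemma good_trivial_on:
  assumes M: "sgp M" and Z: "good M Z" and K: "normal_in K M"
    and ne: "\<exists>P\<in>Z. K \<subseteq> P"
  shows "good M {P \<in> Z. K \<subseteq> P}"
  unfolding good_def
proof (intro conjI ballI allI impI)
  show "{P \<in> Z. K \<subseteq> P} \<noteq> {}" using ne by auto
  show "preord M P" if "P \<in> {P \<in> Z. K \<subseteq> P}" for P using that goodD(2)[OF Z] by auto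
  have "lim_closed {P. x \<in> P}" for x :: 'a by (rule lim_closed_finitary[of "{x}"]) auto
  then have "lim_closed (\<Inter>((\<lambda>x. {P. x \<in> P}) ` K))" by (intro lim_closed_Inter) auto
  then have "lim_closed (Z \<inter> \<Inter>((\<lambda>x. {P. x \<in> P}) ` K))" by (rule lim_closed_Int[OF goodD(3)[OF Z]])
  moreover have "Z \<inter> \<Inter>((\<lambda>x. {P. x \<in> P}) ` K) = {P \<in> Z. K \<subseteq> P}" by auto
  ultimately show "lim_closed {P \<in> Z. K \<subseteq> P}" by simp
next
  fix P D assume P: "P \<in> {P \<in> Z. K \<subseteq> P}" and D: "downset M P D"
  have K': "sgp K" "K \<subseteq> M" using K by (auto simp: normal_in_def)
  have "K \<subseteq> cut_cone M D"
  proof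
    fix k assume k: "k \<in> K"
    have "- k + d \<in> D" if d: "d \<in> D" for d
    proof -
      have dM: "d \<in> M" using d D by (auto simp: downset_def)
      have "- d + k + - (- d) \<in> K"
        using K k sgp_minus[OF M dM] unfolding normal_in_def by blast
      then have "cle P (- k + d) d" using P by (auto simp: cle_def grp)
      then show ?thesis using D d k K' dM M by (auto simp: downset_def sgpI)
    qed
    then show "k \<in> cut_cone M D" using k K' by (auto simp: cut_cone_def)
  qed
  then show "cut_cone M D \<in> {P \<in> Z. K \<subseteq> P}" using goodD(4)[OF Z _ D] P by auto
qed

subsection \<open>Archimedean preorders\<close>

lemma not_cle_mul_Suc:
  assumes "sgp N" "preord N P" "g \<in> N" "- g \<notin> P"
  shows "\<not> cle P (mul (Suc k) g) (mul k g)"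
proof
  assume "cle P (mul (Suc k) g) (mul k g)"
  then have "cle P (mul k g + g) (mul k g + 0)" by (simp add: mul_comm)
  then show False using assms(4) by (simp only: cle_left cle_zero_right)
qed

text \<open>Conrad's condition; two elements violating it generate a free subsemigroup.\<close>
definition conradian :: "'g::group_add set \<Rightarrow> 'g set \<Rightarrow> bool" where
  "conradian N P \<longleftrightarrow>
     (\<forall>a\<in>N. \<forall>b\<in>N. - a \<notin> P \<longrightarrow> - b \<notin> P \<longrightarrow> (\<exists>n. \<not> cle P (a + mul n b) b))"

text \<open>For positive \<open>g\<close> in a Conradian preorder this segment is closed under
  addition, and its symmetric part is the convex subgroup generated by \<open>g\<close>.\<close>

definition below_mul :: "'g::group_add set \<Rightarrow> 'g set \<Rightarrow> 'g \<Rightarrow> 'g set" where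
  "below_mul N P g = {h \<in> N. \<exists>k. cle P h (mul k g)}"

text \<open>If \<open>h + d\<close> exceeded all multiples of \<open>g\<close>, then translation by
  \<open>- h\<close> would squeeze all the elements \<open>- h + l g\<close> below one fixed
  multiple \<open>b\<close> of \<open>g\<close>. This is the configuration
  \<open>a + n b \<le> b\<close> that Conrad's condition excludes.\<close>

lemma below_mul_add:
  assumes N: "sgp N" and P: "preord N P" and con: "conradian N P"
    and g: "g \<in> N" "- g \<notin> P" and h: "h \<in> below_mul N P g" "d \<in> below_mul N P g"
  shows "h + d \<in> below_mul N P g"
proof (rule ccontr)
  assume contra: "h + d \<notin> below_mul N P g"
  obtain k m where k: "cle P h (mul k g)" and m: "cle P d (mul m g)" and hN: "h \<in> N" "d \<in> N"
    using h by (auto simp: below_mul_def)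
  have gP: "g \<in> P" using P g by (auto simp: preord_def)
  \<comment> \<open>The successors make both elements strictly positive, since
    \<open>h \<le> k g < (k + 1) g\<close>.\<close>
  let ?b = "mul (Suc m) g" and ?a = "- h + mul (Suc k) g"
  have "cle P d ?b" using m cle_mul_mono[OF N P gP, of m "Suc m"] cle_trans[OF N P] by auto
  have bnd: "cle P (- h + mul l g) ?b" for l
  proof -
    have "\<not> cle P (h + ?b) (mul l g)"
    proof
      assume "cle P (h + ?b) (mul l g)"
      moreover have "cle P (h + d) (h + ?b)" using \<open>cle P d ?b\<close> by (simp only: cle_left)
      ultimately have "cle P (h + d) (mul l g)" using cle_trans[OF N P] by blast
      then show False using contra hN N by (auto simp: below_mul_def sgpI)
    qed
    then have "cle P (mul l g) (h + ?b)"
      using cle_total[OF N P] N hN g by (meson sgp_add sgp_mul)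
    then show ?thesis by (simp only: cle_shift)
  qed
  have "- ?a \<notin> P"
  proof
    assume "- ?a \<in> P"
    then have "cle P (mul (Suc k) g) h" by (simp add: cle_def grp)
    then show False using k not_cle_mul_Suc[OF N P g] cle_trans[OF N P] by blast
  qed
  moreover have "- ?b \<notin> P"
  proof
    assume "- ?b \<in> P"
    then have "cle P ?b (mul 0 g)" by (simp add: cle_def)
    moreover have "cle P (mul 0 g) (mul m g)" using cle_mul_mono[OF N P gP] by blast
    ultimately show False using not_cle_mul_Suc[OF N P g] cle_trans[OF N P] by blast
  qed
  moreover have "?a \<in> N" "?b \<in> N" using N hN g by (auto intro!: sgpI)
  ultimately obtain n where "\<not> cle P (?a + mul n ?b) ?b" using con unfolding conradian_def by blast
  moreover have "?a + mul n ?b = - h + mul (Suc k + n * Suc m) g"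
    by (simp only: mul_add mul_mult add.assoc)
  ultimately show False using bnd by metis
qed

lemma below_mul_props:
  assumes N: "sgp N" and P: "preord N P" and g: "g \<in> N" "g \<in> P"
  shows "0 \<in> below_mul N P g" "g \<in> below_mul N P g"
    "\<And>x y. x \<in> N \<Longrightarrow> cle P x y \<Longrightarrow> y \<in> below_mul N P g \<Longrightarrow> x \<in> below_mul N P g"
    "below_mul N P g \<subseteq> N"
proof -
  show "0 \<in> below_mul N P g"
    using cle_refl[OF N P, of 0] N by (auto simp: below_mul_def sgpI intro!: exI[of _ 0])
  show "g \<in> below_mul N P g"
    using cle_refl[OF N P, of g] g by (auto simp: below_mul_def intro!: exI[of _ 1])
  show "\<And>x y. x \<in> N \<Longrightarrow> cle P x y \<Longrightarrow> y \<in> below_mul N P g \<Longrightarrow> x \<in> below_mul N P g"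
    using cle_trans[OF N P] by (auto simp: below_mul_def)
  show "below_mul N P g \<subseteq> N" by (auto simp: below_mul_def)
qed

lemma below_mul_subset:
  assumes N: "sgp N" and P: "preord N P" and con: "conradian N P"
    and g: "g \<in> N" "- g \<notin> P" and h: "h \<in> below_mul N P g"
  shows "below_mul N P h \<subseteq> below_mul N P g"
proof -
  have gP: "g \<in> P" using P g by (auto simp: preord_def)
  have "mul n h \<in> below_mul N P g" for n
    by (induction n)
      (use below_mul_props[OF N P g(1) gP] below_mul_add[OF N P con g h] in auto)
  then show ?thesis using below_mul_props(3)[OF N P g(1) gP] by (auto simp: below_mul_def[of N P h])
qed

lemma common_upper_bound:
  assumes N: "sgp N" and P: "preord N P" and g: "g \<in> N" "- g \<notin> P" and J: "finite J" "J \<subseteq> N"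
  shows "\<exists>u\<in>N. - u \<notin> P \<and> (\<forall>h\<in>J. cle P h u \<and> cle P (- h) u)"
  using J
proof (induction J)
  case empty
  then show ?case using g by auto
next
  case (insert h J)
  then obtain u where u: "u \<in> N" "- u \<notin> P" "\<forall>h\<in>J. cle P h u \<and> cle P (- h) u" by auto
  have hN: "h \<in> N" "- h \<in> N" using insert N by (auto simp: sgpI)
  obtain h' where h': "h' = h \<or> h' = - h" "h' \<in> P" "h' \<in> N"
    using P hN unfolding preord_def by blast
  have hh: "cle P h h'" "cle P (- h) h'"
    using h' cle_refl[OF N P] cone_add[OF N P h'(2) h'(2)] by (auto simp: cle_def)
  have uP: "u \<in> P" using P u by (auto simp: preord_def)
  show ?case
  proof (cases "cle P h' u")
    case True
    then show ?thesis using u hh cle_trans[OF N P] by (intro bexI[of _ u]) blast+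
  next
    case False
    then have "cle P u h'" using cle_total[OF N P h'(3) u(1)] by simp
    moreover have "- h' \<notin> P"
    proof
      assume "- h' \<in> P"
      then have "cle P h' u" using cone_add[OF N P _ uP] by (simp add: cle_def)
      then show False using False by simp
    qed
    ultimately show ?thesis using u hh h' cle_trans[OF N P] by (intro bexI[of _ h']) blast+
  qed
qed

text \<open>Either every positive element is bounded, and cutting at larger and larger convex
  subgroups converges to the trivial preorder, or there is a cofinal element, and the cut
  at the largest proper convex subgroup is Archimedean.\<close>
lemma conradian_imp_arch:
  assumes N: "sgp N" and Z: "good N Z" and PZ: "P \<in> Z" and con: "conradian N P"
  shows "\<exists>Q\<in>Z. arch N Q"
proof -
  have P: "preord N P" using Z PZ by (rule goodD)
  note trans = cle_trans[OF N P] and total = cle_total[OF N P] and refl = cle_refl[OF N P]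
  let ?B = "below_mul N P"
  have posP: "g \<in> P" if "g \<in> N" "- g \<notin> P" for g using P that by (auto simp: preord_def)
  have Bdown: "downset N P (?B g)" if "g \<in> N" "- g \<notin> P" "?B g \<noteq> N" for g
    using that below_mul_props[OF N P that(1) posP] unfolding downset_def by blast
  show ?thesis
  proof (cases "\<forall>g\<in>N. - g \<notin> P \<longrightarrow> ?B g \<noteq> N")
    case noncof: True
    show ?thesis
    proof (cases "\<exists>g\<in>N. - g \<notin> P")
      case False
      then show ?thesis using PZ by (auto simp: arch_def)
    next
      case True
      then obtain g where g: "g \<in> N" "- g \<notin> P" by blast
      \<comment> \<open>Some \<open>u\<close> bounds a finite set \<open>J\<close> together with its
        negatives. All of \<open>J\<close> is nonnegative for the cut at \<open>?B u\<close>,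
        because adding \<open>- h\<close> to an element of \<open>?B u\<close> does not leave
        \<open>?B u\<close>.\<close>
      have "\<exists>Q\<in>Z. \<forall>h\<in>N. h \<in> Q"
      proof (rule compactness_indexed[OF goodD(3)[OF Z]])
        show "lim_closed {Q. h \<in> Q}" for h :: 'a by (rule lim_closed_finitary[of "{h}"]) auto
        fix J assume J: "finite J" "J \<subseteq> N"
        obtain u where u: "u \<in> N" "- u \<notin> P" "\<forall>h\<in>J. cle P h u \<and> cle P (- h) u"
          using common_upper_bound[OF N P g J] by blast
        note uB = below_mul_props[OF N P u(1) posP[OF u(1,2)]]
        have "h \<in> cut_cone N (?B u)" if "h \<in> J" for h
        proof -
          have "- h \<in> ?B u" using u that uB J N by (meson sgp_minus subsetD)
          then show ?thesis using below_mul_add[OF N P con u(1,2)] that J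
            by (auto simp: cut_cone_def)
        qed
        moreover have "cut_cone N (?B u) \<in> Z"
          using goodD(4)[OF Z PZ Bdown[OF u(1,2)]] noncof u by blast
        ultimately show "\<exists>Q\<in>Z. \<forall>h\<in>J. h \<in> Q" by blast
      qed
      then obtain Q where "Q \<in> Z" "\<forall>h\<in>N. h \<in> Q" by blast
      then show ?thesis using N by (intro bexI[of _ Q]) (auto simp: arch_def sgpI)
    qed
  next
    case False
    then obtain g where g: "g \<in> N" "- g \<notin> P" "?B g = N" by blast
    \<comment> \<open>The elements that are not both positive and cofinal: this is the initial
      segment spanned by the largest proper convex subgroup.\<close>
    let ?D = "{h \<in> N. - h \<in> P \<or> ?B h \<noteq> N}"
    have Dadd: "h + d \<in> ?D" if "h \<in> ?D" "d \<in> ?D" for h d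
    proof (rule ccontr)
      assume "h + d \<notin> ?D"
      moreover have hd: "h \<in> N" "d \<in> N" "h + d \<in> N" using that N by (auto simp: sgpI)
      ultimately have c: "- (h + d) \<notin> P" "?B (h + d) = N" by auto
      have lez: "cle P y x" if "- y \<in> P" "- x \<notin> P" "x \<in> N" for x y
        using that posP cone_add[OF N P] by (auto simp: cle_def)
      \<comment> \<open>Both summands lie below a single positive element that is not cofinal, so
        their sum is bounded by its multiples.\<close>
      have "\<exists>x\<in>N. - x \<notin> P \<and> ?B x \<noteq> N \<and> cle P h x \<and> cle P d x"
      proof (cases "- h \<in> P"; cases "- d \<in> P")
        assume "- h \<in> P" "- d \<in> P"
        then have "- (h + d) \<in> P" using cone_add[OF N P] by (simp add: minus_add)
        then show ?thesis using c by simp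
      next
        assume "- h \<in> P" "- d \<notin> P"
        then show ?thesis using that hd lez refl by (intro bexI[of _ d]) auto
      next
        assume "- h \<notin> P" "- d \<in> P"
        then show ?thesis using that hd lez refl by (intro bexI[of _ h]) auto
      next
        assume a: "- h \<notin> P" "- d \<notin> P"
        show ?thesis
        proof (cases "cle P h d")
          case True
          then show ?thesis using that hd a refl by (intro bexI[of _ d]) auto
        next
          case False
          then show ?thesis using that hd a refl total[of h d] by (intro bexI[of _ h]) auto
        qed
      qed
      then obtain x where x: "x \<in> N" "- x \<notin> P" "?B x \<noteq> N" "cle P h x" "cle P d x" by blast
      note xB = below_mul_props[OF N P x(1) posP[OF x(1,2)]]
      have "h + d \<in> ?B x"
        using below_mul_add[OF N P con x(1,2)] xB x hd by blast
      then have "?B (h + d) \<subseteq> ?B x" by (rule below_mul_subset[OF N P con x(1,2)])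
      then show False using c x xB(4) by blast
    qed
    have "downset N P ?D"
      unfolding downset_def
    proof (intro conjI ballI impI)
      show "?D \<noteq> {}" using cone_zero[OF N P] N by (auto simp: sgpI intro!: exI[of _ 0])
      show "?D \<noteq> N" using g by auto
      fix d m assume d: "d \<in> ?D" and m: "m \<in> N" "cle P m d"
      show "m \<in> ?D"
      proof (rule ccontr)
        assume "m \<notin> ?D"
        then have mp: "- m \<notin> P" "?B m = N" using m by auto
        have "- d \<notin> P"
        proof
          assume "- d \<in> P"
          then have "cle P m 0" using m(2) trans[of m d 0] by (simp add: cle_zero_right)
          then show False using mp by (simp add: cle_zero_right)
        qed
        have dN: "d \<in> N" using d by simp
        note dB = below_mul_props[OF N P dN posP[OF dN \<open>- d \<notin> P\<close>]]
        have "m \<in> ?B d" using dB m by blast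
        then have "?B m \<subseteq> ?B d" by (rule below_mul_subset[OF N P con dN \<open>- d \<notin> P\<close>])
        then show False using mp d dB(4) \<open>- d \<notin> P\<close> by auto
      qed
    qed auto
    then have QZ: "cut_cone N ?D \<in> Z" by (rule goodD(4)[OF Z PZ])
    have "arch N (cut_cone N ?D)"
      unfolding arch_def
    proof (intro ballI impI)
      fix a y assume a: "a \<in> N" "- a \<notin> cut_cone N ?D" and y: "y \<in> N"
      obtain d where d: "d \<in> ?D" "a + d \<notin> ?D"
        using a N by (auto simp: cut_cone_def sgpI)
      then have "a \<notin> ?D" using Dadd by blast
      then have "?B a = N" using a by auto
      then obtain n where n: "cle P y (mul n a)" using y by (auto simp: below_mul_def)
      have "- mul n a + y \<in> ?D" using n a y N by (auto simp: cle_def grp sgpI)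
      then have "- y + mul n a \<in> cut_cone N ?D"
        using Dadd[of "- mul n a + y"] a y N unfolding cut_cone_def by (auto simp: minus_add sgpI)
      then show "\<exists>n. cle (cut_cone N ?D) y (mul n a)" by (auto simp: cle_def)
    qed
    then show ?thesis using QZ by blast
  qed
qed

text \<open>This is the part of Hoelder's theorem that turns left invariance into invariance on both
  sides. Compared with orders there is an additional case: the conjugate of a positive element might
  be equivalent to 0 without being 0.\<close>

lemma arch_conj:
  assumes N: "sgp N" and P: "preord N P" and ar: "arch N P" and x: "x \<in> P" and y: "y \<in> N"
  shows "- y + x + y \<in> P"
proof -
  note add = cone_add[OF N P] and trans = cle_trans[OF N P]
  have posP: "g \<in> P" if "g \<in> N" "- g \<notin> P" for g using P that by (auto simp: preord_def)
  \<comment> \<open>By the choice of \<open>n\<close>, the element \<open>- b + n a + b\<close> is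
    at least \<open>a\<close>; but it is also the \<open>n\<close>-th multiple of the conjugate,
    hence at most 0.\<close>
  have step1: "- (- b + a + b) \<notin> P" if a: "a \<in> N" "- a \<notin> P" and b: "b \<in> N" "b \<in> P" for a b
  proof
    assume neg: "- (- b + a + b) \<in> P"
    obtain n where n: "cle P (b + a) (mul n a)" using ar a b N unfolding arch_def by (meson sgp_add)
    have "mul n (- b + a + b) = - b + mul n a + b" using mul_conj[of n "- b" a] by simp
    moreover have "- mul n (- b + a + b) \<in> P"
      using cone_mul[OF N P neg, of n] by (simp add: mul_minus)
    ultimately have "- (- b + mul n a + b) \<in> P" by simp
    moreover have "- a + - b + mul n a + b \<in> P"
      using add[OF n[unfolded cle_def] b(2)] by (simp add: grp)
    ultimately have "(- a + - b + mul n a + b) + - (- b + mul n a + b) \<in> P" by (rule add[rotated])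
    then show False using a by (simp add: grp)
  qed
  have conj: "- (- b + a + b) \<notin> P" if a: "a \<in> N" "- a \<notin> P" and b: "b \<in> N" for a b
  proof (cases "b \<in> P")
    case True
    then show ?thesis using step1 a b by blast
  next
    case False
    define c where "c = - b"
    have c: "c \<in> P" "c \<in> N" "- c \<notin> P" "b = - c"
      using False P b N by (auto simp: c_def preord_def sgpI)
    show ?thesis
    proof
      assume "- (- b + a + b) \<in> P"
      then have neg: "- (c + a + - c) \<in> P" using c by simp
      let ?w = "c + a + - c"
      have wN: "?w \<in> N" using N a c by (auto intro!: sgpI)
      show False
      \<comment> \<open>If the conjugate is negative, conjugating back contradicts
        \<open>step1\<close>. If it is equivalent to 0, the Archimedean property has to be used once
        more.\<close>
      proof (cases "?w \<in> P")
        case False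
        have "- (- c + - ?w + c) \<notin> P" by (rule step1) (use False wN N c in \<open>auto simp: sgpI\<close>)
        then show False using posP[OF a] by (simp add: grp)
      next
        case True
        obtain k where k: "cle P c (mul k a)" using ar a c unfolding arch_def by blast
        \<comment> \<open>Since \<open>?w\<close> is equivalent to 0, this \<open>d\<close> is
          positive; nevertheless \<open>d + c \<le> c\<close>, so all multiples of \<open>d\<close>
          stay below \<open>c\<close>.\<close>
        define d where "d = c + - mul k a"
        have dN: "d \<in> N" using N a c by (auto simp: d_def intro!: sgpI)
        have dw: "d = - mul k ?w + c" unfolding d_def mul_conj by (simp add: grp)
        have "- d \<notin> P"
        proof
          assume "- d \<in> P"
          then have "- c + mul k ?w \<in> P" by (simp add: dw grp)
          moreover have "- mul k ?w \<in> P" using cone_mul[OF N P neg, of k] by (simp add: mul_minus)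
          ultimately have "- c + mul k ?w + - mul k ?w \<in> P" by (rule add)
          then show False using c by (simp add: grp)
        qed
        then obtain m where m: "cle P (c + c) (mul m d)" using ar dN c N unfolding arch_def
          by (meson sgp_add)
        have "cle P (d + c) c" using k by (simp add: d_def cle_def grp)
        have "cle P (mul m d + c) c" for m
        proof (induction m)
          case 0
          show ?case by (simp add: cle_refl[OF N P])
        next
          case (Suc m)
          have "cle P (d + (mul m d + c)) (d + c)" using Suc by (simp only: cle_left)
          then show ?case using \<open>cle P (d + c) c\<close> trans unfolding mul.simps add.assoc by blast
        qed
        moreover have "cle P (mul m d) (mul m d + c)" using c(1) by (simp add: cle_def grp)
        ultimately have "cle P (c + c) (c + 0)" using m trans by (metis add.right_neutral)
        then show False using c by (simp only: cle_left cle_zero_right)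
      qed
    qed
  qed
  show ?thesis
  proof (cases "- x \<in> P")
    case False
    have xN: "x \<in> N" using x P by (auto simp: preord_def)
    show ?thesis using conj[OF xN False y] P xN y N
      by (intro posP) (auto intro!: sgpI)
  next
    case True
    have xN: "x \<in> N" using x P by (auto simp: preord_def)
    show ?thesis
    proof (rule ccontr)
      assume h: "- y + x + y \<notin> P"
      have "- (- (- y) + - (- y + x + y) + - y) \<notin> P"
        by (rule conj) (use N h xN y in \<open>auto intro!: sgpI\<close>)
      then show False using x by (simp add: grp)
    qed
  qed
qed

lemma conj_invariant_imp_conradian:
  assumes N: "sgp N" and P: "preord N P" and inv: "\<And>x y. x \<in> P \<Longrightarrow> y \<in> N \<Longrightarrow> - y + x + y \<in> P"
  shows "conradian N P"
  unfolding conradian_def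
proof (intro ballI impI exI[of _ 1] notI)
  fix a b assume ab: "a \<in> N" "b \<in> N" "- a \<notin> P" "- b \<notin> P" "cle P (a + mul 1 b) b"
  then have "- b + - a + b \<in> P" by (simp add: cle_def grp)
  from inv[OF this, of "- b"] show False using ab N by (simp add: grp sgpI)
qed

lemma sgp_directed_Union:
  assumes ne: "\<S> \<noteq> {}" and S: "\<And>S. S \<in> \<S> \<Longrightarrow> sgp S"
    and dir: "\<And>S T. S \<in> \<S> \<Longrightarrow> T \<in> \<S> \<Longrightarrow> \<exists>U\<in>\<S>. S \<union> T \<subseteq> U"
  shows "sgp (\<Union>\<S>)"
  unfolding sgp_def
proof (intro conjI ballI)
  show "0 \<in> \<Union>\<S>" using ne S by (auto simp: sgpI)
  show "- x \<in> \<Union>\<S>" if "x \<in> \<Union>\<S>" for x using that S sgp_minus by blast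
  fix x y assume "x \<in> \<Union>\<S>" "y \<in> \<Union>\<S>"
  then obtain S T where "S \<in> \<S>" "T \<in> \<S>" "x \<in> S" "y \<in> T" by auto
  moreover from this obtain V where "V \<in> \<S>" "S \<union> T \<subseteq> V" using dir by meson
  ultimately have "x + y \<in> V" using S sgp_add by blast
  then show "x + y \<in> \<Union>\<S>" using \<open>V \<in> \<S>\<close> by auto
qed

text \<open>Limits of Archimedean preorders are still bi-invariant, hence Conradian.\<close>
lemma has_arch_Union:
  assumes M: "sgp M" and Z: "good M Z" and ne: "\<S> \<noteq> {}"
    and S: "\<And>S. S \<in> \<S> \<Longrightarrow> sgp S \<and> S \<subseteq> M \<and> has_arch S Z"
    and dir: "\<And>S T. S \<in> \<S> \<Longrightarrow> T \<in> \<S> \<Longrightarrow> \<exists>U\<in>\<S>. S \<union> T \<subseteq> U"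
  shows "has_arch (\<Union>\<S>) Z"
proof -
  have U: "sgp (\<Union>\<S>)" using ne S dir by (intro sgp_directed_Union) blast+
  have fin: "\<exists>V\<in>\<S>. \<Union>J \<subseteq> V" if "finite J" "J \<subseteq> \<S>" for J
    using that
  proof (induction J)
    case empty
    then show ?case using ne by auto
  next
    case (insert S J)
    then obtain V where "V \<in> \<S>" "\<Union>J \<subseteq> V" by auto
    then obtain W where "W \<in> \<S>" "S \<union> V \<subseteq> W" using dir insert by (meson insert_subset)
    then show ?case using \<open>\<Union>J \<subseteq> V\<close> by (intro bexI[of _ W]) auto
  qed
  \<comment> \<open>Only pairs from a common member are constrained: finitely many of them lie in
    one member \<open>V\<close>, and a preorder that is Archimedean on \<open>V\<close> satisfies
    all these constraints.\<close>
  have "\<exists>P\<in>Z. \<forall>(x, y)\<in>{(x, y). \<exists>S\<in>\<S>. x \<in> S \<and> y \<in> S}. x \<in> P \<longrightarrow> - y + x + y \<in> P"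
  proof (rule compactness_indexed[OF goodD(3)[OF Z]])
    show "lim_closed {P. case i of (x, y) \<Rightarrow> x \<in> P \<longrightarrow> - y + x + y \<in> P}" for i :: "'a \<times> 'a"
      by (rule lim_closed_finitary[of "{fst i, - snd i + fst i + snd i}"]) (auto split: prod.splits)
    fix J assume J: "finite J" "J \<subseteq> {(x, y). \<exists>S\<in>\<S>. x \<in> S \<and> y \<in> S}"
    then obtain s where s: "\<And>i. i \<in> J \<Longrightarrow> s i \<in> \<S> \<and> fst i \<in> s i \<and> snd i \<in> s i"
      by (atomize_elim, intro choice) fastforce
    have "s ` J \<subseteq> \<S>" using s by blast
    then obtain V where V: "V \<in> \<S>" "\<Union>(s ` J) \<subseteq> V" using fin[of "s ` J"] J(1) by blast
    then obtain P where P: "P \<in> Z" "arch V (P \<inter> V)" using S unfolding has_arch_def by blast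
    have cP: "preord V (P \<inter> V)" using cone_restrict S V P goodD(2)[OF Z] by blast
    have "case i of (x, y) \<Rightarrow> x \<in> P \<longrightarrow> - y + x + y \<in> P" if "i \<in> J" for i
    proof -
      obtain x y where i: "i = (x, y)" by (cases i)
      then have "x \<in> V" "y \<in> V" using s[OF that] V(2) that by fastforce+
      then show ?thesis using arch_conj[OF _ cP P(2), of x y] i S[OF V(1)] by auto
    qed
    then show "\<exists>P\<in>Z. \<forall>i\<in>J. case i of (x, y) \<Rightarrow> x \<in> P \<longrightarrow> - y + x + y \<in> P" using P by blast
  qed
  then obtain P where P: "P \<in> Z"
    "\<And>x y S. S \<in> \<S> \<Longrightarrow> x \<in> S \<Longrightarrow> y \<in> S \<Longrightarrow> x \<in> P \<Longrightarrow> - y + x + y \<in> P"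
    by blast
  have UM: "\<Union>\<S> \<subseteq> M" using S by auto
  have cP: "preord (\<Union>\<S>) (P \<inter> \<Union>\<S>)" using cone_restrict[OF goodD(2)[OF Z P(1)] U UM] .
  have "conradian (\<Union>\<S>) (P \<inter> \<Union>\<S>)"
  proof (rule conj_invariant_imp_conradian[OF U cP])
    fix x y assume xy: "x \<in> P \<inter> \<Union>\<S>" "y \<in> \<Union>\<S>"
    then obtain A B where "A \<in> \<S>" "B \<in> \<S>" "x \<in> A" "y \<in> B" by auto
    moreover from this obtain V where "V \<in> \<S>" "A \<union> B \<subseteq> V" using dir by meson
    ultimately have "- y + x + y \<in> P" using P(2)[of V x y] xy by blast
    moreover have "- y + x + y \<in> \<Union>\<S>" using xy U by (intro sgpI) auto
    ultimately show "- y + x + y \<in> P \<inter> \<Union>\<S>" by simp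
  qed
  then obtain Q where "Q \<in> (\<lambda>P. P \<inter> \<Union>\<S>) ` Z" "arch (\<Union>\<S>) Q"
    using conradian_imp_arch[OF U good_restrict[OF M Z U UM]] P(1) by blast
  then show "has_arch (\<Union>\<S>) Z" by (auto simp: has_arch_def)
qed

subsection \<open>Hoelder's theorem\<close>

definition zmul :: "int \<Rightarrow> 'g::group_add \<Rightarrow> 'g" where
  "zmul i g = (if 0 \<le> i then mul (nat i) g else - mul (nat (- i)) g)"

lemma zmul_Suc: "zmul (i + 1) g = g + zmul i g"
proof (cases "0 \<le> i")
  case True
  then show ?thesis by (simp add: zmul_def nat_add_distrib)
next
  case False
  define k where "k = nat (- (i + 1))"
  have k: "nat (- i) = Suc k" "zmul (i + 1) g = - mul k g"
    using False by (auto simp: k_def zmul_def)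
  have "zmul i g = - (mul k g + g)" using False by (simp add: zmul_def k mul_comm)
  then show ?thesis using k by (simp add: grp)
qed

lemma zmul_pred: "zmul (i - 1) g = - g + zmul i g"
  using zmul_Suc[of "i - 1" g] by (simp add: grp)

lemma zmul_add: "zmul (i + j) g = zmul i g + zmul j g"
proof (induction i rule: int_induct[of _ 0])
  case base
  show ?case by (simp add: zmul_def)
next
  case (step1 i)
  then show ?case using zmul_Suc[of "i + j" g] zmul_Suc[of i g] by (simp add: grp ac_simps)
next
  case (step2 i)
  then show ?case using zmul_pred[of "i + j" g] zmul_pred[of i g] by (simp add: grp algebra_simps)
qed

lemma zmul_of_nat: "zmul (int n) g = mul n g"
  by (simp add: zmul_def)

lemma sgp_zmul: "sgp N \<Longrightarrow> g \<in> N \<Longrightarrow> zmul i g \<in> N"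
  by (simp add: zmul_def sgpI)

text \<open>This replaces commutativity in the proof that Hoelder's map is additive. The relation is
  abstract because both the preorder and its converse are substituted for it.\<close>

lemma mul_sandwich:
  fixes R :: "'g::group_add \<Rightarrow> 'g \<Rightarrow> bool"
  assumes N: "sgp N" and refl: "\<And>x. R x x" and trans: "\<And>x y z. R x y \<Longrightarrow> R y z \<Longrightarrow> R x z"
    and left: "\<And>x y z. R x y \<Longrightarrow> R (z + x) (z + y)"
    and right: "\<And>x y z. z \<in> N \<Longrightarrow> R x y \<Longrightarrow> R (x + z) (y + z)"
    and xy: "x \<in> N" "y \<in> N" "R (x + y) (y + x)"
  shows "R (mul n x + mul n y) (mul n (x + y)) \<and> R (mul n (x + y)) (mul n y + mul n x)"
proof -
  have swap: "R (mul n x + y) (y + mul n x)" for n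
  proof (induction n)
    case (Suc n)
    have "R (x + (mul n x + y)) (x + (y + mul n x))" using Suc by (rule left)
    moreover have "R (x + y + mul n x) (y + x + mul n x)" using xy N by (intro right) (auto intro: sgpI)
    ultimately show ?case using trans by (metis add.assoc mul.simps(2))
  qed (simp add: refl)
  show ?thesis
  proof (induction n)
    case (Suc n)
    have "R (x + (mul n x + y) + mul n y) (x + (y + mul n x) + mul n y)"
      using xy N by (intro right left swap) (auto intro: sgpI)
    then have a1: "R (mul (Suc n) x + mul (Suc n) y) (x + y + (mul n x + mul n y))"
      by (simp add: add.assoc)
    have a2: "R (x + y + (mul n x + mul n y)) (mul (Suc n) (x + y))"
      unfolding mul.simps using Suc by (intro left) simp
    have "R (mul n (x + y) + (x + y)) (mul n y + mul n x + (x + y))"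
      using Suc xy N by (intro right) (auto intro: sgpI)
    then have b1: "R (mul (Suc n) (x + y)) (mul n y + mul n x + (x + y))"
      by (simp only: mul_comm mul.simps)
    have b2: "R (mul n y + mul n x + (x + y)) (mul n y + mul n x + (y + x))"
      using xy by (intro left)
    have "R (mul n y + (mul n x + y) + x) (mul n y + (y + mul n x) + x)"
      using xy N by (intro right left swap) (auto intro: sgpI)
    moreover have "mul n y + (mul n x + y) + x = mul n y + mul n x + (y + x)"
      by (simp add: add.assoc)
    moreover have "mul n y + (y + mul n x) + x = (mul n y + y) + (mul n x + x)"
      by (simp add: add.assoc)
    ultimately have "R (mul n y + mul n x + (y + x)) (mul (Suc n) y + mul (Suc n) x)"
      by (simp only: mul_comm mul.simps)
    then show ?case using a1 a2 b1 b2 trans by blast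
  qed (simp add: refl)
qed

text \<open>For a fixed positive \<open>u\<close>, an element \<open>x\<close> is measured by the
  rationals \<open>i / n\<close> with \<open>i u \<le> n x\<close>. By \<open>mul_sandwich\<close>,
  the defect of additivity stays bounded after multiplication by any \<open>n\<close>, hence
  vanishes.\<close>

lemma arch_hom:
  assumes N: "sgp N" and P: "preord N P" and ar: "arch N P"
  shows "\<exists>\<tau> :: 'g::group_add \<Rightarrow> real.
    (\<forall>x\<in>N. \<forall>y\<in>N. \<tau> (x + y) = \<tau> x + \<tau> y) \<and> (\<forall>x\<in>N. x \<in> P \<longleftrightarrow> 0 \<le> \<tau> x)"
proof (cases "\<exists>u\<in>N. - u \<notin> P")
  case False
  then have "x \<in> P" if "x \<in> N" for x using that N by (metis minus_minus sgp_minus)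
  then show ?thesis by (intro exI[of _ "\<lambda>_. 0"]) auto
next
  case True
  then obtain u where u: "u \<in> N" "- u \<notin> P" by blast
  have uP: "u \<in> P" using P u by (auto simp: preord_def)
  note trans = cle_trans[OF N P] and total = cle_total[OF N P] and refl = cle_refl[OF N P]
  have right: "cle P (x + z) (y + z)" if "z \<in> N" "cle P x y" for x y z
    using arch_conj[OF N P ar, of "- x + y" z] that by (simp add: cle_def grp)
  have zN: "zmul i u \<in> N" for i using N u by (simp add: sgp_zmul)
  have mN: "mul n x \<in> N" if "x \<in> N" for x n using N that by (simp add: sgpI)
  have zle: "cle P (zmul i u) (zmul j u) \<longleftrightarrow> i \<le> j" for i j
  proof
    assume "i \<le> j"
    then have "- zmul i u + zmul j u = mul (nat (j - i)) u"
      using zmul_add[of i "j - i" u] by (simp add: zmul_def[of "j - i"] grp)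
    then show "cle P (zmul i u) (zmul j u)" using cone_mul[OF N P uP] by (simp add: cle_def)
  next
    assume le: "cle P (zmul i u) (zmul j u)"
    show "i \<le> j"
    proof (rule ccontr)
      assume "\<not> i \<le> j"
      then obtain k where "i - j = int (Suc k)" by (metis diff_gt_0_iff_gt not_le zero_less_imp_eq_int Suc_pred of_nat_0_less_iff)
      then have "i = j + int (Suc k)" by simp
      then have i: "zmul i u = zmul j u + mul (Suc k) u" by (simp only: zmul_add zmul_of_nat)
      have "cle P (zmul j u + mul (Suc k) u) (zmul j u + 0)" using le i by simp
      then have "cle P (mul (Suc k) u) 0" by (simp only: cle_left)
      moreover have "cle P (mul 0 u) (mul k u)" using cle_mul_mono[OF N P uP] by blast
      ultimately show False using not_cle_mul_Suc[OF N P u] trans by (metis mul.simps(1))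
    qed
  qed
  have zmul_mul: "mul n (zmul i u) = zmul (int n * i) u" for n i
    by (induction n) (auto simp: zmul_add algebra_simps zmul_def[of 0])
  have mono: "cle P (mul n x) (mul n y)" if "x \<in> N" "y \<in> N" "cle P x y" for n x y
  proof (induction n)
    case (Suc n)
    have "cle P (x + mul n x) (x + mul n y)" using Suc by (simp only: cle_left)
    moreover have "cle P (x + mul n y) (y + mul n y)" using that mN by (intro right) auto
    ultimately show ?case using trans unfolding mul.simps by blast
  qed (simp add: refl)
  have nle: "cle P y x" if "x \<in> N" "y \<in> N" "\<not> cle P x y" for x y using that total by blast
  define L where "L = (\<lambda>x. {real_of_int i / real n | i n. n \<ge> 1 \<and> cle P (zmul i u) (mul n x)})"
  define \<tau> where "\<tau> = (\<lambda>x. Sup (L x))"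
  have cross: "real_of_int i / real n \<le> real_of_int j / real m"
    if "x \<in> N" "n \<ge> 1" "m \<ge> 1" "cle P (zmul i u) (mul n x)" "cle P (mul m x) (zmul j u)" for x i j n m
  proof -
    have "cle P (mul m (zmul i u)) (mul m (mul n x))" using that zN mN by (intro mono) auto
    moreover have "cle P (mul n (mul m x)) (mul n (zmul j u))" using that zN mN by (intro mono) auto
    moreover have "mul m (mul n x) = mul n (mul m x)" by (metis mul_mult mult.commute)
    ultimately have "int m * i \<le> int n * j" using trans zle by (metis zmul_mul)
    then have "real m * real_of_int i \<le> real n * real_of_int j"
      by (metis of_int_le_iff of_int_mult of_int_of_nat_eq)
    then show ?thesis using that by (simp add: field_simps)
  qed
  have upper: "\<exists>j. cle P x (zmul j u)" if "x \<in> N" for x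
    using ar u that unfolding arch_def by (metis zmul_of_nat)
  have lower: "\<exists>j. cle P (zmul j u) x" if x: "x \<in> N" for x
  proof -
    obtain j where "cle P (- x) (zmul j u)" using upper sgp_minus[OF N x] by blast
    then have "cle P (- x + x) (zmul j u + x)" using x by (rule right[rotated])
    then have "cle P (zmul (- j) u + 0) (zmul (- j) u + (zmul j u + x))" by (simp only: cle_left left_minus)
    moreover have "zmul (- j) u + (zmul j u + x) = x"
      using zmul_add[of "- j" j u] by (simp add: zmul_def[of 0] add.assoc[symmetric])
    ultimately show ?thesis by auto
  qed
  have ge: "real_of_int i \<le> real n * \<tau> x" if "x \<in> N" "n \<ge> 1" "cle P (zmul i u) (mul n x)" for x i n
  proof -
    obtain j where "cle P (mul 1 x) (zmul j u)" using upper \<open>x \<in> N\<close> by auto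
    then have "bdd_above (L x)"
      unfolding L_def bdd_above_def using cross[of x _ 1 _ j] that(1)
      by (intro exI[of _ "real_of_int j / real 1"]) blast
    moreover have "real_of_int i / real n \<in> L x" using that by (auto simp: L_def)
    ultimately have "real_of_int i / real n \<le> \<tau> x" unfolding \<tau>_def by (intro cSup_upper)
    then show ?thesis using that by (simp add: field_simps)
  qed
  have leq: "real n * \<tau> x \<le> real_of_int i" if "x \<in> N" "n \<ge> 1" "cle P (mul n x) (zmul i u)" for x i n
  proof -
    obtain j where "cle P (zmul j u) (mul 1 x)" using lower \<open>x \<in> N\<close> by auto
    then have "L x \<noteq> {}" unfolding L_def by blast
    moreover have "y \<le> real_of_int i / real n" if "y \<in> L x" for y
      using that cross[of x _ n _ i] \<open>x \<in> N\<close> \<open>n \<ge> 1\<close> \<open>cle P (mul n x) (zmul i u)\<close>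
      unfolding L_def by blast
    ultimately have "\<tau> x \<le> real_of_int i / real n" unfolding \<tau>_def by (intro cSup_least)
    then show ?thesis using that by (simp add: field_simps)
  qed
  have approx: "\<exists>i. cle P (zmul i u) (mul n x) \<and> cle P (mul n x) (zmul (i + 3) u) \<and>
      \<bar>real n * \<tau> x - real_of_int i\<bar> \<le> 3" if "x \<in> N" "n \<ge> 1" for x n
  proof -
    \<comment> \<open>Both bounds on \<open>n * \<tau> x\<close> must be strict, so that
      \<open>leq\<close> and \<open>ge\<close> can be applied contrapositively; an interval of width
      3 leaves room for this.\<close>
    define i where "i = \<lceil>real n * \<tau> x\<rceil> - 1"
    have b: "real_of_int i < real n * \<tau> x" "real n * \<tau> x < real_of_int (i + 3)"
      unfolding i_def by linarith+
    have "cle P (zmul i u) (mul n x)" using leq[OF that, of i] b(1) nle mN zN that by force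
    moreover have "cle P (mul n x) (zmul (i + 3) u)"
      using ge[OF that, of "i + 3"] b(2) nle mN zN that by force
    ultimately show ?thesis using b by (intro exI[of _ i]) auto
  qed
  have add: "\<tau> (x + y) = \<tau> x + \<tau> y" if xy: "x \<in> N" "y \<in> N" for x y
  proof -
    have xyN: "x + y \<in> N" using xy N by (simp add: sgpI)
    have sand: "(cle P (mul n x + mul n y) (mul n (x + y)) \<and> cle P (mul n (x + y)) (mul n y + mul n x)) \<or>
      (cle P (mul n y + mul n x) (mul n (x + y)) \<and> cle P (mul n (x + y)) (mul n x + mul n y))" for n
    proof (cases "cle P (x + y) (y + x)")
      case True
      have "cle P (mul n x + mul n y) (mul n (x + y)) \<and> cle P (mul n (x + y)) (mul n y + mul n x)"
        using xy True by (intro mul_sandwich[OF N]) (simp add: refl | blast intro: trans right)+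
      then show ?thesis by blast
    next
      case False
      then have "cle P (y + x) (x + y)" using nle xy N by (simp add: sgpI)
      then have "cle P (mul n y + mul n x) (mul n (x + y)) \<and> cle P (mul n (x + y)) (mul n x + mul n y)"
        using xy
        by (intro mul_sandwich[OF N, where R = "\<lambda>a b. cle P b a", THEN conj_commute[THEN iffD1]])
          (simp add: refl | blast intro: trans right)+
      then show ?thesis by blast
    qed
    \<comment> \<open>The bound is 6 + 3 + 3: an interval of length 6 for the sum and an error of 3
      for each summand.\<close>
    have bound: "real n * \<bar>\<tau> (x + y) - \<tau> x - \<tau> y\<bar> \<le> 12" if n: "n \<ge> 1" for n
    proof -
      obtain i where i: "cle P (zmul i u) (mul n x)" "cle P (mul n x) (zmul (i + 3) u)"
        "\<bar>real n * \<tau> x - real_of_int i\<bar> \<le> 3" using approx[OF xy(1) n] by blast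
      obtain j where j: "cle P (zmul j u) (mul n y)" "cle P (mul n y) (zmul (j + 3) u)"
        "\<bar>real n * \<tau> y - real_of_int j\<bar> \<le> 3" using approx[OF xy(2) n] by blast
      have sum: "cle P (a + b) (a' + b')" if "cle P a a'" "cle P b b'" "b \<in> N" for a b a' b'
        using right[OF that(3,1)] trans[of "a + b" "a' + b" "a' + b'"] that(2) cle_left by blast
      have "cle P (zmul (i + j) u) (mul n x + mul n y)" "cle P (mul n x + mul n y) (zmul (i + j + 6) u)"
        "cle P (zmul (i + j) u) (mul n y + mul n x)" "cle P (mul n y + mul n x) (zmul (i + j + 6) u)"
        using sum[OF i(1) j(1) zN] sum[OF j(1) i(1) zN] sum[OF i(2) j(2) mN[OF xy(2)]]
          sum[OF j(2) i(2) mN[OF xy(1)]]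
        by (simp_all add: zmul_add[symmetric] ac_simps)
      then have "cle P (zmul (i + j) u) (mul n (x + y))" "cle P (mul n (x + y)) (zmul (i + j + 6) u)"
        using sand[of n] trans by blast+
      then have "real_of_int (i + j) \<le> real n * \<tau> (x + y)" "real n * \<tau> (x + y) \<le> real_of_int (i + j + 6)"
        using ge leq xyN n by blast+
      then have "\<bar>real n * \<tau> (x + y) - real n * \<tau> x - real n * \<tau> y\<bar> \<le> 12" using i(3) j(3) by simp
      moreover have "real n * \<tau> (x + y) - real n * \<tau> x - real n * \<tau> y = real n * (\<tau> (x + y) - \<tau> x - \<tau> y)"
        by (simp add: algebra_simps)
      ultimately show ?thesis by (simp add: abs_mult)
    qed
    show ?thesis
    proof (rule ccontr)
      assume "\<tau> (x + y) \<noteq> \<tau> x + \<tau> y"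
      then have "\<bar>\<tau> (x + y) - \<tau> x - \<tau> y\<bar> > 0" by simp
      then obtain n where "12 < real n * \<bar>\<tau> (x + y) - \<tau> x - \<tau> y\<bar>" using reals_Archimedean3 by blast
      moreover from this have "n \<ge> 1" by (cases n) auto
      ultimately show False using bound by fastforce
    qed
  qed
  have "x \<in> P \<longleftrightarrow> 0 \<le> \<tau> x" if x: "x \<in> N" for x
  proof
    assume "x \<in> P"
    then show "0 \<le> \<tau> x" using ge[of x 1 0] x by (simp add: zmul_def cle_def)
  next
    assume t: "0 \<le> \<tau> x"
    show "x \<in> P"
    proof (rule ccontr)
      assume "x \<notin> P"
      then obtain n where n: "cle P u (mul n (- x))"
        using ar u x N unfolding arch_def by (metis minus_minus sgp_minus)
      have "n \<ge> 1"
      proof (rule ccontr)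
        assume "\<not> n \<ge> 1"
        then have "cle P u 0" using n by (simp add: not_le)
        then show False using u by (simp add: cle_zero_right)
      qed
      moreover have "u = zmul 1 u" by (simp add: zmul_def)
      ultimately have "1 \<le> real n * \<tau> (- x)" using ge[of "- x" n 1] n x N by (simp add: sgpI)
      moreover have "\<tau> 0 = 0" using add[of 0 0] N by (simp add: sgpI)
      then have "\<tau> (- x) = - \<tau> x" using add[of x "- x"] x N by (simp add: sgpI)
      ultimately have "real n * \<tau> x \<le> - 1" by simp
      then show False using t by (smt (verit) mult_nonneg_nonneg of_nat_0_le_iff)
    qed
  qed
  then show ?thesis using add by blast
qed

text \<open>If the ratios differed, a rational \<open>p / n\<close> between them would yield the
  element \<open>n x - p u\<close>, on which the two homomorphisms have different signs.\<close>

lemma hom_proportional: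
  fixes \<tau> \<sigma> :: "'g::group_add \<Rightarrow> real"
  assumes N: "sgp N"
    and \<tau>: "\<And>x y. x \<in> N \<Longrightarrow> y \<in> N \<Longrightarrow> \<tau> (x + y) = \<tau> x + \<tau> y"
    and \<sigma>: "\<And>x y. x \<in> N \<Longrightarrow> y \<in> N \<Longrightarrow> \<sigma> (x + y) = \<sigma> x + \<sigma> y"
    and sgn: "\<And>x. x \<in> N \<Longrightarrow> 0 \<le> \<tau> x \<longleftrightarrow> 0 \<le> \<sigma> x"
    and u: "u \<in> N" "\<tau> u > 0" and x: "x \<in> N"
  shows "\<sigma> x = \<sigma> u / \<tau> u * \<tau> x" "\<sigma> u > 0"
proof -
  have hmin: "\<tau> (- x) = - \<tau> x" "\<sigma> (- x) = - \<sigma> x" if "x \<in> N" for x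
  proof -
    have "\<tau> 0 = 0" "\<sigma> 0 = 0" using \<tau>[of 0 0] \<sigma>[of 0 0] N by (simp_all add: sgpI)
    then show "\<tau> (- x) = - \<tau> x" "\<sigma> (- x) = - \<sigma> x"
      using \<tau>[of x "- x"] \<sigma>[of x "- x"] that N by (simp_all add: sgpI)
  qed
  have hmul: "\<tau> (mul n x) = real n * \<tau> x \<and> \<sigma> (mul n x) = real n * \<sigma> x" if "x \<in> N" for x n
  proof (induction n)
    case 0
    show ?case using \<tau>[of 0 0] \<sigma>[of 0 0] N by (simp add: sgpI)
  next
    case (Suc n)
    then show ?case using \<tau>[of x "mul n x"] \<sigma>[of x "mul n x"] that N by (simp add: sgpI algebra_simps)
  qed
  have hz: "\<tau> (zmul i x) = real_of_int i * \<tau> x" "\<sigma> (zmul i x) = real_of_int i * \<sigma> x" if "x \<in> N" for x i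
    using hmul[OF that] hmin sgp_mul[OF N that] by (auto simp: zmul_def)
  have sgn': "\<tau> x > 0 \<longleftrightarrow> \<sigma> x > 0" if "x \<in> N" for x
    using sgn[of "- x"] hmin that N by (auto simp: sgpI)
  show su: "\<sigma> u > 0" using sgn' u by simp
  \<comment> \<open>The pair of homomorphisms is generalized so that it can be inserted in both
    orders.\<close>
  have key: False if lt: "\<sigma>' x / \<sigma>' u < \<tau>' x / \<tau>' u" and pos: "\<sigma>' u > 0" "\<tau>' u > 0"
    and sgn'': "\<And>x. x \<in> N \<Longrightarrow> 0 \<le> \<tau>' x \<Longrightarrow> 0 \<le> \<sigma>' x"
    and lin: "\<And>n i. \<tau>' (mul n x + zmul i u) = real n * \<tau>' x + real_of_int i * \<tau>' u"
      "\<And>n i. \<sigma>' (mul n x + zmul i u) = real n * \<sigma>' x + real_of_int i * \<sigma>' u"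
    for \<tau>' \<sigma>' :: "'g \<Rightarrow> real"
  proof -
    obtain q where q: "q \<in> \<rat>" "\<sigma>' x / \<sigma>' u < q" "q < \<tau>' x / \<tau>' u" using Rats_dense_in_real[OF lt] by blast
    obtain p and n :: nat where pn: "n > 0" "q = real_of_int p / real n"
      using q(1) by (metis Rats_cases' of_nat_0_less_iff of_int_of_nat_eq zero_less_imp_eq_int)
    let ?y = "mul n x + zmul (- p) u"
    have "?y \<in> N" using N x u by (simp add: sgpI sgp_zmul)
    moreover have "0 \<le> \<tau>' ?y" using q(3) pn pos by (simp add: lin field_simps)
    moreover have "\<sigma>' ?y < 0" using q(2) pn pos by (simp add: lin field_simps)
    ultimately show False using sgn'' by fastforce
  qed
  have lin: "\<tau> (mul n x + zmul i u) = real n * \<tau> x + real_of_int i * \<tau> u"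
    "\<sigma> (mul n x + zmul i u) = real n * \<sigma> x + real_of_int i * \<sigma> u" for n i
    using x u N hmul hz \<tau> \<sigma> by (simp_all add: sgpI sgp_zmul)
  have "\<not> \<sigma> x / \<sigma> u < \<tau> x / \<tau> u" using key[of \<sigma> \<tau>] su u(2) sgn lin by blast
  moreover have "\<not> \<tau> x / \<tau> u < \<sigma> x / \<sigma> u" using key[of \<tau> \<sigma>] su u(2) sgn lin by blast
  ultimately have "\<sigma> x / \<sigma> u = \<tau> x / \<tau> u" by simp
  then show "\<sigma> x = \<sigma> u / \<tau> u * \<tau> x" using su by (simp add: field_simps)
qed

subsection \<open>Extensions\<close>

lemma hom_zero_minus:
  fixes \<tau> :: "'g::group_add \<Rightarrow> real"
  assumes N: "sgp N" and \<tau>: "\<And>x y. x \<in> N \<Longrightarrow> y \<in> N \<Longrightarrow> \<tau> (x + y) = \<tau> x + \<tau> y"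
  shows "\<tau> 0 = 0" "x \<in> N \<Longrightarrow> \<tau> (- x) = - \<tau> x" "x \<in> N \<Longrightarrow> \<tau> (mul n x) = real n * \<tau> x"
proof -
  show zero: "\<tau> 0 = 0" using \<tau>[of 0 0] N by (simp add: sgpI)
  show "x \<in> N \<Longrightarrow> \<tau> (- x) = - \<tau> x" using \<tau>[of x "- x"] zero N by (simp add: sgpI)
  show "x \<in> N \<Longrightarrow> \<tau> (mul n x) = real n * \<tau> x"
    by (induction n) (use \<tau> zero N in \<open>auto simp: sgpI algebra_simps\<close>)
qed

lemma normal_inD:
  assumes "normal_in K M"
  shows "sgp K" "K \<subseteq> M" "\<And>m k. m \<in> M \<Longrightarrow> k \<in> K \<Longrightarrow> m + k + - m \<in> K"
  using assms by (auto simp: normal_in_def)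

text \<open>If \<open>m\<close> bounded \<open>A\<close> on one side, then the elements below some
  member of \<open>A\<close>, or those strictly below all members, would form a proper cut invariant
  under \<open>A\<close>, and its preorder would be trivial on \<open>A\<close>.\<close>

lemma unbounded_if_nontrivial:
  assumes M: "sgp M" and Z: "good M Z" and A: "sgp A" "A \<subseteq> M"
    and nt: "\<And>Q. Q \<in> Z \<Longrightarrow> \<not> A \<subseteq> Q" and P: "P \<in> Z" and m: "m \<in> M"
  shows "\<exists>a\<in>A. cle P m a" "\<exists>a\<in>A. cle P a m"
proof -
  have cP: "preord M P" using Z P by (rule goodD)
  note trans = cle_trans[OF M cP] and refl = cle_refl[OF M cP]
  show "\<exists>a\<in>A. cle P m a"
  proof (rule ccontr)
    assume h: "\<not> (\<exists>a\<in>A. cle P m a)"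
    let ?D = "{x \<in> M. \<exists>a\<in>A. cle P x a}"
    have "downset M P ?D"
      unfolding downset_def
    proof (intro conjI ballI impI)
      show "?D \<noteq> {}" using A refl sgp_zero[OF A(1)] by blast
      show "?D \<noteq> M" using h m by blast
      show "y \<in> ?D" if "x \<in> ?D" "y \<in> M" "cle P y x" for x y using that trans by blast
    qed auto
    then have "cut_cone M ?D \<in> Z" by (rule goodD(4)[OF Z P])
    moreover have "A \<subseteq> cut_cone M ?D"
    proof
      fix a assume a: "a \<in> A"
      have "- a + x \<in> ?D" if x: "x \<in> ?D" for x
      proof -
        obtain a' where "a' \<in> A" "cle P x a'" "x \<in> M" using x by auto
        then have "cle P (- a + x) (- a + a')" "- a + a' \<in> A" "- a + x \<in> M"
          using a A M by (auto intro!: sgpI)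
        then show ?thesis by blast
      qed
      then show "a \<in> cut_cone M ?D" using a A by (auto simp: cut_cone_def)
    qed
    ultimately show False using nt by blast
  qed
  show "\<exists>a\<in>A. cle P a m"
  proof (rule ccontr)
    assume h: "\<not> (\<exists>a\<in>A. cle P a m)"
    let ?D = "{x \<in> M. \<forall>a\<in>A. \<not> cle P a x}"
    have "downset M P ?D"
      unfolding downset_def
    proof (intro conjI ballI impI)
      show "?D \<noteq> {}" using h m by blast
      show "?D \<noteq> M" using A refl sgp_zero[OF A(1)] by blast
      show "y \<in> ?D" if "x \<in> ?D" "y \<in> M" "cle P y x" for x y using that trans by blast
    qed auto
    then have "cut_cone M ?D \<in> Z" by (rule goodD(4)[OF Z P])
    moreover have "A \<subseteq> cut_cone M ?D"
    proof
      fix a assume a: "a \<in> A"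
      have "- a + x \<in> ?D" if x: "x \<in> ?D" for x
      proof -
        have "\<not> cle P a' (- a + x)" if "a' \<in> A" for a'
        proof
          assume "cle P a' (- a + x)"
          then have "cle P (a + a') (a + (- a + x))" by (simp only: cle_left)
          then have "cle P (a + a') x" by simp
          then show False using x a that A by (auto simp: sgpI)
        qed
        then show ?thesis using a x A M by (auto intro!: sgpI)
      qed
      then show "a \<in> cut_cone M ?D" using a A by (auto simp: cut_cone_def)
    qed
    ultimately show False using nt by blast
  qed
qed

text \<open>If \<open>M\<close> does not act trivially on the value group of \<open>N\<close>, then moving the base point
  along \<open>N\<close> to infinity yields a preorder on \<open>M\<close> whose leading term is the multiplier of
  that action.\<close>
lemma central_reduction:
  fixes M :: "'g::group_add set"
  assumes M: "sgp M" and Z: "good M Z" and nor: "normal_in N M" and ha: "has_arch N Z"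
  shows "has_arch M Z \<or> (\<exists>\<tau> :: 'g \<Rightarrow> real.
    (\<forall>x\<in>N. \<forall>y\<in>N. \<tau> (x + y) = \<tau> x + \<tau> y) \<and> (\<forall>m\<in>M. \<forall>n\<in>N. \<tau> (m + n + - m) = \<tau> n) \<and>
    (\<exists>P\<in>Z. {n \<in> N. \<tau> n = 0} \<subseteq> P))"
proof (cases "\<exists>Q\<in>Z. N \<subseteq> Q")
  case True
  \<comment> \<open>The zero homomorphism has all of \<open>N\<close> as kernel.\<close>
  then show ?thesis by (intro disjI2 exI[of _ "\<lambda>_. 0"]) auto
next
  case False
  note N = normal_inD[OF nor]
  have conjN: "m + n + - m \<in> N" if "m \<in> M" "n \<in> N" for m n using N that by blast
  obtain P where P: "P \<in> Z" "arch N (P \<inter> N)" using ha by (auto simp: has_arch_def)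
  have cP: "preord M P" using Z P(1) by (rule goodD)
  note trans = cle_trans[OF M cP] and refl = cle_refl[OF M cP]
  have unb: "\<exists>a\<in>N. cle P m a" "\<exists>a\<in>N. cle P a m" if "m \<in> M" for m
    using unbounded_if_nontrivial[OF M Z N(1,2) _ P(1) that] False by blast+
  obtain \<tau> :: "'g \<Rightarrow> real" where "\<forall>x\<in>N. \<forall>y\<in>N. \<tau> (x + y) = \<tau> x + \<tau> y"
    and "\<forall>x\<in>N. x \<in> P \<inter> N \<longleftrightarrow> 0 \<le> \<tau> x"
    using arch_hom[OF N(1) cone_restrict[OF cP N(1,2)] P(2)] by blast
  then have \<tau>: "\<And>x y. x \<in> N \<Longrightarrow> y \<in> N \<Longrightarrow> \<tau> (x + y) = \<tau> x + \<tau> y"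
    and sg: "\<And>x. x \<in> N \<Longrightarrow> x \<in> P \<longleftrightarrow> 0 \<le> \<tau> x" by blast+
  have hom: "\<tau> 0 = 0" "\<And>x. x \<in> N \<Longrightarrow> \<tau> (- x) = - \<tau> x"
    "\<And>x n. x \<in> N \<Longrightarrow> \<tau> (mul n x) = real n * \<tau> x"
    using hom_zero_minus[OF N(1), of \<tau>] \<tau> by blast+
  have \<tau>le: "cle P x y \<longleftrightarrow> \<tau> x \<le> \<tau> y" if "x \<in> N" "y \<in> N" for x y
    using sg[of "- x + y"] \<tau>[of "- x" y] hom that N by (simp add: cle_def sgpI)
  obtain u where u: "u \<in> N" "\<tau> u > 0"
  proof -
    obtain x where "x \<in> N" "x \<notin> P" using False P(1) by blast
    then have "- x \<in> N" "\<tau> (- x) > 0" using sg hom N by (auto simp: sgpI)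
    then show ?thesis using that by blast
  qed
  \<comment> \<open>The point \<open>y\<close> lies between two elements of \<open>N\<close>. If
    \<open>n + y \<le> y\<close>, then their values under \<open>\<tau>\<close> would bound all
    multiples of \<open>\<tau> n\<close>.\<close>
  have move: "\<not> cle P (n + y) y" if n: "n \<in> N" "\<tau> n > 0" and y: "y \<in> M" for n y
  proof
    assume le: "cle P (n + y) y"
    obtain n1 where n1: "n1 \<in> N" "cle P n1 y" using unb(2) y by blast
    obtain n2 where n2: "n2 \<in> N" "cle P y n2" using unb(1) y by blast
    have "cle P (mul k n + y) y" for k
    proof (induction k)
      case (Suc k)
      then have "cle P (n + (mul k n + y)) (n + y)" by (simp only: cle_left)
      then show ?case using le trans unfolding mul.simps add.assoc by blast
    qed (simp add: refl)
    moreover have "cle P (mul k n + n1) (mul k n + y)" for k using n1 by simp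
    ultimately have "cle P (mul k n + n1) n2" for k using n2 trans by blast
    then have "real k * \<tau> n + \<tau> n1 \<le> \<tau> n2" for k
      using \<tau>le n n1 n2 N hom \<tau> by (simp add: sgpI)
    moreover obtain k where "\<tau> n2 - \<tau> n1 < real k * \<tau> n" using reals_Archimedean3 n by blast
    ultimately show False by (smt (verit))
  qed
  have conj_pos: "\<tau> (g + n + - g) > 0" if "n \<in> N" "\<tau> n > 0" "g \<in> M" for g n
  proof -
    have "- (g + n + - g) \<notin> P" using move[OF that(1,2), of "- g"] that M by (simp add: cle_def grp sgpI)
    then show ?thesis using sg[of "- (g + n + - g)"] conjN that N hom by (auto simp: sgpI)
  qed
  have conj_sgn: "0 \<le> \<tau> n \<longleftrightarrow> 0 \<le> \<tau> (g + n + - g)" if "n \<in> N" "g \<in> M" for g n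
  proof
    assume "0 \<le> \<tau> n"
    show "0 \<le> \<tau> (g + n + - g)"
    proof (rule ccontr)
      assume "\<not> 0 \<le> \<tau> (g + n + - g)"
      then have "\<tau> (- g + - (g + n + - g) + - (- g)) > 0"
        using that conjN N M hom by (intro conj_pos) (auto simp: sgpI)
      moreover have "- g + - (g + n + - g) + - (- g) = - n" by (simp add: grp)
      ultimately show False using \<open>0 \<le> \<tau> n\<close> hom that by simp
    qed
  next
    assume h: "0 \<le> \<tau> (g + n + - g)"
    show "0 \<le> \<tau> n"
    proof (rule ccontr)
      assume "\<not> 0 \<le> \<tau> n"
      then have "\<tau> (g + - n + - g) > 0" using that N hom by (intro conj_pos) (auto simp: sgpI)
      moreover have "g + - n + - g = - (g + n + - g)" by (simp add: grp)
      ultimately show False using h hom conjN that by simp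
    qed
  qed
  \<comment> \<open>Conjugation by \<open>g\<close> preserves the sign of \<open>\<tau>\<close>, so
    by \<open>hom_proportional\<close> it multiplies \<open>\<tau>\<close> by a constant;
    \<open>lam\<close> is this multiplier, a homomorphism to the positive reals.\<close>
  define lam where "lam = (\<lambda>g. \<tau> (g + u + - g) / \<tau> u)"
  have lam: "\<tau> (g + n + - g) = lam g * \<tau> n" "lam g > 0" if g: "g \<in> M" and n: "n \<in> N" for g n
  proof -
    have "\<tau> (g + (x + y) + - g) = \<tau> (g + x + - g) + \<tau> (g + y + - g)" if "x \<in> N" "y \<in> N" for x y
      using \<tau>[OF conjN conjN, OF g that(1) g that(2)] by (simp add: grp)
    then show "\<tau> (g + n + - g) = lam g * \<tau> n"
      using hom_proportional(1)[OF N(1), of \<tau> "\<lambda>x. \<tau> (g + x + - g)" u n] \<tau> conj_sgn[OF _ g] u n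
      unfolding lam_def by blast
    show "lam g > 0" using conj_pos[OF u g] u by (simp add: lam_def)
  qed
  have lam_add: "lam (g + h) = lam g * lam h" if "g \<in> M" "h \<in> M" for g h
  proof -
    have "g + h + u + - (g + h) = g + (h + u + - h) + - g" by (simp add: grp)
    then show ?thesis using lam(1)[OF that(1) conjN[OF that(2) u(1)]] by (simp add: lam_def)
  qed
  have lam0: "lam 0 = 1" using u by (simp add: lam_def)
  have lam_minus: "lam (- g) = 1 / lam g" if "g \<in> M" for g
    using lam_add[of g "- g"] lam(2)[OF that u(1)] lam0 that M by (simp add: sgpI field_simps)
  have lampos: "lam g > 0" if "g \<in> M" for g using lam(2)[OF that u(1)] .
  have lam_diff: "lam (- d + m) = lam m / lam d" if "d \<in> M" "m \<in> M" for d m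
    using lam_add[of "- d" m] lam_minus[of d] that M by (simp add: sgpI)
  show ?thesis
  proof (cases "\<forall>g\<in>M. lam g = 1")
    case True
    have "{n \<in> N. \<tau> n = 0} \<subseteq> P" using sg by auto
    then show ?thesis using True lam \<tau> P(1) by (intro disjI2 exI[of _ \<tau>]) auto
  next
    case nontriv: False
    \<comment> \<open>The base point is moved to \<open>k u\<close>. The element
      \<open>h + k u\<close> is at least the conjugate of \<open>k u\<close> by \<open>h\<close>
      plus a constant from \<open>N\<close>. The value of this bound grows like
      \<open>lam h * k\<close>, which eventually exceeds \<open>k\<close> if
      \<open>lam h > 1\<close>.\<close>
    have "\<exists>Q\<in>Z. \<forall>h\<in>{h \<in> M. lam h > 1}. h \<in> Q \<and> - h \<notin> Q"
    proof (rule compactness_indexed[OF goodD(3)[OF Z]])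
      show "lim_closed {Q. h \<in> Q \<and> - h \<notin> Q}" for h :: 'g
        by (rule lim_closed_finitary[of "{h, - h}"]) (simp, blast)
      fix J assume J: "finite J" "J \<subseteq> {h \<in> M. lam h > 1}"
      have "\<forall>\<^sub>F k in sequentially. \<not> cle P (h + mul k u) (mul k u)" if h: "h \<in> J" for h
      proof -
        have hM: "h \<in> M" "lam h > 1" using J h by auto
        obtain n1 where n1: "n1 \<in> N" "cle P n1 h" using unb(2) hM by blast
        have "(lam h - 1) * \<tau> u > 0" using hM u by simp
        then obtain k0 where k0: "- \<tau> n1 < real k0 * ((lam h - 1) * \<tau> u)"
          using reals_Archimedean3 by blast
        have "\<not> cle P (h + mul k u) (mul k u)" if "k \<ge> k0" for k
        proof
          assume le: "cle P (h + mul k u) (mul k u)"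
          let ?w = "h + mul k u + - h + n1"
          have mk: "mul k u \<in> N" using u N by (simp add: sgpI)
          have c: "h + mul k u + - h \<in> N" using conjN hM mk by blast
          have "cle P ?w (h + mul k u + - h + h)" using n1(2) by (simp only: cle_left)
          moreover have "h + mul k u + - h + h = h + mul k u" by (simp add: grp)
          ultimately have "cle P ?w (mul k u)" using le trans by metis
          then have "\<tau> ?w \<le> \<tau> (mul k u)" using \<tau>le[of ?w "mul k u"] c mk n1 N by (simp add: sgpI)
          moreover have "\<tau> ?w = lam h * \<tau> (mul k u) + \<tau> n1"
            using \<tau>[OF c n1(1)] lam(1)[OF hM(1) mk] by simp
          ultimately have "real k * ((lam h - 1) * \<tau> u) \<le> - \<tau> n1"
            using hom(3)[OF u(1), of k] by (simp add: algebra_simps)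
          moreover have "real k0 * ((lam h - 1) * \<tau> u) \<le> real k * ((lam h - 1) * \<tau> u)"
            using that \<open>(lam h - 1) * \<tau> u > 0\<close> by (intro mult_right_mono) auto
          ultimately show False using k0 by simp
        qed
        then show ?thesis by (auto simp: eventually_sequentially)
      qed
      then have "\<forall>\<^sub>F k in sequentially. \<forall>h\<in>J. \<not> cle P (h + mul k u) (mul k u)"
        using J(1) by (intro eventually_ball_finite) auto
      then obtain k where k: "\<And>h. h \<in> J \<Longrightarrow> \<not> cle P (h + mul k u) (mul k u)"
        by (auto simp: eventually_sequentially)
      have mk: "mul k u \<in> M" using u N M by (auto simp: sgpI)
      let ?Q = "{h \<in> M. - mul k u + h + mul k u \<in> P}"
      have "?Q \<in> Z" by (rule good_conj[OF M Z P(1) mk])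
      moreover have "h \<in> ?Q \<and> - h \<notin> ?Q" if "h \<in> J" for h
      proof -
        have hM: "h \<in> M" using J that by auto
        have "- mul k u + - h + mul k u \<notin> P" using k[OF that] by (simp add: cle_def grp)
        moreover have "- (- mul k u + - h + mul k u) = - mul k u + h + mul k u" by (simp add: grp)
        moreover have "- mul k u + - h + mul k u \<in> M" using mk hM M by (auto intro!: sgpI)
        ultimately show ?thesis using cone_total[OF M cP] hM by fastforce
      qed
      ultimately show "\<exists>Q\<in>Z. \<forall>h\<in>J. h \<in> Q \<and> - h \<notin> Q" by blast
    qed
    then obtain Q where Q: "Q \<in> Z" "\<And>h. h \<in> M \<Longrightarrow> lam h > 1 \<Longrightarrow> - h \<notin> Q" by blast
    \<comment> \<open>The cut forgets everything but the multiplier: its preorder compares the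
      values of \<open>lam\<close>, and it is Archimedean because the powers of a number above 1 are
      unbounded.\<close>
    let ?D = "{h \<in> M. lam h \<le> 1}"
    have "downset M Q ?D"
      unfolding downset_def
    proof (intro conjI ballI impI)
      show "?D \<noteq> {}" using lam0 M by (auto simp: sgpI intro!: exI[of _ 0])
      obtain g where g: "g \<in> M" "lam g \<noteq> 1" using nontriv by blast
      then have "lam g > 1 \<or> lam (- g) > 1" using lam_minus lampos by (auto simp: field_simps)
      then show "?D \<noteq> M" using g M sgp_minus[OF M g(1)] by force
      fix d m assume d: "d \<in> ?D" and m: "m \<in> M" "cle Q m d"
      show "m \<in> ?D"
      proof (rule ccontr)
        assume "m \<notin> ?D"
        then have "lam (- d + m) > 1"
          using m d lam_diff[of d m] lampos[of d] by auto
        then have "- (- d + m) \<notin> Q" using Q(2) m d M by (auto simp: sgpI)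
        then show False using m(2) by (simp add: cle_def grp)
      qed
    qed auto
    then have "cut_cone M ?D \<in> Z" by (rule goodD(4)[OF Z Q(1)])
    moreover have cut: "h \<in> cut_cone M ?D" if "h \<in> M" "lam h \<ge> 1" for h
      unfolding cut_cone_def
    proof (rule CollectI, rule conjI[OF that(1)], rule ballI)
      fix d assume "d \<in> ?D"
      then show "- h + d \<in> ?D"
        using that lam_diff[of h d] lampos[of h] M by (auto simp: sgpI)
    qed
    moreover have "arch M (cut_cone M ?D \<inter> M)"
      unfolding arch_def
    proof (intro ballI impI)
      fix a y assume a: "a \<in> M" "- a \<notin> cut_cone M ?D \<inter> M" and y: "y \<in> M"
      have "\<not> lam (- a) \<ge> 1" using a M cut by (auto simp: sgpI)
      then have "lam a > 1" using lam_minus lampos a by (auto simp: field_simps)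
      then obtain n where n: "lam y < lam a ^ n" using real_arch_pow by blast
      have "lam (mul n a) = lam a ^ n" by (induction n) (use lam0 lam_add a M in \<open>auto simp: sgpI\<close>)
      then have "lam (- y + mul n a) \<ge> 1"
        using n lam_diff[of y "mul n a"] lampos[OF y] y a M by (simp add: sgpI)
      then have "- y + mul n a \<in> cut_cone M ?D \<inter> M" using cut y a M by (simp add: sgpI)
      then show "\<exists>n. cle (cut_cone M ?D \<inter> M) y (mul n a)" by (auto simp: cle_def)
    qed
    ultimately show ?thesis by (auto simp: has_arch_def)
  qed
qed

lemma normal_in_kernel:
  fixes \<tau> :: "'g::group_add \<Rightarrow> real"
  assumes nor: "normal_in N M" and \<tau>: "\<And>x y. x \<in> N \<Longrightarrow> y \<in> N \<Longrightarrow> \<tau> (x + y) = \<tau> x + \<tau> y"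
    and inv: "\<And>m n. m \<in> M \<Longrightarrow> n \<in> N \<Longrightarrow> \<tau> (m + n + - m) = \<tau> n"
  shows "normal_in {n \<in> N. \<tau> n = 0} M"
  using normal_inD[OF nor] \<tau> inv hom_zero_minus[OF normal_inD(1)[OF nor] \<tau>]
  by (auto simp: normal_in_def sgp_def)

section \<open>Extensions by groups without free subsemigroups\<close>

definition wev :: "'g::group_add \<Rightarrow> 'g \<Rightarrow> bool list \<Rightarrow> 'g" where
  "wev x y w = foldr (\<lambda>b acc. (if b then x else y) + acc) w 0"

lemma wev_simps [simp]: "wev x y [] = 0" "wev x y (b # w) = (if b then x else y) + wev x y w"
  by (simp_all add: wev_def)

lemma wev_append: "wev x y (v @ w) = wev x y v + wev x y w"
  by (induction v) (auto simp: add.assoc)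

lemma wev_in: "sgp M \<Longrightarrow> x \<in> M \<Longrightarrow> y \<in> M \<Longrightarrow> wev x y w \<in> M"
  by (induction w) (auto simp: sgpI)

definition ns_mod :: "'g::group_add set \<Rightarrow> 'g set \<Rightarrow> bool" where
  "ns_mod M N \<longleftrightarrow> (\<forall>x\<in>M. \<forall>y\<in>M. \<exists>v w. v \<noteq> w \<and> - wev x y v + wev x y w \<in> N)"

text \<open>If \<open>v\<close> and \<open>w\<close> agree up to a central element then \<open>vw\<close> and \<open>wv\<close> are equal.\<close>
lemma ns_mod_central:
  assumes M: "sgp M" and N: "sgp N" "N \<subseteq> M" and K: "sgp K"
    and com: "\<And>m n. m \<in> M \<Longrightarrow> n \<in> N \<Longrightarrow> m + n + - m + - n \<in> K"
    and ns: "ns_mod M N"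
  shows "ns_mod M K"
  unfolding ns_mod_def
proof (intro ballI)
  fix x y assume xy: "x \<in> M" "y \<in> M"
  let ?e = "wev x y"
  have eM: "?e w \<in> M" for w using M xy by (rule wev_in)
  have com': "- n + - m + n + m \<in> K" if "m \<in> M" "n \<in> N" for m n
  proof -
    have "- (- m + - n + - (- m) + - (- n)) \<in> K"
      using com[of "- m" "- n"] that M N K by (simp add: sgpI)
    then show ?thesis by (simp add: grp)
  qed
  have ext: "\<exists>v w. v \<noteq> w \<and> - ?e v + ?e w \<in> K" if "t \<noteq> []" "?e t \<in> N" for t
  proof -
    \<comment> \<open>A letter other than the first one of \<open>t\<close> makes
      \<open>t @ [c]\<close> and \<open>[c] @ t\<close> different words; their values agree modulo
      \<open>K\<close> because \<open>?e t\<close> lies in \<open>N\<close>.\<close>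
    define c where "c = (\<not> hd t)"
    have ne: "t @ [c] \<noteq> [c] @ t" using that by (cases t) (auto simp: c_def)
    have "- (?e t + ?e [c]) + (?e [c] + ?e t) = - (- ?e t + - ?e [c] + ?e t + ?e [c])"
      by (simp add: grp del: wev_simps)
    then have "- (?e t + ?e [c]) + (?e [c] + ?e t) \<in> K"
      using sgp_minus[OF K com'[OF eM that(2), of "[c]"]] by (simp only:)
    then show ?thesis using ne by (metis wev_append)
  qed
  obtain v w where vw: "v \<noteq> w" "- ?e v + ?e w \<in> N" using ns xy unfolding ns_mod_def by blast
  show "\<exists>v w. v \<noteq> w \<and> - ?e v + ?e w \<in> K"
  proof (cases "v @ w = w @ v")
    case False
    have "- ?e (v @ w) + ?e (w @ v) = - (- ?e v + ?e w) + - ?e v + (- ?e v + ?e w) + ?e v"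
      by (simp add: wev_append grp)
    then show ?thesis using com'[OF eM vw(2), of v] False by metis
  next
    case True
    \<comment> \<open>Of two commuting words one is a prefix of the other, so the relation reduces
      to a nonempty word with value in \<open>N\<close>.\<close>
    then obtain t where "v = w @ t \<or> w = v @ t" by (auto simp: append_eq_append_conv2)
    then have t: "t \<noteq> []" "?e v = ?e w + ?e t \<or> ?e w = ?e v + ?e t"
      using vw(1) by (auto simp: wev_append)
    have "?e t \<in> N"
      using t(2)
    proof
      assume "?e v = ?e w + ?e t"
      then have "?e t = - (- ?e v + ?e w)" by (simp add: grp)
      then show ?thesis using vw(2) N by (simp add: sgpI)
    next
      assume "?e w = ?e v + ?e t"
      then show ?thesis using vw(2) by simp
    qed
    then show ?thesis using ext t(1) by blast
  qed
qed

text \<open>Ping-pong: if \<open>a + n b \<le> b\<close> for all \<open>n\<close> then \<open>a\<close> and \<open>b\<close> map the initial segment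
  generated by the multiples of \<open>b\<close> to disjoint parts of itself.\<close>
lemma ns_mod_imp_conradian:
  assumes M: "sgp M" and P: "preord M P" and K: "sgp K" "K \<subseteq> P" and ns: "ns_mod M K"
  shows "conradian M P"
  unfolding conradian_def
proof (intro ballI impI, rule ccontr)
  fix a b assume a: "a \<in> M" "- a \<notin> P" and b: "b \<in> M" "- b \<notin> P"
    and "\<nexists>n. \<not> cle P (a + mul n b) b"
  then have le: "cle P (a + mul n b) b" for n by blast
  note trans = cle_trans[OF M P] and refl = cle_refl[OF M P] and total = cle_total[OF M P]
  have abP: "a \<in> P" "b \<in> P" using P a b by (auto simp: preord_def)
  let ?e = "wev a b"
  have I: "?e w \<in> P \<and> (\<exists>n. cle P (?e w) (mul n b))" for w
  proof (induction w)
    case Nil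
    show ?case using cone_zero[OF M P] by (auto intro!: exI[of _ 0] refl)
  next
    case (Cons c w)
    then obtain n where n: "cle P (?e w) (mul n b)" "?e w \<in> P" by blast
    show ?case
    proof (cases c)
      case True
      have "cle P (a + ?e w) (a + mul n b)" using n by simp
      then have "cle P (a + ?e w) b" using le trans by blast
      then have "cle P (a + ?e w) (mul 1 b)" by simp
      then show ?thesis using True cone_add[OF M P abP(1) n(2)] unfolding wev_simps by (simp only: if_True) blast
    next
      case False
      have "cle P (b + ?e w) (mul (Suc n) b)" using n by simp
      then show ?thesis using False cone_add[OF M P abP(2) n(2)] unfolding wev_simps by (simp only: if_False) blast
    qed
  qed
  \<comment> \<open>The element \<open>b\<close> separates the values of words starting with
    \<open>a\<close> from those of words starting with \<open>b\<close>; the step from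
    \<open>n b\<close> to \<open>(n + 1) b\<close> makes the separation strict.\<close>
  have strict: "\<not> cle P (b + ?e w) (a + ?e v)" for v w
  proof
    assume h: "cle P (b + ?e w) (a + ?e v)"
    obtain n where n: "cle P (?e v) (mul n b)" using I by blast
    have "cle P b (b + ?e w)" using I[of w] by (simp add: cle_def grp)
    moreover have "cle P (a + ?e v) (a + mul n b)" using n by simp
    ultimately have "cle P b (a + mul n b)" using h trans by blast
    moreover have "cle P (a + mul (Suc n) b) b" by (rule le)
    ultimately have "cle P (a + mul (Suc n) b) (a + mul n b)" using trans by blast
    then show False using not_cle_mul_Suc[OF M P b] by (simp only: cle_left)
  qed
  have pos: "\<not> cle P (?e (c # w)) 0" for c w
  proof
    assume h: "cle P (?e (c # w)) 0"
    define g where "g = (if c then a else b)"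
    have "cle P g (g + ?e w)" using I[of w] by (simp add: cle_def grp)
    moreover have "?e (c # w) = g + ?e w" by (simp add: g_def)
    ultimately have "cle P g 0" using h trans by metis
    then show False using a b by (simp add: cle_zero_right g_def split: if_splits)
  qed
  \<comment> \<open>Different words are compared at the first place where their letters differ or
    where one of them ends.\<close>
  have "\<not> (cle P (?e v) (?e w) \<and> cle P (?e w) (?e v))" if "v \<noteq> w" for v w
    using that
  proof (induction v arbitrary: w)
    case Nil
    then obtain c w' where "w = c # w'" by (cases w) auto
    then show ?case using pos[of c w'] by (simp del: wev_simps(2))
  next
    case (Cons c v)
    show ?case
    proof (cases w)
      case Nil
      then show ?thesis using pos[of c v] by (simp del: wev_simps(2))
    next
      case w: (Cons d w')
      show ?thesis
      proof (cases "c = d")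
        case True
        then have "v \<noteq> w'" using Cons.prems w by simp
        then show ?thesis using Cons.IH True w by simp
      next
        case False
        then show ?thesis using strict[of v w'] strict[of w' v] w by (cases c; cases d) auto
      qed
    qed
  qed
  moreover obtain v w where vw: "v \<noteq> w" "- ?e v + ?e w \<in> K" using ns a b unfolding ns_mod_def by blast
  moreover have "cle P (?e v) (?e w)" using vw K by (auto simp: cle_def)
  moreover have "cle P (?e w) (?e v)"
    using sgp_minus[OF K(1) vw(2)] K(2) by (auto simp: cle_def grp)
  ultimately show False by blast
qed

text \<open>If \<open>central_reduction\<close> yields \<open>\<tau>\<close>, then
  \<open>\<tau>\<close> kills the commutators of \<open>M\<close> with \<open>N\<close>, so
  \<open>N\<close> is central modulo its kernel. A relation modulo \<open>N\<close> improves to one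
  modulo this kernel, and a preorder in \<open>Z\<close> that is trivial on the kernel is therefore
  Conradian.\<close>

lemma has_arch_ns_extension:
  assumes M: "sgp M" and Z: "good M Z" and nor: "normal_in N M" and ha: "has_arch N Z"
    and ns: "ns_mod M N"
  shows "has_arch M Z"
proof (rule disjE[OF central_reduction[OF M Z nor ha]])
  assume "\<exists>\<tau> :: 'a \<Rightarrow> real. (\<forall>x\<in>N. \<forall>y\<in>N. \<tau> (x + y) = \<tau> x + \<tau> y) \<and>
    (\<forall>m\<in>M. \<forall>n\<in>N. \<tau> (m + n + - m) = \<tau> n) \<and> (\<exists>P\<in>Z. {n \<in> N. \<tau> n = 0} \<subseteq> P)"
  then obtain \<tau> :: "'a \<Rightarrow> real" and P where \<tau>: "\<And>x y. x \<in> N \<Longrightarrow> y \<in> N \<Longrightarrow> \<tau> (x + y) = \<tau> x + \<tau> y"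
    and inv: "\<And>m n. m \<in> M \<Longrightarrow> n \<in> N \<Longrightarrow> \<tau> (m + n + - m) = \<tau> n"
    and P: "P \<in> Z" "{n \<in> N. \<tau> n = 0} \<subseteq> P" by metis
  note N = normal_inD[OF nor]
  let ?K = "{n \<in> N. \<tau> n = 0}"
  have K: "normal_in ?K M" using nor \<tau> inv by (rule normal_in_kernel)
  have "m + n + - m + - n \<in> ?K" if "m \<in> M" "n \<in> N" for m n
    using \<tau>[of "m + n + - m" "- n"] inv[OF that] N that hom_zero_minus[OF N(1) \<tau>] by (simp add: sgpI)
  then have "ns_mod M ?K" using ns_mod_central[OF M N(1,2) normal_inD(1)[OF K]] ns by blast
  then have "conradian M P" using ns_mod_imp_conradian[OF M goodD(2)[OF Z P(1)] normal_inD(1)[OF K] P(2)] by blast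
  then obtain Q where Q: "Q \<in> Z" "arch M Q" using conradian_imp_arch[OF M Z P(1)] by blast
  moreover have "Q \<inter> M = Q" using goodD(2)[OF Z Q(1)] by (auto simp: preord_def)
  ultimately show ?thesis by (auto simp: has_arch_def intro!: bexI[of _ Q])
qed

subsection \<open>Commuting conjugates\<close>

text \<open>Zorn's lemma applies because a finite part of the union of a chain of stabilizers lies
  in one of them, and compactness then supplies a preorder that stabilizes the whole union.
  Stabilizers are closed under negation, so inclusion in the cone \<open>Q\<close> amounts to
  inclusion in its stabilizer.\<close>

lemma ex_maximal_stabilizer:
  assumes A: "sgp A" and Z: "lim_closed Z" "Z \<noteq> {}"
  shows "\<exists>P\<in>Z. \<forall>Q\<in>Z. {x \<in> A. x \<in> P \<and> - x \<in> P} \<subseteq> Q \<longrightarrow> {x \<in> A. x \<in> Q \<and> - x \<in> Q} \<subseteq> P"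
proof -
  let ?st = "\<lambda>P. {x \<in> A. x \<in> P \<and> - x \<in> P}"
  have "\<exists>m\<in>?st ` Z. \<forall>s\<in>?st ` Z. m \<subseteq> s \<longrightarrow> s = m"
  proof (rule subset_Zorn)
    fix \<C> assume C: "subset.chain (?st ` Z) \<C>"
    show "\<exists>U\<in>?st ` Z. \<forall>s\<in>\<C>. s \<subseteq> U"
    proof -
      have "\<exists>Q\<in>Z. \<forall>x\<in>\<Union>\<C>. x \<in> Q \<and> - x \<in> Q"
      proof (rule compactness_indexed[OF Z(1)])
        show "lim_closed {Q. x \<in> Q \<and> - x \<in> Q}" for x :: 'a
          by (rule lim_closed_finitary[of "{x, - x}"]) (simp, blast)
        fix J assume "finite J" "J \<subseteq> \<Union>\<C>"
        then show "\<exists>Q\<in>Z. \<forall>x\<in>J. x \<in> Q \<and> - x \<in> Q"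
        proof (cases "\<C> = {}")
          case True
          then show ?thesis using \<open>J \<subseteq> \<Union>\<C>\<close> Z by auto
        next
          case False
          then obtain c where "c \<in> \<C>" "J \<subseteq> c"
            using finite_subset_Union_chain[OF \<open>finite J\<close> \<open>J \<subseteq> \<Union>\<C>\<close> False C] by blast
          moreover from this obtain Q where "Q \<in> Z" "c = ?st Q" using C by (auto simp: subset.chain_def)
          ultimately show ?thesis by blast
        qed
      qed
      then obtain Q where Q: "Q \<in> Z" "\<forall>x\<in>\<Union>\<C>. x \<in> Q \<and> - x \<in> Q" by blast
      have "\<Union>\<C> \<subseteq> A" using C by (auto simp: subset.chain_def)
      then have "\<forall>s\<in>\<C>. s \<subseteq> ?st Q" using Q by blast
      then show ?thesis using Q by blast
    qed
  qed
  then obtain P where P: "P \<in> Z" "\<And>Q. Q \<in> Z \<Longrightarrow> ?st P \<subseteq> ?st Q \<Longrightarrow> ?st Q = ?st P" by blast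
  have "?st Q \<subseteq> P" if "Q \<in> Z" "?st P \<subseteq> Q" for Q
  proof -
    have "?st P \<subseteq> ?st Q" using that(2) A by (auto simp: sgpI)
    then show ?thesis using P(2)[OF that(1)] by blast
  qed
  then show ?thesis using P(1) by blast
qed

lemma sgp_conj: "sgp A \<Longrightarrow> sgp ((\<lambda>a. s + a + - s) ` A)"
  unfolding sgp_def
proof (intro conjI ballI; (elim conjE)?)
  assume a: "0 \<in> A" "\<forall>x\<in>A. \<forall>y\<in>A. x + y \<in> A" "\<forall>x\<in>A. - x \<in> A"
  show "0 \<in> (\<lambda>a. s + a + - s) ` A" using a by (intro image_eqI[of _ _ 0]) auto
  show "- x \<in> (\<lambda>a. s + a + - s) ` A" if x: "x \<in> (\<lambda>a. s + a + - s) ` A" for x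
  proof -
    obtain y where "y \<in> A" "x = s + y + - s" using x by auto
    then show ?thesis using a by (intro image_eqI[of _ _ "- y"]) (auto simp: grp)
  qed
  show "x + z \<in> (\<lambda>a. s + a + - s) ` A"
    if xz: "x \<in> (\<lambda>a. s + a + - s) ` A" "z \<in> (\<lambda>a. s + a + - s) ` A" for x z
  proof -
    obtain y w where "y \<in> A" "x = s + y + - s" "w \<in> A" "z = s + w + - s" using xz by auto
    then show ?thesis using a by (intro image_eqI[of _ _ "y + w"]) (auto simp: grp)
  qed
qed

text \<open>Choose a preorder whose stabilizer is maximal in \<open>B\<close>, and then in \<open>A\<close>. If a positive
  element of \<open>B\<close> moves some point of its own orbit downwards, then its powers are bounded, and
  cutting at their supremum shows that it is smaller than every positive element of \<open>A\<close>;
  hence it fixes every cut spanned by the multiples of an element of \<open>A\<close>, which forces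
  these multiples to be unbounded.\<close>
lemma has_arch_commuting_conjugate:
  fixes M :: "'g::group_add set"
  assumes M: "sgp M" and Z: "good M Z" and K: "normal_in K M" "\<And>P. P \<in> Z \<Longrightarrow> K \<subseteq> P"
    and A: "sgp A" "A \<subseteq> M" and s: "s \<in> M"
    and com: "\<And>a b. a \<in> A \<Longrightarrow> b \<in> A \<Longrightarrow> a + (s + b + - s) + - a + - (s + b + - s) \<in> K"
  shows "has_arch A Z"
proof (rule ccontr)
  assume no: "\<not> has_arch A Z"
  define B where "B = (\<lambda>a. s + a + - s) ` A"
  have B: "sgp B" "B \<subseteq> M"
    using sgp_conj[OF A(1)] A M s by (auto simp: B_def intro!: sgpI)
  \<comment> \<open>A preorder that is trivial on \<open>A\<close> would be Archimedean there.
    Consequently \<open>A\<close> is unbounded in both directions for every preorder in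
    \<open>Z\<close>.\<close>
  have nt: "\<not> A \<subseteq> Q" if "Q \<in> Z" for Q
  proof
    assume "A \<subseteq> Q"
    then have "arch A (Q \<inter> A)" unfolding arch_def using sgp_minus[OF A(1)] by blast
    then show False using no that by (auto simp: has_arch_def)
  qed
  obtain P1 where P1: "P1 \<in> Z" "\<And>Q. Q \<in> Z \<Longrightarrow> {x \<in> B. x \<in> P1 \<and> - x \<in> P1} \<subseteq> Q \<Longrightarrow> {x \<in> B. x \<in> Q \<and> - x \<in> Q} \<subseteq> P1"
    using ex_maximal_stabilizer[OF B(1) goodD(3)[OF Z] goodD(1)[OF Z]] by blast
  define B0 where "B0 = {x \<in> B. x \<in> P1 \<and> - x \<in> P1}"
  have B0min: "- x \<in> B0" if "x \<in> B0" for x using that B by (auto simp: B0_def sgpI)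
  \<comment> \<open>The second maximization takes place among the preorders that are still neutral
    on \<open>B0\<close>, so that \<open>P\<close> inherits both maximality properties.\<close>
  define Z1 where "Z1 = {Q \<in> Z. B0 \<subseteq> Q}"
  have "lim_closed {P. x \<in> P}" for x :: 'g by (rule lim_closed_finitary[of "{x}"]) auto
  then have "lim_closed (\<Inter>((\<lambda>x. {P. x \<in> P}) ` B0))" by (intro lim_closed_Inter) auto
  then have "lim_closed (Z \<inter> \<Inter>((\<lambda>x. {P. x \<in> P}) ` B0))" by (rule lim_closed_Int[OF goodD(3)[OF Z]])
  moreover have "Z \<inter> \<Inter>((\<lambda>x. {P. x \<in> P}) ` B0) = Z1" by (auto simp: Z1_def)
  ultimately have "lim_closed Z1" by simp
  moreover have "P1 \<in> Z1" using P1(1) by (auto simp: Z1_def B0_def)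
  ultimately obtain P where P: "P \<in> Z1"
    and maxA: "\<And>Q. Q \<in> Z1 \<Longrightarrow> {x \<in> A. x \<in> P \<and> - x \<in> P} \<subseteq> Q \<Longrightarrow> {x \<in> A. x \<in> Q \<and> - x \<in> Q} \<subseteq> P"
    using ex_maximal_stabilizer[OF A(1), of Z1] by blast
  have PZ: "P \<in> Z" and B0P: "B0 \<subseteq> P" using P by (auto simp: Z1_def)
  have maxB: "b \<in> B0" if "Q \<in> Z" "B0 \<subseteq> Q" "b \<in> B" "b \<in> Q" "- b \<in> Q" for Q b
  proof -
    have "{x \<in> B. x \<in> Q \<and> - x \<in> Q} \<subseteq> P1" using P1(2)[OF that(1)] that(2) by (simp add: B0_def)
    then show ?thesis using that B by (auto simp: B0_def sgpI)
  qed
  have cP: "preord M P" using Z PZ by (rule goodD)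
  note trans = cle_trans[OF M cP] and refl = cle_refl[OF M cP] and total = cle_total[OF M cP]
  have cofA: "\<exists>a\<in>A. cle P m a" "\<exists>a\<in>A. cle P a m" if "m \<in> M" for m
    using unbounded_if_nontrivial[OF M Z A nt PZ that] by blast+
  have swap: "cle P (a + b) (b + a)" "cle P (b + a) (a + b)" if ab: "a \<in> A" "b \<in> B" for a b
  proof -
    obtain b' where b': "b' \<in> A" "b = s + b' + - s" using ab by (auto simp: B_def)
    define k where "k = a + b + - a + - b"
    have kK: "k \<in> K" using com[OF ab(1) b'(1)] b' by (simp add: k_def)
    have "- (b + a) \<in> M" using ab A B M by (auto intro!: sgpI)
    then have "- (b + a) + k + - (- (b + a)) \<in> K" using normal_inD(3)[OF K(1)] kK by blast
    moreover have "- (b + a) + k + - (- (b + a)) = - (b + a) + (a + b)" by (simp add: k_def grp)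
    ultimately have c: "- (b + a) + (a + b) \<in> K" by simp
    then show "cle P (b + a) (a + b)" using K(2)[OF PZ] by (auto simp: cle_def)
    have "- (- (b + a) + (a + b)) \<in> K" using c normal_inD(1)[OF K(1)] by (simp only: sgp_minus)
    then show "cle P (a + b) (b + a)" using K(2)[OF PZ] by (auto simp: cle_def grp)
  qed
  have swap_mul: "cle P (a + mul n b) (mul n b + a)" "cle P (mul n b + a) (a + mul n b)"
    if "a \<in> A" "b \<in> B" for a b n
    using swap[OF that(1) sgp_mul[OF B(1) that(2)]] by blast+
  \<comment> \<open>A positive \<open>b\<close> moves every point of \<open>B\<close> upwards, which
    gives Conrad's condition on \<open>B\<close> with \<open>n = 1\<close>. A counterexample is
    refuted by showing that \<open>P\<close> would be Archimedean on \<open>A\<close>.\<close>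
  have strict: "- b \<in> P" if b: "b \<in> B" and b': "b' \<in> B" and le: "cle P (b + b') b'" for b b'
  proof (rule ccontr)
    assume bP: "- b \<notin> P"
    have bM: "b \<in> M" "b' \<in> M" using b b' B by auto
    have bpos: "b \<in> P" using cP bP bM by (auto simp: preord_def)
    have bB0: "b \<notin> B0" using B0min B0P bP by blast
    obtain a1 where a1: "a1 \<in> A" "cle P a1 b'" using cofA(2) bM by blast
    obtain a2 where a2: "a2 \<in> A" "cle P b' a2" using cofA(1) bM by blast
    \<comment> \<open>Commuting with \<open>a1\<close> turns the bound
      \<open>n b + b' \<le> b'\<close> into one on the multiples of \<open>b\<close> alone.\<close>
    have bnd: "cle P (mul n b) (- a1 + a2)" for n
    proof -
      have "cle P (mul n b + b') b'"
      proof (induction n)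
        case (Suc n)
        then have "cle P (b + (mul n b + b')) (b + b')" by (simp only: cle_left)
        then show ?case using le trans unfolding mul.simps add.assoc by blast
      qed (simp add: refl)
      moreover have "cle P (mul n b + a1) (mul n b + b')" using a1 by simp
      ultimately have "cle P (a1 + mul n b) a2" using swap_mul(1)[OF a1(1) b] a2(2) trans by blast
      then have "cle P (a1 + mul n b) (a1 + (- a1 + a2))" by (simp add: grp)
      then show ?thesis by (simp only: cle_left)
    qed
    let ?D = "{m \<in> M. \<exists>n. cle P m (mul n b)}"
    \<comment> \<open>The part of \<open>A\<close> dominated by the multiples of \<open>b\<close>;
      it is a subgroup because these multiples can be moved past the elements of
      \<open>A\<close>.\<close>
    define AD where "AD = {a \<in> A. a \<in> ?D \<and> - a \<in> ?D}"
    have AD0: "0 \<in> AD" using A refl M by (auto simp: AD_def sgpI intro!: exI[of _ 0])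
    have ADadd: "a + a' \<in> AD" if "a \<in> AD" "a' \<in> AD" for a a'
    proof -
      have add: "x + y \<in> ?D" if xy: "x \<in> A" "x \<in> ?D" "y \<in> ?D" for x y
      proof -
        obtain n m where "cle P x (mul n b)" "cle P y (mul m b)" using xy by auto
        then have "cle P (x + y) (x + mul m b)" "cle P (mul m b + x) (mul m b + mul n b)" by simp_all
        then have "cle P (x + y) (mul (m + n) b)"
          using swap_mul(1)[OF xy(1) b, of m] trans unfolding mul_add by blast
        then show ?thesis using xy M by (auto simp: sgpI)
      qed
      show ?thesis using that add[of a a'] add[of "- a'" "- a"] A by (auto simp: AD_def sgpI minus_add)
    qed
    have ADmin: "- a \<in> AD" if "a \<in> AD" for a using that A by (auto simp: AD_def sgpI)
    \<comment> \<open>An element of \<open>B0\<close> is equivalent to 0 and can be moved past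
      elements of \<open>A\<close>. Hence it fixes every point of \<open>A\<close> up to equivalence
      and preserves each initial segment spanned by such points.\<close>
    have fixes_cut: "b0 \<in> cut_cone M {m \<in> M. \<exists>a\<in>C. cle P m a}" if b0: "b0 \<in> B0" and C: "C \<subseteq> A" for b0 C
      unfolding cut_cone_def
    proof (rule CollectI, intro conjI ballI)
      have b0B: "b0 \<in> B" "- b0 \<in> B" "b0 \<in> M" "- b0 \<in> P"
        using b0 B B0P B0min by (auto simp: B0_def sgpI)
      show "b0 \<in> M" by fact
      fix m assume "m \<in> {m \<in> M. \<exists>a\<in>C. cle P m a}"
      then obtain a where a: "a \<in> C" "cle P m a" "m \<in> M" by blast
      then have "cle P (- b0 + m) (- b0 + a)" by simp
      moreover have "cle P (- b0 + a) (a + - b0)" using swap(2)[of a "- b0"] a C b0B by blast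
      moreover have "b0 \<in> P" using b0 B0P by blast
      then have "cle P (a + - b0) a" by (simp add: cle_def grp)
      ultimately have "cle P (- b0 + m) a" using trans by blast
      then show "- b0 + m \<in> {m \<in> M. \<exists>a\<in>C. cle P m a}" using a M b0B by (auto intro!: sgpI)
    qed
    \<comment> \<open>The cut at the segment spanned by \<open>AD\<close> is stabilized by
      \<open>AD\<close>. By maximality, \<open>AD\<close> was neutral for \<open>P\<close> already,
      so a positive element of \<open>A\<close> lies above all multiples of
      \<open>b\<close>.\<close>
    have below: "cle P b a" if a: "a \<in> A" "- a \<notin> P" for a
    proof -
      let ?D1 = "{m \<in> M. \<exists>a\<in>AD. cle P m a}"
      have D1D: "?D1 \<subseteq> ?D" using trans by (auto simp: AD_def)
      have "downset M P ?D1"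
        unfolding downset_def
      proof (intro conjI ballI impI)
        show "?D1 \<noteq> {}" using AD0 refl sgp_zero[OF M] by blast
        \<comment> \<open>The multiples of \<open>b\<close> are bounded by \<open>- a1 + a2\<close>,
          and adding \<open>b\<close> on the right gives a point strictly above this bound.\<close>
        show "?D1 \<noteq> M"
        proof
          assume "?D1 = M"
          moreover have "- a1 + a2 + b \<in> M" using a1 a2 A bM M by (auto intro!: sgpI)
          ultimately have "- a1 + a2 + b \<in> ?D" using D1D by blast
          then have "cle P (- a1 + a2 + b) (- a1 + a2)" using bnd trans by blast
          then have "cle P (- a1 + a2 + b) (- a1 + a2 + 0)" by (simp only: add_0_right)
          then show False using bP by (simp only: cle_left cle_zero_right)
        qed
        show "y \<in> ?D1" if "x \<in> ?D1" "y \<in> M" "cle P y x" for x y using that trans by blast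
      qed auto
      then have QZ: "cut_cone M ?D1 \<in> Z" by (rule goodD(4)[OF Z PZ])
      have "B0 \<subseteq> cut_cone M ?D1" using fixes_cut[of _ AD] by (auto simp: AD_def)
      then have QZ1: "cut_cone M ?D1 \<in> Z1" using QZ by (simp add: Z1_def)
      have ADQ: "c \<in> cut_cone M ?D1" if c: "c \<in> AD" for c
        unfolding cut_cone_def
      proof (rule CollectI, intro conjI ballI)
        show "c \<in> M" using c by (auto simp: AD_def)
        fix m assume "m \<in> ?D1"
        then obtain a where "a \<in> AD" "cle P m a" "m \<in> M" by blast
        then have "- c + a \<in> AD" "cle P (- c + m) (- c + a)" "- c + m \<in> M"
          using ADadd[OF ADmin[OF c]] \<open>c \<in> M\<close> M by (auto intro: sgpI)
        then show "- c + m \<in> ?D1" by blast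
      qed
      have "{x \<in> A. x \<in> P \<and> - x \<in> P} \<subseteq> AD"
        using A sgp_minus[OF A(1)] by (auto simp: AD_def cle_zero_right intro!: exI[of _ 0])
      then have "{x \<in> A. x \<in> P \<and> - x \<in> P} \<subseteq> cut_cone M ?D1" using ADQ by blast
      then have max: "{x \<in> A. x \<in> cut_cone M ?D1 \<and> - x \<in> cut_cone M ?D1} \<subseteq> P" by (rule maxA[OF QZ1])
      have "a \<notin> ?D"
      proof
        assume "a \<in> ?D"
        moreover have "a \<in> P" using cP a A by (auto simp: preord_def)
        then have "- a \<in> ?D" using a A M by (auto simp: cle_zero_right sgpI intro!: exI[of _ 0])
        ultimately have "a \<in> AD" using a by (simp add: AD_def)
        then have "- a \<in> {x \<in> A. x \<in> cut_cone M ?D1 \<and> - x \<in> cut_cone M ?D1}"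
          using ADQ[of a] ADQ[of "- a"] ADmin a A by (simp add: sgpI)
        then have "- a \<in> P" using max by blast
        then show False using a by simp
      qed
      then have "\<not> cle P a (mul 1 b)" using a A by blast
      then show ?thesis using total[of a b] a A bM by auto
    qed
    have "arch A (P \<inter> A)"
      unfolding arch_def
    proof (intro ballI impI)
      fix a y assume a: "a \<in> A" "- a \<notin> P \<inter> A" and y: "y \<in> A"
      have aP: "- a \<notin> P" using a A by (auto simp: sgpI)
      have ba: "cle P b a" using below a aP by blast
      let ?C = "range (\<lambda>n. mul n a)"
      have CA: "?C \<subseteq> A" using a A by (auto simp: sgpI)
      let ?D3 = "{m \<in> M. \<exists>c\<in>?C. cle P m c}"
      \<comment> \<open>Otherwise the cut at \<open>?D3\<close> is stabilized by \<open>B0\<close>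
        and also by \<open>b\<close>, since translation by \<open>b\<close> moves a multiple of
        \<open>a\<close> no further than to the next one. This contradicts the maximality of
        \<open>B0\<close>.\<close>
      have "?D3 = M"
      proof (rule ccontr)
        assume "?D3 \<noteq> M"
        have "downset M P ?D3"
          unfolding downset_def
        proof (intro conjI ballI impI)
          have "cle P 0 (mul 0 a)" using refl[of 0] by simp
          then show "?D3 \<noteq> {}" using sgp_zero[OF M] by blast
          show "?D3 \<noteq> M" by fact
          show "y \<in> ?D3" if "x \<in> ?D3" "y \<in> M" "cle P y x" for x y using that trans by blast
        qed auto
        then have QZ: "cut_cone M ?D3 \<in> Z" by (rule goodD(4)[OF Z PZ])
        have "B0 \<subseteq> cut_cone M ?D3" using fixes_cut[OF _ CA] by blast
        moreover have "b \<in> cut_cone M ?D3"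
          unfolding cut_cone_def
        proof (rule CollectI, intro conjI ballI)
          show "b \<in> M" by (rule bM)
          fix m assume "m \<in> ?D3"
          then obtain n where n: "cle P m (mul n a)" "m \<in> M" by blast
          then have "cle P (- b + m) (- b + mul n a)" by simp
          moreover have "cle P (- b + mul n a) (mul n a + - b)"
            using swap(2)[OF sgp_mul[OF A(1) a(1)] sgp_minus[OF B(1) b]] .
          moreover have "cle P (mul n a + - b) (mul n a + 0)" unfolding cle_left using bpos by (simp add: cle_def)
          ultimately have "cle P (- b + m) (mul n a + 0)" using trans by blast
          then show "- b + m \<in> ?D3" using n bM M by (auto intro!: sgpI)
        qed
        moreover have "- b \<in> cut_cone M ?D3"
          unfolding cut_cone_def
        proof (rule CollectI, intro conjI ballI)
          show "- b \<in> M" using bM M by (simp add: sgpI)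
          fix m assume "m \<in> ?D3"
          then obtain n where n: "cle P m (mul n a)" "m \<in> M" by blast
          then have "cle P (b + m) (b + mul n a)" by simp
          moreover have "cle P (b + mul n a) (mul n a + b)"
            using swap(2)[OF sgp_mul[OF A(1) a(1)] b] .
          moreover have "cle P (mul n a + b) (mul n a + a)" unfolding cle_left by (rule ba)
          ultimately have "cle P (b + m) (mul (Suc n) a)" using trans unfolding mul_comm mul.simps by blast
          then have "b + m \<in> ?D3" using n bM M by (auto simp: sgpI simp del: mul.simps)
          then show "- (- b) + m \<in> ?D3" by simp
        qed
        ultimately show False using maxB[OF QZ _ b] bB0 by blast
      qed
      then obtain n where "cle P y (mul n a)" using y A by blast
      then show "\<exists>n. cle (P \<inter> A) y (mul n a)" using y a A by (auto simp: cle_def sgpI intro!: exI[of _ n])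
    qed
    then show False using no PZ by (auto simp: has_arch_def)
  qed
  have "conradian B (P \<inter> B)"
    unfolding conradian_def
  proof (intro ballI impI exI[of _ 1])
    fix a b assume ab: "a \<in> B" "b \<in> B" "- a \<notin> P \<inter> B"
    then have "\<not> cle P (a + b) b" using strict B by (auto simp: sgpI)
    then show "\<not> cle (P \<inter> B) (a + mul 1 b) b" by (simp add: cle_def)
  qed
  then obtain Q where Q: "Q \<in> Z" "arch B (Q \<inter> B)"
    using conradian_imp_arch[OF B(1) good_restrict[OF M Z B]] PZ by blast
  \<comment> \<open>Conjugation by \<open>s\<close> carries the Archimedean preorder on
    \<open>B\<close> back to \<open>A\<close>.\<close>
  let ?Q = "{h \<in> M. - (- s) + h + - s \<in> Q}"
  have "?Q \<in> Z" by (rule good_conj[OF M Z Q(1) sgp_minus[OF M s]])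
  moreover have "arch A (?Q \<inter> A)"
    unfolding arch_def
  proof (intro ballI impI)
    fix a y assume a: "a \<in> A" "- a \<notin> ?Q \<inter> A" and y: "y \<in> A"
    let ?c = "\<lambda>a. s + a + - s"
    have "- a \<in> A" "- a \<in> M" using a A by (auto intro: sgp_minus)
    then have "- ?c a \<notin> Q \<inter> B" using a by (auto simp: grp)
    moreover have "?c a \<in> B" "?c y \<in> B" using a y by (auto simp: B_def)
    ultimately obtain n where "cle (Q \<inter> B) (?c y) (mul n (?c a))" using Q(2) unfolding arch_def by blast
    then have "s + (- y + mul n a) + - s \<in> Q"
      unfolding cle_def mul_conj by (simp add: grp)
    moreover have "- y + mul n a \<in> A" using a y A by (simp add: sgpI)
    moreover from this have "- y + mul n a \<in> M" using A by blast
    ultimately have "- y + mul n a \<in> ?Q \<inter> A" by simp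
    then show "\<exists>n. cle (?Q \<inter> A) y (mul n a)" by (auto simp: cle_def)
  qed
  ultimately show False using no by (auto simp: has_arch_def)
qed

text \<open>An abelian quotient satisfies the relation \<open>x y = y x\<close> between positive
  words.\<close>

lemma has_arch_abelian_extension:
  assumes M: "sgp M" and Z: "good M Z" and W: "sgp W" "W \<subseteq> M" and A: "sgp A" "A \<subseteq> W"
    and com: "\<And>x y. x \<in> W \<Longrightarrow> y \<in> W \<Longrightarrow> x + y + - x + - y \<in> A" and ha: "has_arch A Z"
  shows "has_arch W Z"
proof -
  have "normal_in A W"
    unfolding normal_in_def
  proof (intro conjI ballI A)
    fix m k assume "m \<in> W" "k \<in> A"
    then have "m + k + - m + - k \<in> A" "k \<in> A" using com A by auto
    then have "m + k + - m + - k + k \<in> A" using A(1) by (blast intro: sgp_add)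
    then show "m + k + - m \<in> A" by (simp add: grp)
  qed
  moreover have "has_arch A ((\<lambda>P. P \<inter> W) ` Z)" using ha has_arch_restrict_iff[OF A(2)] by simp
  moreover have "ns_mod W A"
    unfolding ns_mod_def
  proof (intro ballI)
    fix x y assume xy: "x \<in> W" "y \<in> W"
    have "- y + - x + - (- y) + - (- x) \<in> A" using com xy W by (blast intro: sgp_minus)
    then have "- wev x y [True, False] + wev x y [False, True] \<in> A" by (simp add: grp)
    then show "\<exists>v w. v \<noteq> w \<and> - wev x y v + wev x y w \<in> A" by blast
  qed
  ultimately have "has_arch W ((\<lambda>P. P \<inter> W) ` Z)"
    using has_arch_ns_extension[OF W(1) good_restrict[OF M Z W]] by blast
  then show ?thesis using has_arch_restrict_iff[of W W Z] by simp
qed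

text \<open>The commutators with the elements of a commuting conjugate are homomorphisms into the
  value group of \<open>N\<close>, so they vanish on a subgroup \<open>A\<close> of \<open>W\<close> with abelian quotient.\<close>
lemma has_arch_displaced:
  fixes M :: "'g::group_add set"
  assumes M: "sgp M" and Z: "good M Z" and nor: "normal_in N M" and ha: "has_arch N Z"
    and W: "sgp W" "W \<subseteq> M" and s: "s \<in> M"
    and com: "\<And>x y. x \<in> W \<Longrightarrow> y \<in> W \<Longrightarrow> x + (s + y + - s) + - x + - (s + y + - s) \<in> N"
  shows "has_arch W Z"
proof (rule disjE[OF central_reduction[OF M Z nor ha]])
  assume "has_arch M Z"
  then show ?thesis using arch_restrict[OF W] by (auto simp: has_arch_def)
next
  assume "\<exists>\<tau> :: 'g \<Rightarrow> real. (\<forall>x\<in>N. \<forall>y\<in>N. \<tau> (x + y) = \<tau> x + \<tau> y) \<and>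
    (\<forall>m\<in>M. \<forall>n\<in>N. \<tau> (m + n + - m) = \<tau> n) \<and> (\<exists>P\<in>Z. {n \<in> N. \<tau> n = 0} \<subseteq> P)"
  then obtain \<tau> :: "'g \<Rightarrow> real" where \<tau>: "\<And>x y. x \<in> N \<Longrightarrow> y \<in> N \<Longrightarrow> \<tau> (x + y) = \<tau> x + \<tau> y"
    and inv: "\<And>m n. m \<in> M \<Longrightarrow> n \<in> N \<Longrightarrow> \<tau> (m + n + - m) = \<tau> n"
    and P: "\<exists>P\<in>Z. {n \<in> N. \<tau> n = 0} \<subseteq> P" by metis
  note N = normal_inD[OF nor]
  let ?K = "{n \<in> N. \<tau> n = 0}"
  have K: "normal_in ?K M" using nor \<tau> inv by (rule normal_in_kernel)
  \<comment> \<open>For preorders that are trivial on the kernel of \<open>\<tau>\<close>,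
    commutators may be read modulo this kernel.\<close>
  let ?Z = "{P \<in> Z. ?K \<subseteq> P}"
  have Z': "good M ?Z" using M Z K P by (rule good_trivial_on)
  define c where "c = (\<lambda>y. s + y + - s)"
  define q where "q = (\<lambda>x y. x + c y + - x + - c y)"
  have qN: "q x y \<in> N" if "x \<in> W" "y \<in> W" for x y using com that by (simp add: q_def c_def)
  have qadd: "\<tau> (q (x + x') y) = \<tau> (q x y) + \<tau> (q x' y)" if "x \<in> W" "x' \<in> W" "y \<in> W" for x x' y
  proof -
    \<comment> \<open>In multiplicative notation, \<open>[x x', c] = x [x', c] x^-1 [x, c]\<close>;
      the conjugation by \<open>x\<close> disappears under \<open>\<tau>\<close>.\<close>
    have "q (x + x') y = (x + q x' y + - x) + q x y" by (simp add: q_def grp)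
    moreover have "x \<in> M" using that W by blast
    note c = N(3)[OF this qN[OF that(2,3)]] inv[OF this qN[OF that(2,3)]]
    ultimately show ?thesis using \<tau>[OF c(1) qN[OF that(1,3)]] c(2) by simp
  qed
  have q0: "\<tau> (q 0 y) = 0" for y using hom_zero_minus(1)[OF N(1), of \<tau>] \<tau> by (simp add: q_def)
  have qmin: "\<tau> (q (- x) y) = - \<tau> (q x y)" if "x \<in> W" "y \<in> W" for x y
    using qadd[of x "- x" y] q0 that W by (simp add: sgpI)
  define A where "A = {x \<in> W. \<forall>y\<in>W. \<tau> (q x y) = 0}"
  have comA: "x + y + - x + - y \<in> A" if "x \<in> W" "y \<in> W" for x y
    using that W qadd qmin by (simp add: A_def sgpI)
  have sA: "sgp A" using W q0 qadd qmin by (auto simp: A_def sgp_def)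
  have "has_arch A ?Z"
  proof (rule has_arch_commuting_conjugate[OF M Z' K _ sA _ s])
    show "?K \<subseteq> P" if "P \<in> ?Z" for P using that by auto
    show "A \<subseteq> M" using W by (auto simp: A_def)
    show "a + (s + b + - s) + - a + - (s + b + - s) \<in> ?K" if "a \<in> A" "b \<in> A" for a b
      using that com by (auto simp: A_def q_def c_def)
  qed
  moreover have "A \<subseteq> W" by (auto simp: A_def)
  ultimately have "has_arch W ?Z" using has_arch_abelian_extension[OF M Z' W sA] comA by blast
  then show ?thesis by (auto simp: has_arch_def)
qed

subsection \<open>The closure properties of the class\<close>

text \<open>Quantifying over the good sets on \<open>N\<close> itself makes the property independent
  of an overgroup: a good set on an overgroup restricts to one on \<open>N\<close>.\<close>

definition tame :: "'g::group_add set \<Rightarrow> bool" where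
  "tame N \<longleftrightarrow> sgp N \<and> (\<forall>Z. good N Z \<longrightarrow> has_arch N Z)"

text \<open>A subgroup \<open>E\<close> of \<open>Q \<times> 'g\<close> encodes a homomorphism from a subgroup of \<open>Q\<close> onto the
  quotient of \<open>snd ` E\<close> by the fibre of \<open>E\<close> over the identity, so that \<open>tame_quotient\<close> says that
  extensions of tame groups by subquotients of \<open>Q\<close> are tame.\<close>
definition subquot :: "('u, 'b) monoid_scheme \<Rightarrow> ('u \<times> 'g::group_add) set \<Rightarrow> bool" where
  "subquot Q E \<longleftrightarrow> E \<subseteq> carrier Q \<times> UNIV \<and> (\<one>\<^bsub>Q\<^esub>, 0) \<in> E \<and>
     (\<forall>q m r n. (q, m) \<in> E \<longrightarrow> (r, n) \<in> E \<longrightarrow> (q \<otimes>\<^bsub>Q\<^esub> r, m + n) \<in> E) \<and>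
     (\<forall>q m. (q, m) \<in> E \<longrightarrow> (\<exists>r. (r, - m) \<in> E \<and> q \<otimes>\<^bsub>Q\<^esub> r = \<one>\<^bsub>Q\<^esub> \<and> r \<otimes>\<^bsub>Q\<^esub> q = \<one>\<^bsub>Q\<^esub>))"

abbreviation fibre :: "('u, 'b) monoid_scheme \<Rightarrow> ('u \<times> 'g) set \<Rightarrow> 'g set" where
  "fibre Q E \<equiv> {m. (\<one>\<^bsub>Q\<^esub>, m) \<in> E}"

definition tame_quotient :: "'g::group_add itself \<Rightarrow> ('u, 'b) monoid_scheme \<Rightarrow> bool" where
  "tame_quotient _ Q \<longleftrightarrow>
     (\<forall>E :: ('u \<times> 'g) set. subquot Q E \<longrightarrow> tame (fibre Q E) \<longrightarrow> tame (snd ` E))"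

lemma subquotD:
  assumes "subquot Q E"
  shows "(q, m) \<in> E \<Longrightarrow> q \<in> carrier Q" "(\<one>\<^bsub>Q\<^esub>, 0) \<in> E"
    "(q, m) \<in> E \<Longrightarrow> (r, n) \<in> E \<Longrightarrow> (q \<otimes>\<^bsub>Q\<^esub> r, m + n) \<in> E"
    "(q, m) \<in> E \<Longrightarrow> \<exists>r. (r, - m) \<in> E \<and> q \<otimes>\<^bsub>Q\<^esub> r = \<one>\<^bsub>Q\<^esub> \<and> r \<otimes>\<^bsub>Q\<^esub> q = \<one>\<^bsub>Q\<^esub>"
  using assms unfolding subquot_def by auto

lemma sgp_snd_subquot: "subquot Q E \<Longrightarrow> sgp (snd ` E)"
  unfolding sgp_def
proof (intro conjI ballI)
  assume E: "subquot Q E"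
  show "0 \<in> snd ` E" using subquotD(2)[OF E] by force
  show "x + y \<in> snd ` E" if "x \<in> snd ` E" "y \<in> snd ` E" for x y
    using that subquotD(3)[OF E] by force
  show "- x \<in> snd ` E" if "x \<in> snd ` E" for x
    using that subquotD(4)[OF E] by force
qed

lemma normal_in_fibre:
  assumes E: "subquot Q E" and one: "\<And>q. q \<in> carrier Q \<Longrightarrow> q \<otimes>\<^bsub>Q\<^esub> \<one>\<^bsub>Q\<^esub> = q"
  shows "normal_in (fibre Q E) (snd ` E)"
  unfolding normal_in_def sgp_def
proof (intro conjI ballI)
  have o: "\<one>\<^bsub>Q\<^esub> \<in> carrier Q" using subquotD(1,2)[OF E] by blast
  show "0 \<in> fibre Q E" using subquotD(2)[OF E] by simp
  show "x + y \<in> fibre Q E" if "x \<in> fibre Q E" "y \<in> fibre Q E" for x y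
    using that subquotD(3)[OF E, of "\<one>\<^bsub>Q\<^esub>" x "\<one>\<^bsub>Q\<^esub>" y] one[OF o] by simp
  show "- x \<in> fibre Q E" if "x \<in> fibre Q E" for x
  proof -
    obtain r where r: "(r, - x) \<in> E" "r \<otimes>\<^bsub>Q\<^esub> \<one>\<^bsub>Q\<^esub> = \<one>\<^bsub>Q\<^esub>"
      using subquotD(4)[OF E, of "\<one>\<^bsub>Q\<^esub>" x] \<open>x \<in> fibre Q E\<close> by auto
    then have "r = \<one>\<^bsub>Q\<^esub>" using one[OF subquotD(1)[OF E r(1)]] by simp
    then show ?thesis using r by simp
  qed
  show "fibre Q E \<subseteq> snd ` E" by force
  show "m + k + - m \<in> fibre Q E" if m: "m \<in> snd ` E" and k: "k \<in> fibre Q E" for m k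
  proof -
    obtain q where q: "(q, m) \<in> E" using m by force
    obtain r where r: "(r, - m) \<in> E" "q \<otimes>\<^bsub>Q\<^esub> r = \<one>\<^bsub>Q\<^esub>" using subquotD(4)[OF E q] by blast
    have "(q \<otimes>\<^bsub>Q\<^esub> \<one>\<^bsub>Q\<^esub> \<otimes>\<^bsub>Q\<^esub> r, m + k + - m) \<in> E"
      using q k r(1) by (intro subquotD(3)[OF E]) auto
    then show ?thesis using one[OF subquotD(1)[OF E q]] r(2) by simp
  qed
qed

lemma tame_directed_Union:
  assumes "\<S> \<noteq> {}" and S: "\<And>S. S \<in> \<S> \<Longrightarrow> tame S"
    and "\<And>S T. S \<in> \<S> \<Longrightarrow> T \<in> \<S> \<Longrightarrow> \<exists>U\<in>\<S>. S \<union> T \<subseteq> U"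
  shows "tame (\<Union>\<S>)"
  unfolding tame_def
proof (intro conjI allI impI)
  show U: "sgp (\<Union>\<S>)" using assms by (intro sgp_directed_Union) (auto simp: tame_def)
  fix Z assume Z: "good (\<Union>\<S>) Z"
  show "has_arch (\<Union>\<S>) Z"
  proof (rule has_arch_Union[OF U Z assms(1) _ assms(3)])
    fix S assume S': "S \<in> \<S>"
    then have SU: "sgp S" "S \<subseteq> \<Union>\<S>" using S by (auto simp: tame_def)
    then have "has_arch S ((\<lambda>P. P \<inter> S) ` Z)"
      using S[OF S'] good_restrict[OF U Z SU] by (auto simp: tame_def)
    then show "sgp S \<and> S \<subseteq> \<Union>\<S> \<and> has_arch S Z"
      using SU has_arch_restrict_iff[of S S Z] by simp
  qed
qed

lemma tame_has_arch:
  assumes "tame N" "sgp M" "good M Z" "N \<subseteq> M"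
  shows "has_arch N Z"
  using assms good_restrict[of M Z N] has_arch_restrict_iff[of N N Z] by (auto simp: tame_def)

lemma tame_quotient_NS:
  fixes H :: "('u, 'b) monoid_scheme"
  assumes H: "NS_group H"
  shows "tame_quotient TYPE('g::group_add) H"
  unfolding tame_quotient_def
proof (intro allI impI)
  fix E :: "('u \<times> 'g) set"
  assume E: "subquot H E" and t: "tame (fibre H E)"
  have gH: "group H" using H by (simp add: NS_group_def)
  then have one: "q \<otimes>\<^bsub>H\<^esub> \<one>\<^bsub>H\<^esub> = q" if "q \<in> carrier H" for q
    using that by (simp add: group.is_monoid monoid.r_one)
  note nor = normal_in_fibre[OF E one]
  have M: "sgp (snd ` E)" by (rule sgp_snd_subquot[OF E])
  have we: "(word_eval H p q w, wev x y w) \<in> E" if "(p, x) \<in> E" "(q, y) \<in> E" for p q x y w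
    using that subquotD(2,3)[OF E] by (induction w) (auto simp: word_eval_def)
  have "ns_mod (snd ` E) (fibre H E)"
    unfolding ns_mod_def
  proof (intro ballI)
    fix x y assume "x \<in> snd ` E" "y \<in> snd ` E"
    then obtain p q where pq: "(p, x) \<in> E" "(q, y) \<in> E" by force
    then obtain v w where vw: "v \<noteq> w" "word_eval H p q v = word_eval H p q w"
      using H subquotD(1)[OF E] unfolding NS_group_def by metis
    obtain r where "(r, - wev x y v) \<in> E" "r \<otimes>\<^bsub>H\<^esub> word_eval H p q v = \<one>\<^bsub>H\<^esub>"
      using subquotD(4)[OF E we[OF pq]] by blast
    then have "- wev x y v + wev x y w \<in> fibre H E"
      using subquotD(3)[OF E _ we[OF pq, of w]] vw(2) by fastforce
    then show "\<exists>v w. v \<noteq> w \<and> - wev x y v + wev x y w \<in> fibre H E" using vw(1) by blast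
  qed
  then show "tame (snd ` E)"
    unfolding tame_def
    using has_arch_ns_extension[OF M _ nor] tame_has_arch[OF t M _ normal_inD(2)[OF nor]] M by blast
qed

lemma tame_quotient_sub:
  assumes "tame_quotient TYPE('g::group_add) H" "S \<subseteq> carrier H"
  shows "tame_quotient TYPE('g) (H\<lparr>carrier := S\<rparr>)"
  unfolding tame_quotient_def
proof (intro allI impI)
  fix E :: "('a \<times> 'g) set"
  assume E: "subquot (H\<lparr>carrier := S\<rparr>) E" and t: "tame (fibre (H\<lparr>carrier := S\<rparr>) E)"
  have "subquot H E" using E assms(2) by (auto simp: subquot_def)
  then show "tame (snd ` E)" using assms(1) t unfolding tame_quotient_def by simp
qed

text \<open>Pulling \<open>E\<close> back along \<open>h\<close> changes neither the fibre over the
  identity nor, by surjectivity, the second projection.\<close>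

lemma tame_quotient_image:
  fixes H :: "('u, 'b) monoid_scheme" and K :: "('v, 'c) monoid_scheme"
  assumes H: "group H" and K: "group K" and h: "h \<in> hom H K" "h ` carrier H = carrier K"
    and t: "tame_quotient TYPE('g::group_add) H"
  shows "tame_quotient TYPE('g) K"
  unfolding tame_quotient_def
proof (intro allI impI)
  fix E :: "('v \<times> 'g) set"
  assume E: "subquot K E" and tE: "tame (fibre K E)"
  interpret h: group_hom H K h using H K h(1) by (simp add: group_hom_def group_hom_axioms_def)
  let ?E = "{(q, m). q \<in> carrier H \<and> (h q, m) \<in> E}"
  have E': "subquot H ?E"
    unfolding subquot_def
  proof (intro conjI allI impI)
    show "?E \<subseteq> carrier H \<times> UNIV" by auto
    show "(\<one>\<^bsub>H\<^esub>, 0) \<in> ?E" using subquotD(2)[OF E] by simp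
    show "(q \<otimes>\<^bsub>H\<^esub> r, m + n) \<in> ?E" if "(q, m) \<in> ?E" "(r, n) \<in> ?E" for q m r n
      using that subquotD(3)[OF E] by simp
    fix q m assume q: "(q, m) \<in> ?E"
    then obtain r where r: "(r, - m) \<in> E" "r \<otimes>\<^bsub>K\<^esub> h q = \<one>\<^bsub>K\<^esub>" using subquotD(4)[OF E] by blast
    then have "r = inv\<^bsub>K\<^esub> h q" using h.H.inv_equality subquotD(1)[OF E] q h.hom_closed by fastforce
    then have "(inv\<^bsub>H\<^esub> q, - m) \<in> ?E" using r q by simp
    then show "\<exists>r. (r, - m) \<in> ?E \<and> q \<otimes>\<^bsub>H\<^esub> r = \<one>\<^bsub>H\<^esub> \<and> r \<otimes>\<^bsub>H\<^esub> q = \<one>\<^bsub>H\<^esub>"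
      using q by (intro exI[of _ "inv\<^bsub>H\<^esub> q"]) simp
  qed
  have "fibre H ?E = fibre K E" by simp
  then have "tame (snd ` ?E)"
    using t[unfolded tame_quotient_def, rule_format, OF E'] tE by simp
  moreover have "snd ` ?E = snd ` E"
  proof
    show "snd ` E \<subseteq> snd ` ?E"
    proof
      fix m assume "m \<in> snd ` E"
      then obtain k where k: "(k, m) \<in> E" by force
      then have "k \<in> h ` carrier H" using h(2) subquotD(1)[OF E] by simp
      then obtain q where "q \<in> carrier H" "h q = k" by blast
      then have "(q, m) \<in> ?E" using k by simp
      then show "m \<in> snd ` ?E" by force
    qed
  qed force
  ultimately show "tame (snd ` E)" by (simp only:)
qed

text \<open>Two extensions in succession: the part of \<open>E\<close> over \<open>N\<close> leads
  from the fibre to the projection of that part, and this projection is the fibre over the identity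
  of the relation that \<open>E\<close> induces on \<open>K\<close>.\<close>

lemma tame_quotient_ext:
  fixes H :: "('u, 'b) monoid_scheme" and K :: "('v, 'c) monoid_scheme"
  assumes H: "group H" and N: "N \<lhd> H" and tN: "tame_quotient TYPE('g::group_add) (H\<lparr>carrier := N\<rparr>)"
    and K: "group K" "tame_quotient TYPE('g) K" and iso: "K \<cong> H Mod N"
  shows "tame_quotient TYPE('g) H"
  unfolding tame_quotient_def
proof (intro allI impI)
  fix E :: "('u \<times> 'g) set"
  assume E: "subquot H E" and tE: "tame (fibre H E)"
  interpret N: normal N H by (rule N)
  interpret K: group K by (rule K(1))
  interpret Q: group "H Mod N" by (rule N.factorgroup_is_group)
  obtain \<phi> where \<phi>: "\<phi> \<in> hom K (H Mod N)" "bij_betw \<phi> (carrier K) (carrier (H Mod N))"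
    using iso by (auto simp: is_iso_def iso_def)
  interpret f: group_hom K "H Mod N" \<phi> using \<phi>(1) by unfold_locales
  have lift: "\<exists>k\<in>carrier K. \<phi> k = N #>\<^bsub>H\<^esub> q" if "q \<in> carrier H" for q
  proof -
    have "N #>\<^bsub>H\<^esub> q \<in> \<phi> ` carrier K"
      using \<phi>(2) that by (auto simp: bij_betw_def FactGroup_def RCOSETS_def)
    then show ?thesis by auto
  qed
  have cosN: "N #>\<^bsub>H\<^esub> q = N \<longleftrightarrow> q \<in> N" if "q \<in> carrier H" for q
    using N.rcos_const[OF H] N.coset_join1[OF _ that N.subgroup_axioms] by blast
  have one: "q = \<one>\<^bsub>K\<^esub>" if "q \<in> carrier K" "\<phi> q = N" for q
  proof -
    have "\<phi> q = \<phi> \<one>\<^bsub>K\<^esub>" using that f.hom_one by simp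
    then show ?thesis using \<phi>(2) that by (auto simp: bij_betw_def inj_on_def)
  qed
  let ?E1 = "E \<inter> N \<times> UNIV"
  have E1: "subquot (H\<lparr>carrier := N\<rparr>) ?E1"
    unfolding subquot_def
  proof (intro conjI allI impI)
    show "(\<one>\<^bsub>H\<lparr>carrier := N\<rparr>\<^esub>, 0) \<in> ?E1" using subquotD(2)[OF E] N.one_closed by simp
    show "(q \<otimes>\<^bsub>H\<lparr>carrier := N\<rparr>\<^esub> r, m + n) \<in> ?E1" if "(q, m) \<in> ?E1" "(r, n) \<in> ?E1" for q m r n
      using that subquotD(3)[OF E] N.m_closed by simp
    fix q m assume q: "(q, m) \<in> ?E1"
    then obtain r where r: "(r, - m) \<in> E" "q \<otimes>\<^bsub>H\<^esub> r = \<one>\<^bsub>H\<^esub>" "r \<otimes>\<^bsub>H\<^esub> q = \<one>\<^bsub>H\<^esub>"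
      using subquotD(4)[OF E] by blast
    moreover from this have "q \<in> carrier H" "r \<in> carrier H" using subquotD(1)[OF E] q by blast+
    ultimately have "r = inv\<^bsub>H\<^esub> q" using group.inv_equality[OF H r(3)] by simp
    then have "r \<in> N" using q N.m_inv_closed by simp
    then show "\<exists>r. (r, - m) \<in> ?E1 \<and> q \<otimes>\<^bsub>H\<lparr>carrier := N\<rparr>\<^esub> r = \<one>\<^bsub>H\<lparr>carrier := N\<rparr>\<^esub> \<and>
      r \<otimes>\<^bsub>H\<lparr>carrier := N\<rparr>\<^esub> q = \<one>\<^bsub>H\<lparr>carrier := N\<rparr>\<^esub>" using r by (intro exI[of _ r]) simp
  qed auto
  have "fibre (H\<lparr>carrier := N\<rparr>) ?E1 = fibre H E" using N.one_closed by simp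
  then have t1: "tame (snd ` ?E1)" using tN E1 tE unfolding tame_quotient_def by metis
  let ?E2 = "{(k, m). k \<in> carrier K \<and> (\<exists>q. (q, m) \<in> E \<and> \<phi> k = N #>\<^bsub>H\<^esub> q)}"
  have E2: "subquot K ?E2"
    unfolding subquot_def
  proof (intro conjI allI impI)
    show "?E2 \<subseteq> carrier K \<times> UNIV" by auto
    show "(\<one>\<^bsub>K\<^esub>, 0) \<in> ?E2" using subquotD(2)[OF E] f.hom_one cosN N.one_closed by force
    show "(k \<otimes>\<^bsub>K\<^esub> l, m + n) \<in> ?E2" if kl: "(k, m) \<in> ?E2" "(l, n) \<in> ?E2" for k m l n
    proof -
      obtain q r where qr: "(q, m) \<in> E" "(r, n) \<in> E" "\<phi> k = N #>\<^bsub>H\<^esub> q" "\<phi> l = N #>\<^bsub>H\<^esub> r"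
        "k \<in> carrier K" "l \<in> carrier K" using kl by auto
      then have "\<phi> (k \<otimes>\<^bsub>K\<^esub> l) = N #>\<^bsub>H\<^esub> (q \<otimes>\<^bsub>H\<^esub> r)"
        using f.hom_mult N.rcos_sum subquotD(1)[OF E] by (simp add: FactGroup_def)
      moreover have "(q \<otimes>\<^bsub>H\<^esub> r, m + n) \<in> E" using qr subquotD(3)[OF E] by blast
      ultimately show ?thesis using qr K.m_closed by blast
    qed
    fix k m assume "(k, m) \<in> ?E2"
    then obtain q where q: "(q, m) \<in> E" "\<phi> k = N #>\<^bsub>H\<^esub> q" "k \<in> carrier K" by auto
    then obtain r where r: "(r, - m) \<in> E" "q \<otimes>\<^bsub>H\<^esub> r = \<one>\<^bsub>H\<^esub>" "r \<otimes>\<^bsub>H\<^esub> q = \<one>\<^bsub>H\<^esub>"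
      using subquotD(4)[OF E] by blast
    obtain l where l: "l \<in> carrier K" "\<phi> l = N #>\<^bsub>H\<^esub> r" using lift subquotD(1)[OF E r(1)] by blast
    have "\<phi> (k \<otimes>\<^bsub>K\<^esub> l) = N" "\<phi> (l \<otimes>\<^bsub>K\<^esub> k) = N"
      using f.hom_mult q r l N.rcos_sum subquotD(1)[OF E] cosN[of "\<one>\<^bsub>H\<^esub>"] N.one_closed
      by (simp_all add: FactGroup_def)
    then have "k \<otimes>\<^bsub>K\<^esub> l = \<one>\<^bsub>K\<^esub>" "l \<otimes>\<^bsub>K\<^esub> k = \<one>\<^bsub>K\<^esub>" using one q l by auto
    then show "\<exists>l. (l, - m) \<in> ?E2 \<and> k \<otimes>\<^bsub>K\<^esub> l = \<one>\<^bsub>K\<^esub> \<and> l \<otimes>\<^bsub>K\<^esub> k = \<one>\<^bsub>K\<^esub>"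
      using r l by (intro exI[of _ l]) blast
  qed
  have fib: "fibre K ?E2 = snd ` ?E1"
  proof (intro Set.set_eqI iffI)
    fix m assume "m \<in> fibre K ?E2"
    then obtain q where q: "(q, m) \<in> E" "N = N #>\<^bsub>H\<^esub> q" using f.hom_one by auto
    then have "q \<in> N" using cosN[OF subquotD(1)[OF E q(1)]] by metis
    then have "(q, m) \<in> ?E1" using q by auto
    then show "m \<in> snd ` ?E1" by force
  next
    fix m assume "m \<in> snd ` ?E1"
    then obtain q where q: "(q, m) \<in> E" "q \<in> N" by auto
    then have "\<phi> \<one>\<^bsub>K\<^esub> = N #>\<^bsub>H\<^esub> q"
      using cosN[OF subquotD(1)[OF E q(1)]] f.hom_one by simp
    then show "m \<in> fibre K ?E2" using q(1) K.one_closed by blast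
  qed
  have "tame (snd ` ?E2)"
    using K(2)[unfolded tame_quotient_def, rule_format, OF E2] t1 unfolding fib by blast
  moreover have "snd ` ?E2 = snd ` E"
  proof
    show "snd ` E \<subseteq> snd ` ?E2"
    proof
      fix m assume "m \<in> snd ` E"
      then obtain q where q: "(q, m) \<in> E" by force
      then obtain k where "k \<in> carrier K" "\<phi> k = N #>\<^bsub>H\<^esub> q" using lift subquotD(1)[OF E] by blast
      then have "(k, m) \<in> ?E2" using q by auto
      then show "m \<in> snd ` ?E2" by force
    qed
  qed force
  ultimately show "tame (snd ` E)" by (simp only:)
qed

text \<open>The parts of \<open>E\<close> over the members of the family share the fibre over the
  identity and exhaust \<open>E\<close>.\<close>

lemma tame_quotient_union:
  fixes H :: "('u, 'b) monoid_scheme"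
  assumes H: "group H" and ne: "\<S> \<noteq> {}"
    and S: "\<And>S. S \<in> \<S> \<Longrightarrow> subgroup S H \<and> tame_quotient TYPE('g::group_add) (H\<lparr>carrier := S\<rparr>)"
    and dir: "\<forall>S\<in>\<S>. \<forall>T\<in>\<S>. \<exists>U\<in>\<S>. S \<union> T \<subseteq> U" and U: "\<Union>\<S> = carrier H"
  shows "tame_quotient TYPE('g) H"
  unfolding tame_quotient_def
proof (intro allI impI)
  fix E :: "('u \<times> 'g) set"
  assume E: "subquot H E" and tE: "tame (fibre H E)"
  let ?E = "\<lambda>S. E \<inter> S \<times> UNIV"
  have "tame (snd ` ?E S)" if S': "S \<in> \<S>" for S
  proof -
    interpret S: subgroup S H by (rule S[OF S', THEN conjunct1])
    have "subquot (H\<lparr>carrier := S\<rparr>) (?E S)"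
      unfolding subquot_def
    proof (intro conjI allI impI)
      show "(\<one>\<^bsub>H\<lparr>carrier := S\<rparr>\<^esub>, 0) \<in> ?E S" using subquotD(2)[OF E] by simp
      show "(q \<otimes>\<^bsub>H\<lparr>carrier := S\<rparr>\<^esub> r, m + n) \<in> ?E S" if "(q, m) \<in> ?E S" "(r, n) \<in> ?E S" for q m r n
        using that subquotD(3)[OF E] by simp
      fix q m assume q: "(q, m) \<in> ?E S"
      then obtain r where r: "(r, - m) \<in> E" "q \<otimes>\<^bsub>H\<^esub> r = \<one>\<^bsub>H\<^esub>" "r \<otimes>\<^bsub>H\<^esub> q = \<one>\<^bsub>H\<^esub>"
        using subquotD(4)[OF E] by blast
      moreover from this have "q \<in> carrier H" "r \<in> carrier H" using subquotD(1)[OF E] q by blast+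
      ultimately have "r = inv\<^bsub>H\<^esub> q" using group.inv_equality[OF H r(3)] by simp
      then have "r \<in> S" using q by simp
      then show "\<exists>r. (r, - m) \<in> ?E S \<and> q \<otimes>\<^bsub>H\<lparr>carrier := S\<rparr>\<^esub> r = \<one>\<^bsub>H\<lparr>carrier := S\<rparr>\<^esub> \<and>
        r \<otimes>\<^bsub>H\<lparr>carrier := S\<rparr>\<^esub> q = \<one>\<^bsub>H\<lparr>carrier := S\<rparr>\<^esub>" using r by (intro exI[of _ r]) simp
    qed auto
    moreover have "fibre (H\<lparr>carrier := S\<rparr>) (?E S) = fibre H E" by simp
    ultimately show ?thesis using S[OF S'] tE unfolding tame_quotient_def by metis
  qed
  then have "tame (\<Union>((\<lambda>S. snd ` ?E S) ` \<S>))"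
  proof (intro tame_directed_Union)
    fix A B assume "A \<in> (\<lambda>S. snd ` ?E S) ` \<S>" "B \<in> (\<lambda>S. snd ` ?E S) ` \<S>"
    then obtain S T where "S \<in> \<S>" "A = snd ` ?E S" "T \<in> \<S>" "B = snd ` ?E T" by auto
    moreover from this obtain V where "V \<in> \<S>" "S \<union> T \<subseteq> V" using dir by meson
    ultimately show "\<exists>V\<in>(\<lambda>S. snd ` ?E S) ` \<S>. A \<union> B \<subseteq> V" by (intro bexI[of _ "snd ` ?E V"]) auto
  qed (use ne in auto)
  moreover have "\<Union>((\<lambda>S. snd ` ?E S) ` \<S>) = snd ` E"
  proof
    show "snd ` E \<subseteq> \<Union>((\<lambda>S. snd ` ?E S) ` \<S>)"
    proof
      fix m assume "m \<in> snd ` E"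
      then obtain q where q: "(q, m) \<in> E" by force
      then have "q \<in> \<Union>\<S>" unfolding U by (rule subquotD(1)[OF E])
      then obtain S where "S \<in> \<S>" "q \<in> S" by blast
      then show "m \<in> \<Union>((\<lambda>S. snd ` ?E S) ` \<S>)" using q by force
    qed
  qed auto
  ultimately show "tame (snd ` E)" by simp
qed

subsection \<open>Piecewise linear homeomorphisms\<close>

lemma pl_less: "pl_homeo f \<Longrightarrow> 0 \<le> x \<Longrightarrow> x < y \<Longrightarrow> y \<le> 1 \<Longrightarrow> f x < f y"
  by (auto simp: pl_homeo_def strict_mono_on_def)

lemma pl_le: "pl_homeo f \<Longrightarrow> 0 \<le> x \<Longrightarrow> x \<le> y \<Longrightarrow> y \<le> 1 \<Longrightarrow> f x \<le> f y"
  using pl_less[of f x y] by (cases "x = y") auto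

lemma pl_0: "pl_homeo f \<Longrightarrow> f 0 = 0" and pl_1: "pl_homeo f \<Longrightarrow> f 1 = 1"
  and pl_outside: "pl_homeo f \<Longrightarrow> x \<notin> {0..1} \<Longrightarrow> f x = x"
  and pl_continuous: "pl_homeo f \<Longrightarrow> continuous_on {0..1} f"
  by (auto simp: pl_homeo_def)

lemma pl_range: "pl_homeo f \<Longrightarrow> x \<in> {0..1} \<Longrightarrow> f x \<in> {0..1}"
  using pl_le[of f 0 x] pl_le[of f x 1] by (auto simp: pl_0 pl_1)

lemma pl_affine_near:
  assumes f: "pl_homeo f" and t: "t \<in> {0..1}" "f t = t"
  shows "t < 1 \<Longrightarrow> \<exists>b m. t < b \<and> b \<le> 1 \<and> (\<forall>x\<in>{t..b}. f x = t + m * (x - t))"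
    and "0 < t \<Longrightarrow> \<exists>a m. a < t \<and> 0 \<le> a \<and> (\<forall>x\<in>{a..t}. f x = t + m * (x - t))"
proof -
  obtain T where T: "finite T" "T \<subseteq> {0..1}" "0 \<in> T" "1 \<in> T"
    and aff: "\<And>a b. a \<in> T \<Longrightarrow> b \<in> T \<Longrightarrow> a < b \<Longrightarrow> {a<..<b} \<inter> T = {} \<Longrightarrow>
      \<exists>m c. \<forall>x\<in>{a..b}. f x = m * x + c"
    using f unfolding pl_homeo_def by metis
  have key: "\<exists>m. \<forall>x\<in>{a..b}. f x = t + m * (x - t)"
    if ab: "a \<in> T" "b \<in> T" "a < b" "{a<..<b} \<inter> T = {}" "t \<in> {a..b}" for a b
  proof -
    obtain m c where mc: "\<forall>x\<in>{a..b}. f x = m * x + c" using aff[OF ab(1-4)] by blast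
    then have "t = m * t + c" using t ab by auto
    then have "\<forall>x\<in>{a..b}. f x = t + m * (x - t)" using mc by (auto simp: algebra_simps)
    then show ?thesis by blast
  qed
  show "\<exists>b m. t < b \<and> b \<le> 1 \<and> (\<forall>x\<in>{t..b}. f x = t + m * (x - t))" if "t < 1"
  proof -
    define a where "a = Max {x \<in> T. x \<le> t}"
    define b where "b = Min {x \<in> T. t < x}"
    have fin: "finite {x \<in> T. x \<le> t}" "finite {x \<in> T. t < x}" using T(1) by auto
    have a: "a \<in> {x \<in> T. x \<le> t}" unfolding a_def using fin T t by (intro Max_in) auto
    have b: "b \<in> {x \<in> T. t < x}" unfolding b_def using fin T that by (intro Min_in) auto
    have "x \<le> a \<or> b \<le> x" if "x \<in> T" for x
      using that fin unfolding a_def b_def by (cases "x \<le> t") auto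
    then have "{a<..<b} \<inter> T = {}" by fastforce
    then obtain m where "\<forall>x\<in>{a..b}. f x = t + m * (x - t)" using key[of a b] a b by auto
    moreover have "b \<le> 1" "a \<le> t" "t < b" using a b T(2) by auto
    ultimately show ?thesis by (intro exI[of _ b] exI[of _ m]) auto
  qed
  show "\<exists>a m. a < t \<and> 0 \<le> a \<and> (\<forall>x\<in>{a..t}. f x = t + m * (x - t))" if "0 < t"
  proof -
    define a where "a = Max {x \<in> T. x < t}"
    define b where "b = Min {x \<in> T. t \<le> x}"
    have fin: "finite {x \<in> T. x < t}" "finite {x \<in> T. t \<le> x}" using T(1) by auto
    have a: "a \<in> {x \<in> T. x < t}" unfolding a_def using fin T that by (intro Max_in) auto
    have b: "b \<in> {x \<in> T. t \<le> x}" unfolding b_def using fin T t by (intro Min_in) auto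
    have "x \<le> a \<or> b \<le> x" if "x \<in> T" for x
      using that fin unfolding a_def b_def by (cases "x < t") auto
    then have "{a<..<b} \<inter> T = {}" by fastforce
    then obtain m where "\<forall>x\<in>{a..b}. f x = t + m * (x - t)" using key[of a b] a b by auto
    moreover have "0 \<le> a" "a < t" "t \<le> b" using a b T(2) by auto
    ultimately show ?thesis by (intro exI[of _ a] exI[of _ m]) auto
  qed
qed

text \<open>The sign \<open>s\<close> selects the right or the left germ at the fixed point \<open>t\<close>.\<close>
lemma pl_germ:
  assumes f: "pl_homeo f" and t: "t \<in> {0..1}" "f t = t" and s: "s = 1 \<and> t < 1 \<or> s = - 1 \<and> 0 < t"
  shows "\<exists>e>0. \<exists>m>0. \<forall>u\<in>{0..e}. t + s * u \<in> {0..1} \<and> f (t + s * u) = t + s * (m * u)"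
  using s
proof
  assume s: "s = 1 \<and> t < 1"
  then obtain b m where b: "t < b" "b \<le> 1" "\<forall>x\<in>{t..b}. f x = t + m * (x - t)"
    using pl_affine_near(1)[OF f t] by blast
  have "0 < m * (b - t)" using pl_less[OF f, of t b] b t by auto
  then have "m > 0" using b by (simp add: zero_less_mult_iff)
  then show ?thesis using b s t by (intro exI[of _ "b - t"] conjI exI[of _ m]) auto
next
  assume s: "s = - 1 \<and> 0 < t"
  then obtain a m where a: "a < t" "0 \<le> a" "\<forall>x\<in>{a..t}. f x = t + m * (x - t)"
    using pl_affine_near(2)[OF f t] by blast
  have "m * (a - t) < 0" using pl_less[OF f, of a t] a t by auto
  then have "m > 0" using a by (simp add: mult_less_0_iff)
  then show ?thesis using a s t by (intro exI[of _ "t - a"] conjI exI[of _ m]) auto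
qed

text \<open>One-sided germs at a common fixed point are multiplications by a slope, so they
  commute.\<close>

lemma pl_commutator_germ:
  assumes f: "pl_homeo f" "f t = t" "\<And>x. f' (f x) = x" and g: "pl_homeo g" "g t = t" "\<And>x. g' (g x) = x"
    and t: "t \<in> {0..1}" and s: "s = 1 \<and> t < 1 \<or> s = - 1 \<and> 0 < t"
  shows "\<exists>e>0. \<forall>v\<in>{0..e}. f (g (f' (g' (t + s * v)))) = t + s * v"
proof -
  obtain d m where d: "d > 0" "m > 0" "\<And>u. u \<in> {0..d} \<Longrightarrow> f (t + s * u) = t + s * (m * u)"
    using pl_germ[OF f(1) t f(2) s] by blast
  obtain e n where e: "e > 0" "n > 0" "\<And>u. u \<in> {0..e} \<Longrightarrow> g (t + s * u) = t + s * (n * u)"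
    using pl_germ[OF g(1) t g(2) s] by blast
  \<comment> \<open>This radius keeps \<open>u\<close>, \<open>m * u\<close> and
    \<open>n * u\<close> within the range where both germs are valid; applying both maps leads to
    distance \<open>m * n * u\<close> from \<open>t\<close>.\<close>
  define r where "r = min d e / (1 + m + n)"
  have r: "r > 0" using d e by (simp add: r_def)
  have small: "u \<le> d" "u \<le> e" "m * u \<le> e" "n * u \<le> d" if "u \<in> {0..r}" for u
  proof -
    have "(1 + m + n) * u \<le> min d e" using that d e by (simp add: r_def field_simps)
    moreover have "0 \<le> u" "0 \<le> m * u" "0 \<le> n * u" using that d e by auto
    ultimately show "u \<le> d" "u \<le> e" "m * u \<le> e" "n * u \<le> d" by (auto simp: algebra_simps)
  qed
  have "f (g (f' (g' (t + s * v)))) = t + s * v" if v: "v \<in> {0..m * n * r}" for v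
  proof -
    define u where "u = v / (m * n)"
    have u: "u \<in> {0..r}" using v d e by (simp add: u_def field_simps)
    have v': "m * (n * u) = v" "n * (m * u) = v" using d e by (simp_all add: u_def)
    have b: "m * u \<in> {0..e}" "n * u \<in> {0..d}" "u \<in> {0..d}" "u \<in> {0..e}"
      using small[OF u] u d e by auto
    have "g (f (t + s * u)) = t + s * v" "f (g (t + s * u)) = t + s * v"
      using d(3) e(3) b v' by auto
    then show ?thesis using f(3) g(3) by metis
  qed
  then show ?thesis using d e r by (intro exI[of _ "m * n * r"]) auto
qed

section \<open>Common fixed points and pointwise stabilizers\<close>

definition fixing :: "((real \<Rightarrow> real) \<times> 'g::group_add) set \<Rightarrow> real set \<Rightarrow> 'g set" where
  "fixing E A = {m. \<exists>f. (f, m) \<in> E \<and> (\<forall>x\<in>A. f x = x)}"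

definition fixset :: "((real \<Rightarrow> real) \<times> 'g::group_add) set \<Rightarrow> real set" where
  "fixset E = {t \<in> {0..1}. \<forall>f m. (f, m) \<in> E \<longrightarrow> f t = t}"

lemma subquot_PL:
  assumes E: "subquot PL_group E"
  shows "(f, m) \<in> E \<Longrightarrow> pl_homeo f" "(id, 0) \<in> E"
    "(f, m) \<in> E \<Longrightarrow> (g, n) \<in> E \<Longrightarrow> (f \<circ> g, m + n) \<in> E"
    "(f, m) \<in> E \<Longrightarrow> \<exists>f'. (f', - m) \<in> E \<and> (\<forall>x. f (f' x) = x) \<and> (\<forall>x. f' (f x) = x)"
  using subquotD(1)[OF E, of f m] subquotD(2)[OF E] subquotD(3)[OF E, of f m g n] subquotD(4)[OF E, of f m]
  by (auto simp: PL_group_def fun_eq_iff)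

lemma sgp_fixing:
  assumes E: "subquot PL_group E"
  shows "sgp (fixing E A)"
  unfolding sgp_def
proof (intro conjI ballI)
  show "0 \<in> fixing E A" using subquot_PL(2)[OF E] by (auto simp: fixing_def)
  show "x + y \<in> fixing E A" if "x \<in> fixing E A" "y \<in> fixing E A" for x y
    using that subquot_PL(3)[OF E] by (fastforce simp: fixing_def)
  show "- x \<in> fixing E A" if x: "x \<in> fixing E A" for x
  proof -
    obtain f where f: "(f, x) \<in> E" "\<forall>x\<in>A. f x = x" using x by (auto simp: fixing_def)
    then obtain f' where "(f', - x) \<in> E" "\<forall>x. f' (f x) = x" using subquot_PL(4)[OF E] by blast
    moreover from this have "\<forall>x\<in>A. f' x = x" using f(2) by metis
    ultimately show ?thesis by (auto simp: fixing_def)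
  qed
qed

lemma fixing_antimono: "A \<subseteq> B \<Longrightarrow> fixing E B \<subseteq> fixing E A"
  by (auto simp: fixing_def)

lemma fixing_subset: "fixing E A \<subseteq> snd ` E"
  by (force simp: fixing_def)

lemma pl_interval:
  assumes "pl_homeo f" "0 \<le> a" "b \<le> 1" "f a = a" "f b = b" "x \<in> {a..b}"
  shows "f x \<in> {a..b}"
  using pl_le[OF assms(1), of a x] pl_le[OF assms(1), of x b] assms by auto

lemma normal_in_fixing:
  assumes E: "subquot PL_group E" and t: "t \<in> fixset E"
  shows "normal_in (fixing E {0..t}) (snd ` E)"
  unfolding normal_in_def
proof (intro conjI ballI)
  show "sgp (fixing E {0..t})" by (rule sgp_fixing[OF E])
  show "fixing E {0..t} \<subseteq> snd ` E" by (rule fixing_subset)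
  show "m + k + - m \<in> fixing E {0..t}" if m: "m \<in> snd ` E" and k: "k \<in> fixing E {0..t}" for m k
  proof -
    obtain f where f: "(f, m) \<in> E" using m by force
    obtain f' where f': "(f', - m) \<in> E" "\<And>x. f (f' x) = x" using subquot_PL(4)[OF E f] by blast
    obtain g where g: "(g, k) \<in> E" "\<And>x. x \<in> {0..t} \<Longrightarrow> g x = x" using k by (auto simp: fixing_def)
    have "(f \<circ> g \<circ> f', m + k + - m) \<in> E" using subquot_PL(3)[OF E] f g f' by blast
    moreover have "(f \<circ> g \<circ> f') x = x" if "x \<in> {0..t}" for x
    proof -
      have pf: "pl_homeo f'" using subquot_PL(1)[OF E f'(1)] .
      have "f' x \<in> {0..t}"
        using t f'(1) that by (intro pl_interval[OF pf]) (auto simp: fixset_def pl_0[OF pf])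
      then show ?thesis using g(2) f'(2) by simp
    qed
    ultimately show ?thesis by (auto simp: fixing_def)
  qed
qed

text \<open>The set \<open>B\<close> is chosen after the maps, because the neighbourhood on which
  two germs commute depends on them. On \<open>A\<close> both maps are the identity, so only points
  outside \<open>A\<close> need a computation.\<close>

lemma commutator_in_fixing:
  assumes E: "subquot PL_group E" and xy: "x \<in> fixing E A" "y \<in> fixing E A"
    and fin: "\<And>f g f' g'. (f, x) \<in> E \<Longrightarrow> (g, y) \<in> E \<Longrightarrow> (\<And>x. f' (f x) = x) \<Longrightarrow> (\<And>x. g' (g x) = x) \<Longrightarrow>
      (\<And>x. x \<in> A \<Longrightarrow> f x = x) \<Longrightarrow> (\<And>x. x \<in> A \<Longrightarrow> g x = x) \<Longrightarrow>
      \<exists>B\<in>\<B>. \<forall>x\<in>B. x \<in> A \<or> f (g (f' (g' x))) = x"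
  shows "\<exists>B\<in>\<B>. x + y + - x + - y \<in> fixing E B"
proof -
  obtain f where f: "(f, x) \<in> E" "\<And>x. x \<in> A \<Longrightarrow> f x = x" using xy by (auto simp: fixing_def)
  obtain g where g: "(g, y) \<in> E" "\<And>x. x \<in> A \<Longrightarrow> g x = x" using xy by (auto simp: fixing_def)
  obtain f' where f': "(f', - x) \<in> E" "\<And>x. f' (f x) = x" using subquot_PL(4)[OF E f(1)] by blast
  obtain g' where g': "(g', - y) \<in> E" "\<And>x. g' (g x) = x" using subquot_PL(4)[OF E g(1)] by blast
  obtain B where B: "B \<in> \<B>" "\<forall>x\<in>B. x \<in> A \<or> f (g (f' (g' x))) = x"
    using fin[OF f(1) g(1) f'(2) g'(2) f(2) g(2)] by blast
  have "(f \<circ> g \<circ> f' \<circ> g', x + y + - x + - y) \<in> E"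
    by (intro subquot_PL(3)[OF E] f(1) g(1) f'(1) g'(1))
  moreover have "(f \<circ> g \<circ> f' \<circ> g') x = x" if "x \<in> B" for x
  proof (cases "x \<in> A")
    case True
    have "f' x = x" using f'(2)[of x] f(2)[OF True] by simp
    moreover have "g' x = x" using g'(2)[of x] g(2)[OF True] by simp
    ultimately show ?thesis using f(2)[OF True] g(2)[OF True] by simp
  next
    case False
    then show ?thesis using B(2) that by auto
  qed
  ultimately show ?thesis using B(1) unfolding fixing_def by blast
qed

text \<open>The supremum of the orbit of \<open>a\<close> is a common fixed point; if
  \<open>b\<close> bounded the orbit, this point would lie strictly between \<open>c\<close> and
  \<open>t\<close>.\<close>

lemma exists_displacing:
  assumes E: "subquot PL_group E" and c: "0 \<le> c" "c < a" "a < t" "b < t" "t \<in> fixset E"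
    and nofix: "\<And>x. x \<in> {c<..<t} \<Longrightarrow> x \<notin> fixset E"
  shows "\<exists>h m. (h, m) \<in> E \<and> b \<le> h a"
proof (rule ccontr)
  assume no: "\<not> ?thesis"
  define Y where "Y = (\<lambda>p. fst p a) ` E"
  define \<sigma> where "\<sigma> = Sup Y"
  have t1: "t \<le> 1" using c by (auto simp: fixset_def)
  have ub: "y \<le> b" if "y \<in> Y" for y using no that by (force simp: Y_def)
  have aO: "a \<in> Y" using subquot_PL(2)[OF E] unfolding Y_def by (intro image_eqI[of _ _ "(id, 0)"]) auto
  have bdd: "bdd_above Y" by (rule bdd_aboveI[of _ b]) (rule ub)
  have \<sigma>: "a \<le> \<sigma>" "\<sigma> \<le> b" unfolding \<sigma>_def using aO ub bdd by (auto intro: cSup_upper cSup_least)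
  have range: "\<sigma> \<in> {0..1}" using \<sigma> c t1 by auto
  \<comment> \<open>If \<open>k\<close> raised \<open>\<sigma>\<close>, its inverse would lower
    \<open>\<sigma>\<close> below some orbit point \<open>y\<close>, and \<open>k y\<close> would be
    an orbit point above \<open>\<sigma>\<close>.\<close>
  have up: "k \<sigma> \<le> \<sigma>" if k: "(k, n) \<in> E" for k n
  proof (rule ccontr)
    assume gt: "\<not> k \<sigma> \<le> \<sigma>"
    obtain k' where k': "(k', - n) \<in> E" "\<And>x. k (k' x) = x" "\<And>x. k' (k x) = x"
      using subquot_PL(4)[OF E k] by blast
    have pk: "pl_homeo k" "pl_homeo k'" using subquot_PL(1)[OF E] k k' by blast+
    have "k' \<sigma> < k' (k \<sigma>)"
      using gt range pl_range[OF pk(1) range] by (intro pl_less[OF pk(2)]) auto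
    then have "k' \<sigma> < \<sigma>" using k' by simp
    then obtain y where y: "y \<in> Y" "k' \<sigma> < y" unfolding \<sigma>_def using less_cSup_iff[OF _ bdd] aO by blast
    then obtain h m where h: "(h, m) \<in> E" "y = h a" by (auto simp: Y_def)
    have "y \<in> {0..1}" using h pl_range[OF subquot_PL(1)[OF E h(1)]] c t1 by auto
    moreover have "k' \<sigma> \<in> {0..1}" using pl_range[OF pk(2) range] .
    ultimately have "k (k' \<sigma>) < k y" using y by (intro pl_less[OF pk(1)]) auto
    moreover have "(k \<circ> h, n + m) \<in> E" using subquot_PL(3)[OF E k h(1)] .
    then have "k y \<in> Y" unfolding Y_def h(2) by (intro image_eqI[of _ _ "(k \<circ> h, n + m)"]) auto
    then have "k y \<le> \<sigma>" unfolding \<sigma>_def by (intro cSup_upper bdd)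
    ultimately show False using k' by simp
  qed
  have "\<sigma> \<in> fixset E"
    unfolding fixset_def
  proof (intro CollectI conjI range allI impI)
    fix f m assume f: "(f, m) \<in> E"
    obtain f' where f': "(f', - m) \<in> E" "\<And>x. f (f' x) = x" using subquot_PL(4)[OF E f] by blast
    have "f (f' \<sigma>) \<le> f \<sigma>"
      using up[OF f'(1)] range pl_range[OF subquot_PL(1)[OF E f'(1)] range]
      by (intro pl_le[OF subquot_PL(1)[OF E f]]) auto
    then show "f \<sigma> = \<sigma>" using up[OF f] f'(2) by simp
  qed
  then show False using nofix[of \<sigma>] \<sigma> c by auto
qed

text \<open>Within \<open>[0,t]\<close> the map of \<open>x\<close> moves only points between
  \<open>a\<close> and \<open>b\<close>, while the conjugate map moves only points beyond
  \<open>h a\<close>, hence beyond \<open>b\<close>. Maps with disjoint supports commute; beyond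
  \<open>t\<close> nothing is claimed.\<close>

lemma fixing_displaced:
  assumes E: "subquot PL_group E" and t: "t \<in> fixset E" and ab: "0 \<le> a" "a < t" "0 \<le> b" "b < t"
    and h: "(h, s) \<in> E" "b \<le> h a"
    and xy: "x \<in> fixing E ({0..a} \<union> {b..t})" "y \<in> fixing E ({0..a} \<union> {b..t})"
  shows "x + (s + y + - s) + - x + - (s + y + - s) \<in> fixing E {0..t}"
proof -
  have t1: "t \<le> 1" using t by (auto simp: fixset_def)
  obtain f where f: "(f, x) \<in> E" "\<And>z. z \<in> {0..a} \<union> {b..t} \<Longrightarrow> f z = z" using xy by (auto simp: fixing_def)
  obtain g where g: "(g, y) \<in> E" "\<And>z. z \<in> {0..a} \<union> {b..t} \<Longrightarrow> g z = z" using xy by (auto simp: fixing_def)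
  obtain f' where f': "(f', - x) \<in> E" "\<And>z. f (f' z) = z" "\<And>z. f' (f z) = z"
    using subquot_PL(4)[OF E f(1)] by blast
  obtain h' where h': "(h', - s) \<in> E" "\<And>z. h (h' z) = z" "\<And>z. h' (h z) = z"
    using subquot_PL(4)[OF E h(1)] by blast
  define k where "k = h \<circ> g \<circ> h'"
  have k: "(k, s + y + - s) \<in> E" unfolding k_def using subquot_PL(3)[OF E] h g h' by blast
  obtain k' where k': "(k', - (s + y + - s)) \<in> E" "\<And>z. k (k' z) = z" "\<And>z. k' (k z) = z"
    using subquot_PL(4)[OF E k] by blast
  note pl = subquot_PL(1)[OF E]
  have fixt: "j t = t" if "(j, n) \<in> E" for j n using t that by (auto simp: fixset_def)
  have kb: "k z = z" if z: "z \<in> {0..b}" for z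
  proof -
    have z1: "z \<in> {0..1}" using z ab t1 by auto
    have "h' z \<le> h' (h a)"
      using z h z1 pl_range[OF pl[OF h(1)], of a] ab t1 by (intro pl_le[OF pl[OF h'(1)]]) auto
    then have "h' z \<in> {0..a}" using pl_range[OF pl[OF h'(1)] z1] h' by auto
    then show ?thesis using g(2) h'(2) by (simp add: k_def)
  qed
  have k'b: "k' z = z" if "z \<in> {0..b}" for z using kb[OF that] k'(3) by metis
  have "f (k (f' (k' z))) = z" if z: "z \<in> {0..t}" for z
  proof (cases "z \<le> b")
    case True
    have "f b = b" using f(2)[of b] ab by auto
    then have "f' b = b" using f'(3) by metis
    then have "f' z \<in> {0..b}"
      using True z t1 ab pl_0[OF pl[OF f'(1)]] by (intro pl_interval[OF pl[OF f'(1)]]) auto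
    then show ?thesis using k'b[of z] kb True z f' by auto
  next
    case False
    have "k' z \<in> {b..t}"
      using k'b[of b] fixt[OF k'(1)] ab False z t1 by (intro pl_interval[OF pl[OF k'(1)]]) auto
    then have "f' (k' z) = k' z" using f(2)[of "k' z"] f'(3) by (metis UnI2)
    then show ?thesis using k'(2) f(2)[of z] z False by auto
  qed
  moreover have "(f \<circ> k \<circ> f' \<circ> k', x + (s + y + - s) + - x + - (s + y + - s)) \<in> E"
    by (intro subquot_PL(3)[OF E] f(1) k f'(1) k'(1))
  ultimately show ?thesis by (force simp: fixing_def)
qed

text \<open>To the left of \<open>t\<close> there is either a nearest common fixed point or an
  interval of common fixed points ending at \<open>t\<close>. Finite generation guarantees this. In
  general, common fixed points might accumulate at \<open>t\<close>, and a descent from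
  \<open>t\<close> would have no next step.\<close>

definition left_discrete :: "((real \<Rightarrow> real) \<times> 'g::group_add) set \<Rightarrow> bool" where
  "left_discrete E \<longleftrightarrow> (\<forall>t\<in>fixset E. 0 < t \<longrightarrow> (\<exists>a\<in>{0..<t}.
     (\<forall>f m. (f, m) \<in> E \<longrightarrow> (\<forall>x\<in>{a..t}. f x = x)) \<or> (\<forall>x\<in>{a<..<t}. x \<notin> fixset E)))"

lemma closed_fixset:
  assumes E: "subquot PL_group E"
  shows "closed (fixset E)"
proof -
  have "closed {t \<in> {0..1}. f t - t = 0}" if "(f, m) \<in> E" for f m
    using pl_continuous[OF subquot_PL(1)[OF E that]]
    by (intro continuous_closed_preimage_constant continuous_intros) auto
  then have "closed ({0..1} \<inter> (\<Inter>(f, m)\<in>E. {t \<in> {0..1}. f t - t = 0}))"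
    by (intro closed_Int closed_INT) auto
  moreover have "{0..1} \<inter> (\<Inter>(f, m)\<in>E. {t \<in> {0..1}. f t - t = 0}) = fixset E"
    by (auto simp: fixset_def)
  ultimately show ?thesis by simp
qed

text \<open>The infimum \<open>t\<close> of the fixed points whose pointwise fixing subgroup admits an Archimedean
  preorder is attained, because germs at \<open>t\<close> form an abelian group. If \<open>t > 0\<close>, let \<open>c\<close> be the
  next fixed point to its left; elements fixing neighbourhoods of \<open>c\<close> and \<open>t\<close> are displaced
  from each other on \<open>(c, t)\<close>, so that \<open>c\<close> has the same property.\<close>
lemma has_arch_left_discrete:
  fixes E :: "((real \<Rightarrow> real) \<times> 'g::group_add) set"
  assumes E: "subquot PL_group E" and ld: "left_discrete E"
    and Z: "good (snd ` E) Z" and fib: "has_arch (fibre PL_group E) Z"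
  shows "has_arch (snd ` E) Z"
proof -
  let ?M = "snd ` E" and ?V = "fixing E"
  have M: "sgp ?M" by (rule sgp_snd_subquot[OF E])
  note pl = subquot_PL(1)[OF E] and sV = sgp_fixing[OF E]
  have F01: "0 \<in> fixset E" "1 \<in> fixset E" using pl pl_0 pl_1 by (auto simp: fixset_def)
  define G where "G = {t \<in> fixset E. has_arch (?V {0..t}) Z}"
  have "f = id" if "(f, m) \<in> E" "\<forall>x\<in>{0..1}. f x = x" for f m
    using that pl_outside[OF pl[OF that(1)]] by (auto simp: fun_eq_iff)
  \<comment> \<open>The descent starts at 1, where the stabilizer is the fibre.\<close>
  then have "?V {0..1} = fibre PL_group E" by (auto simp: fixing_def PL_group_def)
  then have "1 \<in> G" using fib F01 by (simp add: G_def)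
  define t where "t = Inf G"
  have bdd: "bdd_below G" by (auto simp: G_def fixset_def intro!: bdd_belowI[of _ 0])
  have tle: "t \<le> x" if "x \<in> G" for x unfolding t_def using that bdd by (rule cInf_lower)
  have "t \<in> closure G" unfolding t_def using \<open>1 \<in> G\<close> bdd by (intro closure_contains_Inf) auto
  then have tF: "t \<in> fixset E"
    using closure_minimal[OF _ closed_fixset[OF E], of G] by (auto simp: G_def)
  have t01: "t \<in> {0..1}" using tF by (simp add: fixset_def)
  have fixF: "f x = x" if "(f, m) \<in> E" "x \<in> fixset E" for f m x using that by (auto simp: fixset_def)
  have tG: "t \<in> G"
  proof (rule ccontr)
    assume no: "t \<notin> G"
    \<comment> \<open>The union of these stabilizers contains every commutator of the stabilizer of
      \<open>[0,t]\<close>: such a commutator is the identity just to the right of \<open>t\<close>,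
      hence up to some \<open>r\<close> in \<open>G\<close>.\<close>
    let ?S = "(\<lambda>r. ?V {0..r}) ` G"
    have chain: "\<exists>U\<in>?S. S \<union> T \<subseteq> U" if "S \<in> ?S" "T \<in> ?S" for S T
    proof -
      obtain r q where rq: "r \<in> G" "S = ?V {0..r}" "q \<in> G" "T = ?V {0..q}" using \<open>S \<in> ?S\<close> \<open>T \<in> ?S\<close> by auto
      have "S \<union> T \<subseteq> ?V {0..min r q}" unfolding rq by (intro Un_least fixing_antimono) auto
      moreover have "min r q \<in> G" using rq by (simp add: min_def)
      ultimately show ?thesis by blast
    qed
    have ne: "?S \<noteq> {}" using \<open>1 \<in> G\<close> by blast
    have sub: "?V {0..r} \<subseteq> ?V {0..t}" if "r \<in> G" for r
      using tle[OF that] by (intro fixing_antimono) auto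
    have "has_arch (\<Union>?S) Z"
      using sV fixing_subset[of E] by (intro has_arch_Union[OF M Z ne _ chain]) (auto simp: G_def)
    moreover have "sgp (\<Union>?S)" using sV by (intro sgp_directed_Union[OF ne _ chain]) auto
    moreover have "x + y + - x + - y \<in> \<Union>?S" if "x \<in> ?V {0..t}" "y \<in> ?V {0..t}" for x y
    proof -
      have "\<exists>B\<in>(\<lambda>r. {0..r}) ` G. x + y + - x + - y \<in> ?V B"
      proof (rule commutator_in_fixing[OF E that])
        fix f g :: "real \<Rightarrow> real" and f' g'
        assume f: "(f, x) \<in> E" "(g, y) \<in> E" "\<And>x. f' (f x) = x" "\<And>x. g' (g x) = x"
        have "t \<noteq> 1" using no \<open>1 \<in> G\<close> by auto
        then have "t < 1" using t01 by simp
        then obtain e where e: "e > 0" "\<forall>v\<in>{0..e}. f (g (f' (g' (t + 1 * v)))) = t + 1 * v"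
          using pl_commutator_germ[of f t f' g g' 1] pl f fixF[OF _ tF] t01 by blast
        have "\<not> t + e \<le> t" using e by simp
        then obtain r where r: "r \<in> G" "r < t + e"
          unfolding t_def using cInf_less_iff[of G "Inf G + e"] \<open>1 \<in> G\<close> bdd by auto
        have "z \<in> {0..t} \<or> f (g (f' (g' z))) = z" if "z \<in> {0..r}" for z
        proof (cases "z \<le> t")
          case False
          then have "z - t \<in> {0..e}" using that r by auto
          then show ?thesis using e(2) by fastforce
        qed (use that in auto)
        then show "\<exists>B\<in>(\<lambda>r. {0..r}) ` G. \<forall>z\<in>B. z \<in> {0..t} \<or> f (g (f' (g' z))) = z"
          using r(1) by blast
      qed
      then show ?thesis by blast
    qed
    ultimately have "has_arch (?V {0..t}) Z"
      using sub by (intro has_arch_abelian_extension[OF M Z sV fixing_subset, of "\<Union>?S"]) auto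
    then show False using no tF by (simp add: G_def)
  qed
  have "t = 0"
  proof (rule ccontr)
    assume "t \<noteq> 0"
    then have "0 < t" using t01 by simp
    then obtain a where a: "a \<in> {0..<t}" "(\<forall>f m. (f, m) \<in> E \<longrightarrow> (\<forall>x\<in>{a..t}. f x = x)) \<or>
      (\<forall>x\<in>{a<..<t}. x \<notin> fixset E)" using ld tF unfolding left_discrete_def by blast
    from a(2) show False
    proof
      \<comment> \<open>Here \<open>t\<close> can be lowered to \<open>a\<close> without changing
        the stabilizer.\<close>
      assume id: "\<forall>f m. (f, m) \<in> E \<longrightarrow> (\<forall>x\<in>{a..t}. f x = x)"
      have "?V {0..a} \<subseteq> ?V {0..t}"
      proof
        fix m assume "m \<in> ?V {0..a}"
        then obtain f where f: "(f, m) \<in> E" "\<forall>x\<in>{0..a}. f x = x" by (auto simp: fixing_def)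
        have "f x = x" if "x \<in> {0..t}" for x using id f that by (cases "x \<le> a") auto
        then show "m \<in> ?V {0..t}" using f by (auto simp: fixing_def)
      qed
      moreover have "?V {0..t} \<subseteq> ?V {0..a}" using a by (intro fixing_antimono) auto
      ultimately have "?V {0..a} = ?V {0..t}" by blast
      moreover have "a \<in> fixset E" using id a t01 by (auto simp: fixset_def)
      ultimately have "a \<in> G" using tG by (simp add: G_def)
      then show False using tle a by force
    next
      assume nofix: "\<forall>x\<in>{a<..<t}. x \<notin> fixset E"
      \<comment> \<open>The set is closed and contains 0, so \<open>c\<close> is itself a common
        fixed point.\<close>
      define c where "c = Sup (fixset E \<inter> {0..a})"
      have ne: "fixset E \<inter> {0..a} \<noteq> {}" using F01 a by auto
      have bd: "bdd_above (fixset E \<inter> {0..a})" by (auto intro!: bdd_aboveI[of _ a])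
      have "c \<in> fixset E \<inter> {0..a}"
        unfolding c_def using ne bd closed_fixset[OF E] by (intro closed_contains_Sup closed_Int) auto
      then have c: "c \<in> fixset E" "0 \<le> c" "c < t" using a by auto
      have nofix': "x \<notin> fixset E" if "x \<in> {c<..<t}" for x
      proof
        assume x: "x \<in> fixset E"
        have "x \<le> a" using nofix x that by force
        then have "x \<le> c" unfolding c_def using x bd that c by (intro cSup_upper) auto
        then show False using that by simp
      qed
      \<comment> \<open>Within \<open>[0,t]\<close> these elements are supported in a compact part
        of the open interval from \<open>c\<close> to \<open>t\<close>. Some \<open>s\<close>
        displaces this support, so commutators with the conjugate by \<open>s\<close> lie in the
        stabilizer of \<open>[0,t]\<close>.\<close>
      let ?W = "\<lambda>(p, q). ?V ({0..p} \<union> {q..t})"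
      let ?S = "?W ` ({c<..<t} \<times> {c<..<t})"
      obtain z where z: "c < z" "z < t" using c dense by blast
      have ne: "?S \<noteq> {}" using z by auto
      have chain: "\<exists>U\<in>?S. S \<union> T \<subseteq> U" if ST: "S \<in> ?S" "T \<in> ?S" for S T
      proof -
        obtain p q p' q' where pq: "p \<in> {c<..<t}" "q \<in> {c<..<t}" "S = ?V ({0..p} \<union> {q..t})"
          "p' \<in> {c<..<t}" "q' \<in> {c<..<t}" "T = ?V ({0..p'} \<union> {q'..t})" using ST by auto
        have "S \<union> T \<subseteq> ?W (min p p', max q q')"
          unfolding pq prod.case by (intro Un_least fixing_antimono) auto
        moreover have "(min p p', max q q') \<in> {c<..<t} \<times> {c<..<t}" using pq by auto
        ultimately show ?thesis by blast
      qed
      have "has_arch S Z" if S: "S \<in> ?S" for S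
      proof -
        obtain p q where pq: "p \<in> {c<..<t}" "q \<in> {c<..<t}" "S = ?V ({0..p} \<union> {q..t})" using S by auto
        obtain h s where h: "(h, s) \<in> E" "q \<le> h p"
          using exists_displacing[OF E c(2) _ _ _ tF nofix', of p q] pq by auto
        have sM: "s \<in> ?M" using h by force
        show ?thesis
        proof (rule has_arch_displaced[OF M Z normal_in_fixing[OF E tF] _ _ _ sM])
          show "has_arch (?V {0..t}) Z" using tG by (simp add: G_def)
          show "sgp S" "S \<subseteq> ?M" unfolding pq(3) by (rule sV, rule fixing_subset)
          show "x + (s + y + - s) + - x + - (s + y + - s) \<in> ?V {0..t}" if "x \<in> S" "y \<in> S" for x y
            using that pq c by (intro fixing_displaced[OF E tF _ _ _ _ h]) auto
        qed
      qed
      moreover have props: "sgp S \<and> S \<subseteq> ?M" if S: "S \<in> ?S" for S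
      proof -
        obtain p q where "S = ?V ({0..p} \<union> {q..t})" using S by auto
        then show ?thesis by (simp add: sV fixing_subset)
      qed
      ultimately have "has_arch (\<Union>?S) Z" by (intro has_arch_Union[OF M Z ne _ chain]) blast+
      moreover have "sgp (\<Union>?S)" by (intro sgp_directed_Union[OF ne _ chain]) (use props in blast)+
      moreover have "\<Union>?S \<subseteq> ?V {0..c}"
      proof (intro Union_least)
        fix S assume "S \<in> ?S"
        then obtain p q where "p \<in> {c<..<t}" "S = ?V ({0..p} \<union> {q..t})" by auto
        then show "S \<subseteq> ?V {0..c}" using c by (simp only:) (rule fixing_antimono, auto)
      qed
      moreover have "x + y + - x + - y \<in> \<Union>?S" if "x \<in> ?V {0..c}" "y \<in> ?V {0..c}" for x y
      proof -
        \<comment> \<open>A commutator of elements fixing \<open>[0,c]\<close> is the identity near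
          both ends of the interval from \<open>c\<close> to \<open>t\<close>, by the germs at
          \<open>c\<close> and at \<open>t\<close>.\<close>
        let ?B = "(\<lambda>(p, q). {0..p} \<union> {q..t}) ` ({c<..<t} \<times> {c<..<t})"
        have "\<exists>B\<in>?B. x + y + - x + - y \<in> ?V B"
        proof (rule commutator_in_fixing[OF E that])
          fix f g :: "real \<Rightarrow> real" and f' g'
          assume f: "(f, x) \<in> E" "(g, y) \<in> E" "\<And>x. f' (f x) = x" "\<And>x. g' (g x) = x"
          have "c < 1" "c \<in> {0..1}" using c t01 by auto
          then obtain e where e: "e > 0" "\<forall>v\<in>{0..e}. f (g (f' (g' (c + 1 * v)))) = c + 1 * v"
            using pl_commutator_germ[of f c f' g g' 1] pl f fixF[OF _ c(1)] by blast
          obtain d where d: "d > 0" "\<forall>v\<in>{0..d}. f (g (f' (g' (t + - 1 * v)))) = t + - 1 * v"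
            using pl_commutator_germ[of f t f' g g' "- 1"] pl f fixF[OF _ tF] t01 \<open>0 < t\<close> by blast
          define p where "p = min z (c + e)"
          define q where "q = max z (t - d)"
          have pq: "p \<in> {c<..<t}" "q \<in> {c<..<t}" using z e d by (auto simp: p_def q_def)
          have "w \<in> {0..c} \<or> f (g (f' (g' w))) = w" if w: "w \<in> {0..p} \<union> {q..t}" for w
          proof (cases "w \<le> c")
            case True
            then show ?thesis using w c pq by auto
          next
            case False
            from w show ?thesis
            proof
              assume "w \<in> {0..p}"
              then have "w - c \<in> {0..e}" using False by (auto simp: p_def)
              then show ?thesis using e(2) by fastforce
            next
              assume "w \<in> {q..t}"
              then have "t - w \<in> {0..d}" by (auto simp: q_def)
              then show ?thesis using d(2) by fastforce
            qed
          qed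
          then show "\<exists>B\<in>?B. \<forall>w\<in>B. w \<in> {0..c} \<or> f (g (f' (g' w))) = w"
            using pq by (intro bexI[of _ "{0..p} \<union> {q..t}"]) auto
        qed
        then show ?thesis by auto
      qed
      ultimately have "has_arch (?V {0..c}) Z"
        by (intro has_arch_abelian_extension[OF M Z sV fixing_subset, of "\<Union>?S"])
      then have "c \<in> G" using c by (simp add: G_def)
      then show False using tle c by force
    qed
  qed
  moreover have "?V {0..0} = ?M" using pl pl_0 by (force simp: fixing_def)
  ultimately show ?thesis using tG by (simp add: G_def)
qed

section \<open>Finitely generated groups of piecewise linear maps\<close>

inductive_set words :: "('a \<Rightarrow> 'a) set \<Rightarrow> ('a \<Rightarrow> 'a) set" for W where
  words_id: "id \<in> words W"
| words_letter: "f \<in> W \<Longrightarrow> g \<in> words W \<Longrightarrow> f \<circ> g \<in> words W"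

definition inverse_closed :: "('a \<Rightarrow> 'a) set \<Rightarrow> bool" where
  "inverse_closed W \<longleftrightarrow> (\<forall>f\<in>W. \<exists>f'\<in>W. f \<circ> f' = id \<and> f' \<circ> f = id)"

lemma words_comp: "f \<in> words W \<Longrightarrow> g \<in> words W \<Longrightarrow> f \<circ> g \<in> words W"
  by (induction rule: words.induct) (auto simp: comp_assoc intro: words.intros)

lemma words_single: "f \<in> W \<Longrightarrow> f \<in> words W"
  using words_letter[OF _ words_id, of f W] by auto

lemma inverse_closed_words:
  assumes "inverse_closed W"
  shows "inverse_closed (words W)"
  unfolding inverse_closed_def
proof
  fix g assume "g \<in> words W"
  then show "\<exists>g'\<in>words W. g \<circ> g' = id \<and> g' \<circ> g = id"
  proof (induction rule: words.induct)
    case words_id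
    show ?case by (rule bexI[OF _ words.words_id]) simp
  next
    case (words_letter f g)
    then obtain f' g' where fg: "f' \<in> W" "g' \<in> words W" "f \<circ> f' = id" "f' \<circ> f = id" "g \<circ> g' = id" "g' \<circ> g = id"
      using assms unfolding inverse_closed_def by blast
    have "(f \<circ> g) \<circ> (g' \<circ> f') = f \<circ> (g \<circ> g') \<circ> f'" "(g' \<circ> f') \<circ> (f \<circ> g) = g' \<circ> (f' \<circ> f) \<circ> g"
      by (simp_all only: comp_assoc)
    then have "(f \<circ> g) \<circ> (g' \<circ> f') = id" "(g' \<circ> f') \<circ> (f \<circ> g) = id" using fg by simp_all
    then show ?case using words_comp[OF fg(2) words_single[OF fg(1)]] by blast
  qed
qed

lemma words_mono: "W \<subseteq> W' \<Longrightarrow> words W \<subseteq> words W'"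
proof
  fix g assume "W \<subseteq> W'" and g: "g \<in> words W"
  from g show "g \<in> words W'"
    by (induction rule: words.induct) (blast intro: words.intros subsetD[OF \<open>W \<subseteq> W'\<close>])+
qed

text \<open>\<open>E\<close> is the directed union of its parts over the groups generated by finite
  inverse-closed sets of maps. All parts have the same fibre, because each of these groups contains
  the identity, and finiteness makes them \<open>left_discrete\<close>.\<close>

lemma tame_quotient_PL: "tame_quotient TYPE('g::group_add) PL_group"
  unfolding tame_quotient_def
proof (intro allI impI)
  fix E :: "((real \<Rightarrow> real) \<times> 'g) set"
  assume E: "subquot PL_group E" and tE: "tame (fibre PL_group E)"
  define F where "F = (\<lambda>W. {(f, m). (f, m) \<in> E \<and> f \<in> words W})"
  let ?\<W> = "{W. finite W \<and> W \<subseteq> fst ` E \<and> inverse_closed W}"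
  have tF: "tame (snd ` F W)" if W: "finite W" "W \<subseteq> fst ` E" "inverse_closed W" for W
  proof -
    have sF: "subquot PL_group (F W)"
      unfolding subquot_def
    proof (intro conjI allI impI)
      show "F W \<subseteq> carrier PL_group \<times> UNIV" using subquotD(1)[OF E] by (auto simp: F_def)
      show "(\<one>\<^bsub>PL_group\<^esub>, 0) \<in> F W"
        using subquot_PL(2)[OF E] words_id by (auto simp: F_def PL_group_def)
      show "(q \<otimes>\<^bsub>PL_group\<^esub> r, m + n) \<in> F W" if "(q, m) \<in> F W" "(r, n) \<in> F W" for q m r n
        using that subquot_PL(3)[OF E] words_comp by (auto simp: F_def PL_group_def)
      fix f m assume f: "(f, m) \<in> F W"
      then obtain f' where f': "(f', - m) \<in> E" "\<forall>x. f (f' x) = x" "\<forall>x. f' (f x) = x"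
        using subquot_PL(4)[OF E] unfolding F_def by blast
      obtain g where g: "g \<in> words W" "f \<circ> g = id"
        using inverse_closed_words[OF W(3)] f by (auto simp: F_def inverse_closed_def)
      have "f' x = g x" for x using f'(3) g(2) by (metis comp_apply id_apply)
      then have "f' = g" by (simp add: fun_eq_iff)
      then have "f' \<in> words W" using g(1) by simp
      then show "\<exists>r. (r, - m) \<in> F W \<and> f \<otimes>\<^bsub>PL_group\<^esub> r = \<one>\<^bsub>PL_group\<^esub> \<and> r \<otimes>\<^bsub>PL_group\<^esub> f = \<one>\<^bsub>PL_group\<^esub>"
        using f' by (intro exI[of _ f']) (auto simp: F_def PL_group_def fun_eq_iff)
    qed
    have fib: "fibre PL_group (F W) = fibre PL_group E" using words_id by (auto simp: F_def PL_group_def)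
    have WF: "\<exists>m. (f, m) \<in> F W" if "f \<in> W" for f
      using that W(2) words_single(1)[OF that] by (force simp: F_def)
    have "left_discrete (F W)"
      unfolding left_discrete_def
    proof (intro ballI impI)
      fix t assume t: "t \<in> fixset (F W)" "0 < t"
      have t01: "t \<in> {0..1}" using t by (simp add: fixset_def)
      have fW: "pl_homeo f" "f t = t" if "f \<in> W" for f
        using WF[OF that] subquot_PL(1)[OF sF] t by (auto simp: fixset_def)
      have "\<exists>a m. a < t \<and> 0 \<le> a \<and> (\<forall>x\<in>{a..t}. f x = t + m * (x - t))" if "f \<in> W" for f
        using pl_affine_near(2)[OF fW(1)[OF that] t01 fW(2)[OF that] t(2)] .
      then obtain a m where am: "\<And>f. f \<in> W \<Longrightarrow> a f < t \<and> 0 \<le> a f \<and> (\<forall>x\<in>{a f..t}. f x = t + m f * (x - t))"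
        by metis
      \<comment> \<open>Between \<open>b\<close> and \<open>t\<close> every generator is linear
        around its fixed point \<open>t\<close>.\<close>
      define b where "b = Max (insert 0 (a ` W))"
      have b: "b \<in> {0..<t}" "\<And>f. f \<in> W \<Longrightarrow> a f \<le> b" using W(1) am t(2) by (auto simp: b_def)
      show "\<exists>a\<in>{0..<t}. (\<forall>f m. (f, m) \<in> F W \<longrightarrow> (\<forall>x\<in>{a..t}. f x = x)) \<or> (\<forall>x\<in>{a<..<t}. x \<notin> fixset (F W))"
      \<comment> \<open>If all slopes are 1, every word is the identity on \<open>[b,t]\<close>; a
        generator with another slope has no fixed point strictly between \<open>b\<close> and
        \<open>t\<close>.\<close>
      proof (cases "\<forall>f\<in>W. m f = 1")
        case True
        have wx: "f x = x" if "f \<in> W" "x \<in> {b..t}" for f x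
        proof -
          have "x \<in> {a f..t}" using that b(2)[OF that(1)] by auto
          then show ?thesis using am[OF that(1)] True that(1) by auto
        qed
        have "g x = x" if "g \<in> words W" "x \<in> {b..t}" for g x
          using that
        proof (induction rule: words.induct)
          case (words_letter f g)
          then show ?case using wx[of f x] by simp
        qed simp
        then show ?thesis using b(1) by (intro bexI[of _ b]) (auto simp: F_def)
      next
        case False
        then obtain f where f: "f \<in> W" "m f \<noteq> 1" by blast
        have "x \<notin> fixset (F W)" if x: "x \<in> {b<..<t}" for x
        proof
          assume "x \<in> fixset (F W)"
          then have "f x = x" using WF[OF f(1)] by (auto simp: fixset_def)
          moreover have "x \<in> {a f..t}" using x b(2)[OF f(1)] by auto
          then have "f x = t + m f * (x - t)" using am[OF f(1)] by blast
          ultimately have "(m f - 1) * (x - t) = 0" by (simp add: algebra_simps)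
          then show False using f x by simp
        qed
        then show ?thesis using b(1) by blast
      qed
    qed
    then have "has_arch (snd ` F W) Z" if Z: "good (snd ` F W) Z" for Z
      using has_arch_left_discrete[OF sF _ Z] tame_has_arch[OF tE sgp_snd_subquot[OF sF] Z]
      unfolding fib[symmetric] by force
    then show ?thesis using sgp_snd_subquot[OF sF] by (auto simp: tame_def)
  qed
  have "tame (\<Union>((\<lambda>W. snd ` F W) ` ?\<W>))"
  proof (rule tame_directed_Union)
    have "{} \<in> ?\<W>" by (simp add: inverse_closed_def)
    then show "(\<lambda>W. snd ` F W) ` ?\<W> \<noteq> {}" by blast
    show "tame S" if "S \<in> (\<lambda>W. snd ` F W) ` ?\<W>" for S using that tF by auto
    fix S T assume "S \<in> (\<lambda>W. snd ` F W) ` ?\<W>" "T \<in> (\<lambda>W. snd ` F W) ` ?\<W>"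
    then obtain V W where VW: "V \<in> ?\<W>" "S = snd ` F V" "W \<in> ?\<W>" "T = snd ` F W" by blast
    have "F V \<subseteq> F (V \<union> W)" "F W \<subseteq> F (V \<union> W)"
      using words_mono[of V "V \<union> W"] words_mono[of W "V \<union> W"] by (auto simp: F_def)
    then have "S \<union> T \<subseteq> snd ` F (V \<union> W)" using VW by blast
    moreover have "V \<union> W \<in> ?\<W>" using VW unfolding inverse_closed_def by blast
    ultimately show "\<exists>U\<in>(\<lambda>W. snd ` F W) ` ?\<W>. S \<union> T \<subseteq> U" by blast
  qed
  moreover have "\<Union>((\<lambda>W. snd ` F W) ` ?\<W>) = snd ` E"
  proof
    show "snd ` E \<subseteq> \<Union>((\<lambda>W. snd ` F W) ` ?\<W>)"
    proof
      fix m assume "m \<in> snd ` E"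
      then obtain f where f: "(f, m) \<in> E" by force
      then obtain f' where f': "(f', - m) \<in> E" "f \<circ> f' = id" "f' \<circ> f = id"
        using subquot_PL(4)[OF E] by (fastforce simp: fun_eq_iff)
      have "(f, m) \<in> F {f, f'}" using f words_single[of f "{f, f'}"] by (simp add: F_def)
      then have "m \<in> snd ` F {f, f'}" by force
      moreover have "{f, f'} \<in> ?\<W>" using f f' by (force simp: inverse_closed_def)
      ultimately show "m \<in> \<Union>((\<lambda>W. snd ` F W) ` ?\<W>)" by blast
    qed
  qed (auto simp: F_def)
  ultimately show "tame (snd ` E)" by simp
qed

text \<open>The image of the identity is an idempotent strictly increasing map, hence the identity
  map. With this, \<open>E\<close> can be transported along the isomorphism.\<close>

lemma tame_quotient_iso_PL:
  assumes H: "group H" and iso: "H \<cong> PL_group"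
  shows "tame_quotient TYPE('g::group_add) H"
  unfolding tame_quotient_def
proof (intro allI impI)
  fix E :: "('a \<times> 'g) set"
  assume E: "subquot H E" and tE: "tame (fibre H E)"
  interpret H: group H by (rule H)
  obtain \<phi> where "\<phi> \<in> hom H PL_group" "bij_betw \<phi> (carrier H) (carrier PL_group)"
    using iso by (auto simp: is_iso_def iso_def)
  then have \<phi>: "\<And>x. x \<in> carrier H \<Longrightarrow> pl_homeo (\<phi> x)"
    "\<And>x y. x \<in> carrier H \<Longrightarrow> y \<in> carrier H \<Longrightarrow> \<phi> (x \<otimes>\<^bsub>H\<^esub> y) = \<phi> x \<circ> \<phi> y"
    and inj: "inj_on \<phi> (carrier H)"
    by (auto simp: hom_def PL_group_def bij_betw_def)
  have idem: "\<phi> \<one>\<^bsub>H\<^esub> (\<phi> \<one>\<^bsub>H\<^esub> x) = \<phi> \<one>\<^bsub>H\<^esub> x" for x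
    using \<phi>(2)[of "\<one>\<^bsub>H\<^esub>" "\<one>\<^bsub>H\<^esub>"] by (simp add: fun_eq_iff)
  have p1: "pl_homeo (\<phi> \<one>\<^bsub>H\<^esub>)" using \<phi>(1) by simp
  have one: "\<phi> \<one>\<^bsub>H\<^esub> x = x" for x
  proof (cases "x \<in> {0..1}")
    case True
    have r: "\<phi> \<one>\<^bsub>H\<^esub> x \<in> {0..1}" by (rule pl_range[OF p1 True])
    have "\<not> \<phi> \<one>\<^bsub>H\<^esub> x < x" "\<not> x < \<phi> \<one>\<^bsub>H\<^esub> x"
      using pl_less[OF p1, of "\<phi> \<one>\<^bsub>H\<^esub> x" x] pl_less[OF p1, of x "\<phi> \<one>\<^bsub>H\<^esub> x"] idem[of x] True r
      by auto
    then show ?thesis by simp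
  next
    case False
    then show ?thesis by (rule pl_outside[OF p1])
  qed
  let ?h = "\<lambda>(q, m). (\<phi> q, m)"
  have "subquot PL_group (?h ` E)"
    unfolding subquot_def
  proof (intro conjI allI impI)
    show "?h ` E \<subseteq> carrier PL_group \<times> UNIV"
      using \<phi>(1) subquotD(1)[OF E] by (auto simp: PL_group_def)
    have "(id, 0) = ?h (\<one>\<^bsub>H\<^esub>, 0)" using one by (simp add: fun_eq_iff)
    then show "(\<one>\<^bsub>PL_group\<^esub>, 0) \<in> ?h ` E"
      using subquotD(2)[OF E] unfolding PL_group_def monoid.simps by (rule image_eqI)
    show "(f \<otimes>\<^bsub>PL_group\<^esub> g, m + n) \<in> ?h ` E" if fg: "(f, m) \<in> ?h ` E" "(g, n) \<in> ?h ` E" for f m g n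
    proof -
      obtain q r where qr: "(q, m) \<in> E" "f = \<phi> q" "(r, n) \<in> E" "g = \<phi> r" using fg by auto
      then have "f \<otimes>\<^bsub>PL_group\<^esub> g = \<phi> (q \<otimes>\<^bsub>H\<^esub> r)" "(q \<otimes>\<^bsub>H\<^esub> r, m + n) \<in> E"
        using \<phi>(2) subquotD(1,3)[OF E] by (auto simp: PL_group_def)
      then show ?thesis by (intro image_eqI[of _ _ "(q \<otimes>\<^bsub>H\<^esub> r, m + n)"]) auto
    qed
    fix f m assume "(f, m) \<in> ?h ` E"
    then obtain q where q: "(q, m) \<in> E" "f = \<phi> q" by auto
    then obtain r where r: "(r, - m) \<in> E" "q \<otimes>\<^bsub>H\<^esub> r = \<one>\<^bsub>H\<^esub>" "r \<otimes>\<^bsub>H\<^esub> q = \<one>\<^bsub>H\<^esub>"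
      using subquotD(4)[OF E] by blast
    have c: "q \<in> carrier H" "r \<in> carrier H" using subquotD(1)[OF E] q r by blast+
    have "\<phi> q \<circ> \<phi> r = id" "\<phi> r \<circ> \<phi> q = id"
      using \<phi>(2)[OF c] \<phi>(2)[OF c(2,1)] r one by (simp_all add: fun_eq_iff)
    moreover have "(\<phi> r, - m) \<in> ?h ` E" using r by force
    ultimately show "\<exists>r. (r, - m) \<in> ?h ` E \<and> f \<otimes>\<^bsub>PL_group\<^esub> r = \<one>\<^bsub>PL_group\<^esub> \<and> r \<otimes>\<^bsub>PL_group\<^esub> f = \<one>\<^bsub>PL_group\<^esub>"
      using q by (intro exI[of _ "\<phi> r"]) (simp add: PL_group_def)
  qed
  moreover have "fibre PL_group (?h ` E) = fibre H E"
  proof (intro Set.set_eqI iffI)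
    fix m assume "m \<in> fibre PL_group (?h ` E)"
    then obtain q where q: "(q, m) \<in> E" "\<phi> q = id" by (auto simp: PL_group_def)
    then have "\<phi> q = \<phi> \<one>\<^bsub>H\<^esub>" using one by (simp add: fun_eq_iff)
    then have "q = \<one>\<^bsub>H\<^esub>" using inj subquotD(1)[OF E q(1)] by (auto simp: inj_on_def)
    then show "m \<in> fibre H E" using q by simp
  next
    fix m assume "m \<in> fibre H E"
    moreover have "\<phi> \<one>\<^bsub>H\<^esub> = id" using one by (simp add: fun_eq_iff)
    ultimately show "m \<in> fibre PL_group (?h ` E)" by (force simp: PL_group_def)
  qed
  ultimately have "tame (snd ` ?h ` E)"
    using tame_quotient_PL[unfolded tame_quotient_def, rule_format, of "?h ` E"] tE by simp
  moreover have "snd ` ?h ` E = snd ` E" by force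
  ultimately show "tame (snd ` E)" by simp
qed

lemma inC_tame_quotient:
  assumes "inC H"
  shows "group H \<and> tame_quotient TYPE('g::group_add) H"
  using assms
proof (induction rule: inC.induct)
  case (NS H)
  then show ?case using tame_quotient_NS by (auto simp: NS_group_def)
next
  case (P H)
  then show ?case using tame_quotient_iso_PL by blast
next
  case (sub H S)
  then show ?case
    using tame_quotient_sub[of H S] subgroup.subset[of S H] subgroup.subgroup_is_group[of S H] by blast
next
  case (image H K h)
  then show ?case using tame_quotient_image by blast
next
  case (ext H N K)
  then show ?case using tame_quotient_ext by blast
next
  case (union H \<S>)
  have "tame_quotient TYPE('g) H"
    by (rule tame_quotient_union[OF union(1,2) _ union(3,4)]) (use union(5) in simp)
  then show ?case using union(1) by simp
qed

subsection \<open>The Cayley embedding\<close>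

text \<open>The permutations of a type form a type of class \<open>group_add\<close>; the abstract
  group \<open>F\<close> is represented in it by left multiplication on its carrier.\<close>

typedef 'a sym = "{f :: 'a \<Rightarrow> 'a. bij f}"
  morphisms app Sym
  by (auto intro: bij_id)

lemma bij_app: "bij (app x)"
  using app[of x] by simp

instantiation sym :: (type) group_add
begin

definition zero_sym :: "'a sym" where "0 = Sym id"
definition plus_sym :: "'a sym \<Rightarrow> 'a sym \<Rightarrow> 'a sym" where "x + y = Sym (app x \<circ> app y)"
definition uminus_sym :: "'a sym \<Rightarrow> 'a sym" where "- x = Sym (inv_into UNIV (app x))"
definition minus_sym :: "'a sym \<Rightarrow> 'a sym \<Rightarrow> 'a sym" where "x - y = x + - (y :: 'a sym)"

lemma app_zero: "app (0 :: 'a sym) = id"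
  by (simp add: zero_sym_def Sym_inverse)

lemma app_plus: "app (x + y) = app x \<circ> app (y :: 'a sym)"
  by (simp add: plus_sym_def Sym_inverse bij_comp bij_app)

lemma app_uminus: "app (- x) = inv_into UNIV (app (x :: 'a sym))"
  by (simp add: uminus_sym_def Sym_inverse bij_imp_bij_inv bij_app)

instance
proof
  fix a b c :: "'a sym"
  show "a + b + c = a + (b + c)" by (rule app_inject[THEN iffD1]) (simp add: app_plus comp_assoc)
  show "0 + a = a" "a + 0 = a" by (rule app_inject[THEN iffD1], simp add: app_plus app_zero)+
  show "- a + a = 0"
    by (rule app_inject[THEN iffD1]) (simp add: app_plus app_zero app_uminus bij_is_inj[OF bij_app])
  show "a + - b = a - b" by (simp add: minus_sym_def)
qed

end

definition cay :: "('a, 'b) monoid_scheme \<Rightarrow> 'a \<Rightarrow> 'a sym" where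
  "cay F x = Sym (\<lambda>y. if y \<in> carrier F then x \<otimes>\<^bsub>F\<^esub> y else y)"

context group
begin

lemma app_cay:
  assumes x: "x \<in> carrier G"
  shows "app (cay G x) = (\<lambda>y. if y \<in> carrier G then x \<otimes> y else y)"
proof -
  let ?f = "\<lambda>x y. if y \<in> carrier G then x \<otimes> y else y"
  have inv: "?f x \<circ> ?f (inv x) = id" "?f (inv x) \<circ> ?f x = id"
    using x by (auto simp: fun_eq_iff m_assoc[symmetric])
  have "bij (?f x)" by (rule o_bij[OF inv(2,1)])
  then show ?thesis by (simp add: cay_def Sym_inverse)
qed

lemma cay_mult: "x \<in> carrier G \<Longrightarrow> y \<in> carrier G \<Longrightarrow> cay G (x \<otimes> y) = cay G x + cay G y"
  by (rule app_inject[THEN iffD1]) (auto simp: app_plus app_cay fun_eq_iff m_assoc)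

lemma cay_one: "cay G \<one> = 0"
  by (metis add.right_neutral add_left_cancel cay_mult l_one one_closed)

lemma cay_inv: "x \<in> carrier G \<Longrightarrow> cay G (inv x) = - cay G x"
  using cay_mult[of "inv x" x] by (simp add: cay_one eq_neg_iff_add_eq_0)

lemma inj_cay: "inj_on (cay G) (carrier G)"
proof (rule inj_onI)
  fix x y assume xy: "x \<in> carrier G" "y \<in> carrier G" "cay G x = cay G y"
  then have "app (cay G x) \<one> = app (cay G y) \<one>" by simp
  then show "x = y" using xy(1,2) by (simp add: app_cay)
qed

lemma sgp_cay: "subgroup S G \<Longrightarrow> sgp (cay G ` S)"
  unfolding sgp_def
proof (intro conjI ballI)
  assume S: "subgroup S G"
  have sub: "x \<in> carrier G" if "x \<in> S" for x using that subgroup.subset[OF S] by blast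
  show "0 \<in> cay G ` S" using cay_one subgroup.one_closed[OF S] by (metis image_eqI)
  show "x + y \<in> cay G ` S" if "x \<in> cay G ` S" "y \<in> cay G ` S" for x y
    using that sub cay_mult subgroup.m_closed[OF S] by (auto simp: image_iff) metis
  show "- x \<in> cay G ` S" if "x \<in> cay G ` S" for x
    using that sub cay_inv subgroup.m_inv_closed[OF S] by (auto simp: image_iff) metis
qed

end

subsection \<open>Preorders on a finitely generated group\<close>

text \<open>A preorder is trivial as soon as the finitely many generators are neutral, so
  nontriviality survives limits. A cut is never trivial, because a nonempty set invariant under all
  translations is the whole group.\<close>

lemma good_proper_preorders:
  assumes F: "sgp F" and X: "finite S" "S \<subseteq> F"
    and gen: "\<And>P. preord F P \<Longrightarrow> (\<And>x. x \<in> S \<Longrightarrow> x \<in> P \<and> - x \<in> P) \<Longrightarrow> P = F"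
    and ne: "preord F P0" "P0 \<noteq> F"
  shows "good F {P. preord F P \<and> P \<noteq> F}"
  unfolding good_def
proof (intro conjI ballI allI impI)
  show "{P. preord F P \<and> P \<noteq> F} \<noteq> {}" using ne by auto
  show "preord F P" if "P \<in> {P. preord F P \<and> P \<noteq> F}" for P using that by simp
  show "lim_closed {P. preord F P \<and> P \<noteq> F}"
    unfolding lim_closed_def
  proof (intro allI impI)
    fix Q assume Q: "\<forall>W. finite W \<longrightarrow> (\<exists>P\<in>{P. preord F P \<and> P \<noteq> F}. P \<inter> W = Q \<inter> W)"
    have app: "\<exists>P. preord F P \<and> P \<noteq> F \<and> (\<forall>x\<in>W. x \<in> P \<longleftrightarrow> x \<in> Q)" if "finite W" for W
    proof -
      obtain P where P: "P \<in> {P. preord F P \<and> P \<noteq> F}" "P \<inter> W = Q \<inter> W" using Q \<open>finite W\<close> by meson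
      have "x \<in> P \<longleftrightarrow> x \<in> Q" if "x \<in> W" for x using P(2) that by blast
      then show ?thesis using P(1) by blast
    qed
    have "preord F Q"
      unfolding preord_def
    proof (intro conjI ballI subsetI)
      show "x \<in> F" if "x \<in> Q" for x
        using app[of "{x}"] that by (auto simp: preord_def)
      show "x + y \<in> Q" if "x \<in> Q" "y \<in> Q" for x y
        using app[of "{x, y, x + y}"] that by (auto simp: preord_def)
      show "x \<in> Q \<or> - x \<in> Q" if "x \<in> F" for x
        using app[of "{x, - x}"] that by (auto simp: preord_def)
    qed
    moreover have "Q \<noteq> F"
    proof
      assume "Q = F"
      obtain P where P: "preord F P" "P \<noteq> F" "\<forall>x\<in>S \<union> uminus ` S. x \<in> P \<longleftrightarrow> x \<in> Q"
        using app[of "S \<union> uminus ` S"] X by blast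
      then have "x \<in> P \<and> - x \<in> P" if "x \<in> S" for x
        using that X F \<open>Q = F\<close> by (auto simp: sgpI)
      then show False using gen[OF P(1)] P(2) by blast
    qed
    ultimately show "Q \<in> {P. preord F P \<and> P \<noteq> F}" by simp
  qed
next
  fix P D assume "P \<in> {P. preord F P \<and> P \<noteq> F}" and D: "downset F P D"
  then have P: "preord F P" by simp
  have DF: "D \<subseteq> F" "D \<noteq> {}" "D \<noteq> F" and down: "\<And>m d. d \<in> D \<Longrightarrow> m \<in> F \<Longrightarrow> cle P m d \<Longrightarrow> m \<in> D"
    using D by (auto simp: downset_def)
  let ?C = "cut_cone F D"
  have "preord F ?C"
    unfolding preord_def
  proof (intro conjI ballI)
    show "?C \<subseteq> F" by (auto simp: cut_cone_def)
    show "x + y \<in> ?C" if "x \<in> ?C" "y \<in> ?C" for x y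
      using that F by (auto simp: cut_cone_def grp sgpI)
    fix x assume x: "x \<in> F"
    show "x \<in> ?C \<or> - x \<in> ?C"
    proof (cases "x \<in> ?C")
      case False
      \<comment> \<open>The excluded point \<open>- x + d\<close> lies above all of
        \<open>D\<close>, so translation by \<open>x\<close> moves \<open>D\<close> below
        \<open>d\<close>.\<close>
      then obtain d where d: "d \<in> D" "- x + d \<notin> D" using x by (auto simp: cut_cone_def)
      have xd: "- x + d \<in> F" using d x DF F by (auto intro!: sgpI)
      have "x + d' \<in> D" if d': "d' \<in> D" for d'
      proof -
        have "\<not> cle P (- x + d) d'" using down[OF d' xd] d by blast
        then have "cle P d' (- x + d)" using cle_total[OF F P xd] d' DF by blast
        then have "cle P (x + d') (x + (- x + d))" by (simp only: cle_left)
        then show ?thesis using down[OF d(1)] x d' DF F by (auto simp: sgpI)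
      qed
      then show ?thesis using x F by (simp add: cut_cone_def sgpI)
    qed simp
  qed
  moreover have "?C \<noteq> F"
  proof
    assume C: "?C = F"
    obtain d where d: "d \<in> D" using DF by blast
    have "y \<in> D" if y: "y \<in> F" for y
    proof -
      have "d + - y \<in> ?C" unfolding C using d y DF F by (auto intro!: sgpI)
      then have "- (d + - y) + d \<in> D" using d by (auto simp: cut_cone_def)
      then show ?thesis by (simp add: grp)
    qed
    then show False using DF by blast
  qed
  ultimately show "?C \<in> {P. preord F P \<and> P \<noteq> F}" by simp
qed

context group
begin

lemma left_order_of_preord:
  assumes P: "preord (cay G ` carrier G) P" and anti: "\<And>c. c \<in> P \<Longrightarrow> - c \<in> P \<Longrightarrow> c = 0"
  shows "left_order G {(x, y). x \<in> carrier G \<and> y \<in> carrier G \<and> cle P (cay G x) (cay G y)}"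
    (is "left_order G ?R")
proof -
  have F: "sgp (cay G ` carrier G)" by (rule sgp_cay[OF subgroup_self])
  have "?R \<subseteq> carrier G \<times> carrier G" by auto
  moreover have "refl_on (carrier G) ?R" using cle_refl[OF F P] by (auto simp: refl_on_def)
  moreover have "trans ?R" by (rule transI) (auto intro: cle_trans[OF F P])
  moreover have "antisym ?R"
  proof (rule antisymI)
    fix x y assume "(x, y) \<in> ?R" "(y, x) \<in> ?R"
    then have xy: "x \<in> carrier G" "y \<in> carrier G" "cle P (cay G x) (cay G y)" "cle P (cay G y) (cay G x)"
      by auto
    then have "- cay G x + cay G y = 0" by (intro anti) (auto simp: cle_def grp)
    then have "cay G x = cay G y" by (simp add: neg_eq_iff_add_eq_0[symmetric])
    then show "x = y" using inj_cay xy by (auto simp: inj_on_def)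
  qed
  moreover have "total_on (carrier G) ?R"
    using cle_total[OF F P] by (auto simp: total_on_def)
  moreover have "(f \<otimes> x, f \<otimes> y) \<in> ?R" if "f \<in> carrier G" "x \<in> carrier G" "y \<in> carrier G" "(x, y) \<in> ?R" for f x y
    using that by (simp add: cay_mult)
  ultimately show ?thesis
    unfolding left_order_def linear_order_on_def partial_order_on_def preorder_on_def by blast
qed

lemma preord_of_left_order:
  assumes R: "left_order G R"
  defines "P \<equiv> {cay G x | x. x \<in> carrier G \<and> (\<one>, x) \<in> R}"
  shows "preord (cay G ` carrier G) P" "\<And>c. c \<in> P \<Longrightarrow> - c \<in> P \<Longrightarrow> c = 0"
proof -
  have lo: "linear_order_on (carrier G) R"
    and left': "\<forall>f\<in>carrier G. \<forall>x\<in>carrier G. \<forall>y\<in>carrier G. (x, y) \<in> R \<longrightarrow> (f \<otimes> x, f \<otimes> y) \<in> R"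
    using R unfolding left_order_def by simp_all
  then have lin: "trans R" "antisym R" "total_on (carrier G) R" "refl_on (carrier G) R"
    unfolding linear_order_on_def partial_order_on_def preorder_on_def by simp_all
  have left: "(f \<otimes> x, f \<otimes> y) \<in> R"
    if "f \<in> carrier G" "x \<in> carrier G" "y \<in> carrier G" "(x, y) \<in> R" for f x y
    using left' that by simp
  have one: "(\<one>, \<one>) \<in> R" using lin(4) by (auto simp: refl_on_def)
  show "preord (cay G ` carrier G) P"
    unfolding preord_def
  proof (intro conjI ballI)
    show "P \<subseteq> cay G ` carrier G" by (auto simp: P_def)
    show "c + d \<in> P" if cd: "c \<in> P" "d \<in> P" for c d
    proof -
      obtain x y where xy: "c = cay G x" "x \<in> carrier G" "(\<one>, x) \<in> R" "d = cay G y" "y \<in> carrier G" "(\<one>, y) \<in> R"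
        using cd by (auto simp: P_def)
      have "(x \<otimes> \<one>, x \<otimes> y) \<in> R" using left xy by blast
      then have "(\<one>, x \<otimes> y) \<in> R" using xy transD[OF lin(1), of \<one> x "x \<otimes> y"] by simp
      then show ?thesis using xy by (auto simp: P_def cay_mult intro!: exI[of _ "x \<otimes> y"])
    qed
    fix c assume "c \<in> cay G ` carrier G"
    then obtain x where x: "c = cay G x" "x \<in> carrier G" by auto
    show "c \<in> P \<or> - c \<in> P"
    proof (cases "(\<one>, x) \<in> R")
      case True
      then show ?thesis using x by (auto simp: P_def)
    next
      case False
      then have "x \<noteq> \<one>" using one by auto
      then have "(x, \<one>) \<in> R" using False x lin(3) by (auto simp: total_on_def)
      then have "(inv x \<otimes> x, inv x \<otimes> \<one>) \<in> R" using x left[of "inv x" x \<one>] by simp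
      then have "(\<one>, inv x) \<in> R" using x by simp
      then have "- c \<in> P" using x by (auto simp: P_def cay_inv intro!: exI[of _ "inv x"])
      then show ?thesis by blast
    qed
  qed
  show "c = 0" if c: "c \<in> P" "- c \<in> P" for c
  proof -
    obtain x where x: "c = cay G x" "x \<in> carrier G" "(\<one>, x) \<in> R" using c by (auto simp: P_def)
    obtain y where y: "- c = cay G y" "y \<in> carrier G" "(\<one>, y) \<in> R" using c by (auto simp: P_def)
    have "cay G y = cay G (inv x)" using x y by (simp add: cay_inv)
    then have "y = inv x" using inj_cay x y by (auto simp: inj_on_def)
    then have "(x \<otimes> \<one>, x \<otimes> inv x) \<in> R" using left x y by blast
    then have "(x, \<one>) \<in> R" using x by simp
    then have "x = \<one>" using x antisymD[OF lin(2)] by blast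
    then show ?thesis using x by (simp add: cay_one)
  qed
qed

text \<open>The left order refines \<open>P\<close> by an arbitrary left order on its stabilizer.\<close>
lemma left_rel_convex_stabilizer:
  assumes P: "preord (cay G ` carrier G) P" and lo: "left_orderable G"
  shows "left_rel_convex G {x \<in> carrier G. cay G x \<in> P \<and> - cay G x \<in> P}" (is "left_rel_convex G ?B")
proof -
  have F: "sgp (cay G ` carrier G)" by (rule sgp_cay[OF subgroup_self])
  obtain R where "left_order G R" using lo by (auto simp: left_orderable_def)
  from preord_of_left_order[OF this] obtain P1 where P1: "preord (cay G ` carrier G) P1"
    "\<And>c. c \<in> P1 \<Longrightarrow> - c \<in> P1 \<Longrightarrow> c = 0" by blast
  define P2 where "P2 = {c \<in> P. - c \<notin> P \<or> c \<in> P1}"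
  note add = cone_add[OF F P] and add1 = cone_add[OF F P1(1)]
  have P2: "preord (cay G ` carrier G) P2"
    unfolding preord_def
  proof (intro conjI ballI)
    show "P2 \<subseteq> cay G ` carrier G" using P by (auto simp: P2_def preord_def)
    show "c + d \<in> P2" if cd: "c \<in> P2" "d \<in> P2" for c d
    proof -
      \<comment> \<open>Both \<open>c\<close> and \<open>d\<close> are nonnegative for
        \<open>P\<close>, so their sum is equivalent to 0 only if both of them are.\<close>
      have "c + d \<in> P1" if "- (c + d) \<in> P"
      proof -
        have "d + - (c + d) \<in> P" "- (c + d) + c \<in> P" using that cd add by (auto simp: P2_def)
        then have "- c \<in> P" "- d \<in> P" by (simp_all add: grp)
        then show ?thesis using cd add1 by (auto simp: P2_def)
      qed
      then show ?thesis using cd add by (auto simp: P2_def)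
    qed
    show "c \<in> P2 \<or> - c \<in> P2" if "c \<in> cay G ` carrier G" for c
      using that P P1(1) by (auto simp: P2_def preord_def)
  qed
  let ?R = "{(x, y). x \<in> carrier G \<and> y \<in> carrier G \<and> cle P2 (cay G x) (cay G y)}"
  have "left_order G ?R" using P1(2) by (intro left_order_of_preord[OF P2]) (auto simp: P2_def)
  moreover have "convex_wrt G ?R ?B"
    unfolding convex_wrt_def
  proof (intro conjI ballI impI)
    have "\<one> \<in> ?B" using cone_zero[OF F P] by (simp add: cay_one)
    then have "?B \<noteq> {}" by blast
    then show "subgroup ?B G"
      using add by (intro subgroupI) (simp_all add: cay_mult cay_inv minus_add subset_iff)
    fix x z y assume B: "x \<in> ?B" "z \<in> ?B" "y \<in> carrier G" and r: "(x, y) \<in> ?R \<and> (y, z) \<in> ?R"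
    then have "- cay G x + cay G y \<in> P" "- cay G y + cay G z \<in> P" by (auto simp: cle_def P2_def)
    then have "cay G x + (- cay G x + cay G y) \<in> P" "- cay G y + cay G z + - cay G z \<in> P"
      using add B by blast+
    then show "y \<in> ?B" using B by (simp add: grp)
  qed
  ultimately show ?thesis by (auto simp: left_rel_convex_def)
qed

text \<open>The quotient by the kernel embeds into the additive group of the reals.\<close>

lemma FactGroup_real_hom:
  fixes \<tau> :: "'a \<Rightarrow> real"
  assumes \<tau>: "\<And>x y. x \<in> carrier G \<Longrightarrow> y \<in> carrier G \<Longrightarrow> \<tau> (x \<otimes> y) = \<tau> x + \<tau> y"
    and K: "K = {x \<in> carrier G. \<tau> x = 0}"
  shows "K \<lhd> G" "comm_group (G Mod K)" "torsion_free (G Mod K)"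
proof -
  have one: "\<tau> \<one> = 0" using \<tau>[of \<one> \<one>] by simp
  have inv: "\<tau> (inv x) = - \<tau> x" if "x \<in> carrier G" for x
    using \<tau>[of x "inv x"] one that by simp
  have "subgroup K G" unfolding K by (rule subgroupI) (use one inv \<tau> in auto)
  then show nor: "K \<lhd> G"
    using \<tau> inv by (auto simp: normal_inv_iff K)
  then interpret K: normal K G .
  interpret Q: group "G Mod K" by (rule K.factorgroup_is_group)
  have eq: "K #> x = K #> y" if "x \<in> carrier G" "y \<in> carrier G" "\<tau> x = \<tau> y" for x y
  proof -
    have "\<tau> (x \<otimes> inv y) = 0" unfolding \<tau>[OF that(1) inv_closed[OF that(2)]] inv[OF that(2)] that(3) by simp
    then have "x \<otimes> inv y \<in> K" unfolding K using that(1,2) by blast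
    then have "x \<in> K #> y" using K.rcos_module[OF is_group that(2,1)] by blast
    then show ?thesis using repr_independence[OF _ that(2) K.subgroup_axioms] by blast
  qed
  show "comm_group (G Mod K)"
  proof (rule Q.group_comm_groupI)
    fix a b assume "a \<in> carrier (G Mod K)" "b \<in> carrier (G Mod K)"
    then obtain x y where "x \<in> carrier G" "a = K #> x" "y \<in> carrier G" "b = K #> y"
      by (auto simp: FactGroup_def RCOSETS_def)
    then show "a \<otimes>\<^bsub>G Mod K\<^esub> b = b \<otimes>\<^bsub>G Mod K\<^esub> a"
      using eq[of "x \<otimes> y" "y \<otimes> x"] \<tau> by (simp add: FactGroup_def K.rcos_sum)
  qed
  have pow: "\<tau> (x [^] n) = real n * \<tau> x" if "x \<in> carrier G" for x and n :: nat
    by (induction n) (use one \<tau> that in \<open>auto simp: algebra_simps\<close>)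
  show "torsion_free (G Mod K)"
    unfolding torsion_free_def
  proof (intro ballI allI impI, elim conjE)
    fix a and n :: nat
    assume a: "a \<in> carrier (G Mod K)" and n: "n > 0" "a [^]\<^bsub>G Mod K\<^esub> n = \<one>\<^bsub>G Mod K\<^esub>"
    obtain x where x: "x \<in> carrier G" "a = K #> x" using a by (auto simp: FactGroup_def RCOSETS_def)
    have "a [^]\<^bsub>G Mod K\<^esub> n = K #> (x [^] n)" unfolding x(2) by (rule K.FactGroup_pow[OF x(1)])
    then have "K #> (x [^] n) = K" using n by (simp add: FactGroup_def)
    then have "x [^] n \<in> K" using coset_join1[OF _ _ K.subgroup_axioms] x by simp
    then have "real n * \<tau> x = 0" unfolding K pow[OF x(1), symmetric] by blast
    then have "x \<in> K" unfolding K using n x(1) by simp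
    then show "a = \<one>\<^bsub>G Mod K\<^esub>" unfolding x(2) one_FactGroup by (rule coset_join2[OF x(1) K.subgroup_axioms])
  qed
qed

end

theorem theorem4p12:
  fixes F :: "'a monoid" and G :: "'a set" and H :: "'u monoid"
  assumes "group F" and "subgroup G F"
    and "inC H" and "F\<lparr>carrier := G\<rparr> \<cong> H"
    and "carrier F \<noteq> {\<one>\<^bsub>F\<^esub>}"
    and "fin_gen F" and "left_orderable F"
  shows "\<exists>B. left_rel_convex F B \<and> B \<noteq> carrier F \<and>
           (B \<inter> G) \<lhd> F\<lparr>carrier := G\<rparr> \<and>
           (\<exists>A. subgroup A (F\<lparr>carrier := G\<rparr>) \<and> B \<inter> G \<subseteq> A \<and>
              (let GG = F\<lparr>carrier := G\<rparr>; Q = GG Mod (B \<inter> G);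
                   AQ = (\<lambda>a. (B \<inter> G) #>\<^bsub>GG\<^esub> a) ` A
               in AQ \<lhd> Q \<and> comm_group (Q\<lparr>carrier := AQ\<rparr>) \<and> torsion_free (Q\<lparr>carrier := AQ\<rparr>) \<and>
                  centralizer_of Q AQ = AQ \<and>
                  A \<lhd> GG \<and> comm_group (GG Mod A) \<and> torsion_free (GG Mod A)))"
proof -
  interpret F: group F by (rule assms(1))
  interpret G: subgroup G F by (rule assms(2))
  define GG where "GG = F\<lparr>carrier := G\<rparr>"
  interpret GG: group GG unfolding GG_def by (rule G.subgroup_is_group[OF assms(1)])
  interpret H: group H using inC_tame_quotient[OF assms(3)] by blast
  let ?c = "cay F"
  let ?F = "?c ` carrier F" and ?G = "?c ` G"
  have sF: "sgp ?F" by (rule F.sgp_cay[OF F.subgroup_self])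
  have sG: "sgp ?G" "?G \<subseteq> ?F" using F.sgp_cay[OF assms(2)] G.subset by auto
  have tame: "tame ?G"
  proof -
    obtain \<phi> where \<phi>: "\<phi> \<in> hom GG H" "inj_on \<phi> G"
      using assms(4) by (auto simp: is_iso_def iso_def bij_betw_def GG_def)
    interpret f: group_hom GG H \<phi> using \<phi>(1) by unfold_locales
    have GGs: "carrier GG = G" "\<one>\<^bsub>GG\<^esub> = \<one>\<^bsub>F\<^esub>" "x \<otimes>\<^bsub>GG\<^esub> y = x \<otimes>\<^bsub>F\<^esub> y" for x y by (simp_all add: GG_def)
    have inv: "inv\<^bsub>GG\<^esub> g = inv\<^bsub>F\<^esub> g" if "g \<in> G" for g
      unfolding GG_def using F.m_inv_consistent[OF assms(2) that] .
    \<comment> \<open>This is the isomorphism read through the Cayley embedding. By injectivity the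
      fibre over the identity is 0, so \<open>G\<close> appears as an extension of the trivial
      group.\<close>
    let ?E = "(\<lambda>g. (\<phi> g, ?c g)) ` G"
    have "subquot H ?E"
      unfolding subquot_def
    proof (intro conjI allI impI)
      show "?E \<subseteq> carrier H \<times> UNIV" using f.hom_closed GGs by auto
      show "(\<one>\<^bsub>H\<^esub>, 0) \<in> ?E" using f.hom_one GGs F.cay_one G.one_closed by (intro image_eqI[of _ _ "\<one>\<^bsub>F\<^esub>"]) simp_all
      show "(q \<otimes>\<^bsub>H\<^esub> r, m + n) \<in> ?E" if qr: "(q, m) \<in> ?E" "(r, n) \<in> ?E" for q m r n
      proof -
        obtain g h where "g \<in> G" "h \<in> G" "q = \<phi> g" "m = ?c g" "r = \<phi> h" "n = ?c h" using qr by auto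
        then show ?thesis
          using f.hom_mult[of g h] GGs F.cay_mult[of g h] by (intro image_eqI[of _ _ "g \<otimes>\<^bsub>F\<^esub> h"]) auto
      qed
      fix q m assume "(q, m) \<in> ?E"
      then obtain g where g: "g \<in> G" "q = \<phi> g" "m = ?c g" by auto
      then have "(\<phi> (inv\<^bsub>F\<^esub> g), - m) \<in> ?E" using F.cay_inv[of g] by (intro image_eqI[of _ _ "inv\<^bsub>F\<^esub> g"]) auto
      moreover have "\<phi> (inv\<^bsub>F\<^esub> g) = inv\<^bsub>H\<^esub> q" using f.hom_inv[of g] g GGs inv by simp
      moreover have "q \<in> carrier H" using g f.hom_closed GGs by simp
      ultimately show "\<exists>r. (r, - m) \<in> ?E \<and> q \<otimes>\<^bsub>H\<^esub> r = \<one>\<^bsub>H\<^esub> \<and> r \<otimes>\<^bsub>H\<^esub> q = \<one>\<^bsub>H\<^esub>"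
        by (intro exI[of _ "inv\<^bsub>H\<^esub> q"]) simp
    qed
    moreover have "fibre H ?E = {0}"
    proof (intro Set.set_eqI iffI)
      fix m assume "m \<in> fibre H ?E"
      then obtain g where g: "g \<in> G" "\<phi> g = \<one>\<^bsub>H\<^esub>" "m = ?c g" by auto
      moreover from this have "\<phi> g = \<phi> \<one>\<^bsub>F\<^esub>" using f.hom_one GGs by simp
      ultimately have "g = \<one>\<^bsub>F\<^esub>" using inj_onD[OF \<phi>(2)] G.one_closed by blast
      then show "m \<in> {0}" using g F.cay_one by simp
    next
      fix m :: "'a sym" assume "m \<in> {0}"
      then show "m \<in> fibre H ?E" using f.hom_one GGs F.cay_one G.one_closed by (auto intro!: image_eqI[of _ _ "\<one>\<^bsub>F\<^esub>"])
    qed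
    moreover have "tame {0 :: 'a sym}"
    proof -
      have "has_arch {0} Z" if "good {0 :: 'a sym} Z" for Z
        using goodD(1,2)[OF that] by (fastforce simp: has_arch_def arch_def preord_def)
      then show ?thesis by (simp add: tame_def sgp_def)
    qed
    ultimately have "tame (snd ` ?E)"
      using inC_tame_quotient[OF assms(3), where 'g = "'a sym", THEN conjunct2, unfolded tame_quotient_def, rule_format, of ?E]
      by simp
    moreover have "snd ` ?E = ?G" by force
    ultimately show ?thesis by simp
  qed
  obtain S where S: "finite S" "S \<subseteq> carrier F" "generate F S = carrier F"
    using assms(6) by (auto simp: fin_gen_def)
  obtain R where R: "left_order F R" using assms(7) by (auto simp: left_orderable_def)
  \<comment> \<open>A left order on the nontrivial group \<open>F\<close> provides the nontrivial
    preorder to start from.\<close>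
  have "good ?F {P. preord ?F P \<and> P \<noteq> ?F}"
  proof (rule good_proper_preorders[OF sF])
    show "finite (?c ` S)" "?c ` S \<subseteq> ?F" using S by auto
    show "P = ?F" if P: "preord ?F P" and SP: "\<And>x. x \<in> ?c ` S \<Longrightarrow> x \<in> P \<and> - x \<in> P" for P
    proof -
      have "x \<in> carrier F \<and> ?c x \<in> P" if "x \<in> generate F S" for x
        using that
      proof (induction rule: generate.induct)
        case one
        then show ?case using cone_zero[OF sF P] F.cay_one by simp
      next
        case (incl h)
        then show ?case using SP S by auto
      next
        case (inv h)
        then show ?case using SP S F.cay_inv[of h] by auto
      next
        case (eng g h)
        then show ?case using cone_add[OF sF P] F.cay_mult[of g h] by simp
      qed
      then show ?thesis using P S(3) by (auto simp: preord_def)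
    qed
    let ?P = "{?c x | x. x \<in> carrier F \<and> (\<one>\<^bsub>F\<^esub>, x) \<in> R}"
    show "preord ?F ?P" by (rule F.preord_of_left_order(1)[OF R])
    show "?P \<noteq> ?F"
    proof
      assume eq: "?P = ?F"
      have "x = \<one>\<^bsub>F\<^esub>" if x: "x \<in> carrier F" for x
      proof -
        have "?c x \<in> ?F" "- ?c x \<in> ?F" using x sgp_minus[OF sF] by blast+
        then have "?c x = ?c \<one>\<^bsub>F\<^esub>" using F.preord_of_left_order(2)[OF R, of "?c x"] F.cay_one unfolding eq by simp
        then show ?thesis using F.inj_cay x by (auto simp: inj_on_def)
      qed
      then show False using assms(5) F.one_closed by blast
    qed
  qed
  then obtain P where P: "preord ?F P" "P \<noteq> ?F" "arch ?G (P \<inter> ?G)"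
    using tame_has_arch[OF tame sF _ sG(2)] by (auto simp: has_arch_def)
  obtain \<tau> :: "'a sym \<Rightarrow> real" where "\<forall>x\<in>?G. \<forall>y\<in>?G. \<tau> (x + y) = \<tau> x + \<tau> y"
    and "\<forall>x\<in>?G. x \<in> P \<inter> ?G \<longleftrightarrow> 0 \<le> \<tau> x"
    using arch_hom[OF sG(1) cone_restrict[OF P(1) sG] P(3)] by blast
  then have \<tau>: "\<And>x y. x \<in> ?G \<Longrightarrow> y \<in> ?G \<Longrightarrow> \<tau> (x + y) = \<tau> x + \<tau> y"
    and sg: "\<And>x. x \<in> ?G \<Longrightarrow> x \<in> P \<longleftrightarrow> 0 \<le> \<tau> x" by blast+
  define t where "t = (\<lambda>x. \<tau> (?c x))"
  have GGs: "carrier GG = G" "x \<otimes>\<^bsub>GG\<^esub> y = x \<otimes>\<^bsub>F\<^esub> y" for x y by (simp_all add: GG_def)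
  have t: "t (x \<otimes>\<^bsub>GG\<^esub> y) = t x + t y" if "x \<in> carrier GG" "y \<in> carrier GG" for x y
    using that \<tau> F.cay_mult[of x y] by (simp add: t_def GGs)
  define B where "B = {x \<in> carrier F. ?c x \<in> P \<and> - ?c x \<in> P}"
  have BG: "B \<inter> G = {x \<in> carrier GG. t x = 0}"
  proof -
    have "?c x \<in> P \<and> - ?c x \<in> P \<longleftrightarrow> t x = 0" if "x \<in> G" for x
    proof -
      have "?c x \<in> ?G" "- ?c x \<in> ?G" using that sgp_minus[OF sG(1)] by blast+
      moreover have "\<tau> (- ?c x) = - \<tau> (?c x)" using hom_zero_minus(2)[OF sG(1), of \<tau>] \<tau> that by blast
      ultimately show ?thesis using sg by (auto simp: t_def)
    qed
    then show ?thesis by (auto simp: B_def GGs)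
  qed
  have nor: "B \<inter> G \<lhd> GG" and com: "comm_group (GG Mod (B \<inter> G))" and tf: "torsion_free (GG Mod (B \<inter> G))"
    using GG.FactGroup_real_hom[of t, OF t BG] by blast+
  \<comment> \<open>The zero homomorphism, with kernel \<open>G\<close>, takes care of the quotient
    by \<open>A = G\<close>.\<close>
  have triv: "G = {x \<in> carrier GG. (\<lambda>_. 0 :: real) x = 0}" by (simp add: GGs)
  have nor': "G \<lhd> GG" and com': "comm_group (GG Mod G)" and tf': "torsion_free (GG Mod G)"
    by (rule GG.FactGroup_real_hom[OF _ triv], simp)+
  interpret Q: comm_group "GG Mod (B \<inter> G)" by (rule com)
  let ?AQ = "(\<lambda>a. (B \<inter> G) #>\<^bsub>GG\<^esub> a) ` G"
  have AQ: "?AQ = carrier (GG Mod (B \<inter> G))" by (auto simp: FactGroup_def RCOSETS_def GGs)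
  have "\<forall>x\<in>carrier (GG Mod (B \<inter> G)). \<forall>a\<in>carrier (GG Mod (B \<inter> G)).
    x \<otimes>\<^bsub>GG Mod (B \<inter> G)\<^esub> a = a \<otimes>\<^bsub>GG Mod (B \<inter> G)\<^esub> x"
    by (intro ballI Q.m_comm)
  then have cen: "centralizer_of (GG Mod (B \<inter> G)) ?AQ = ?AQ"
    unfolding AQ centralizer_of_def by blast
  have lrc: "left_rel_convex F B" unfolding B_def by (rule F.left_rel_convex_stabilizer[OF P(1) assms(7)])
  have proper: "B \<noteq> carrier F" using P(1,2) by (auto simp: B_def preord_def)
  have sub: "subgroup G GG" using GG.subgroup_self by (simp add: GGs)
  have norQ: "?AQ \<lhd> GG Mod (B \<inter> G)" unfolding AQ by (rule Q.normal_self)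
  have eq: "(GG Mod (B \<inter> G))\<lparr>carrier := ?AQ\<rparr> = GG Mod (B \<inter> G)" unfolding AQ by simp
  show ?thesis
    unfolding Let_def GG_def[symmetric]
    by (intro exI[of _ B] conjI exI[of _ G] Int_lower2 lrc proper nor sub norQ cen nor' com' tf')
      (simp_all only: eq com tf)
qed

end
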